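(* Let $\Gamma$ be a finitely generated, infinite group and let $\mathcal G$ be the Cayley graph of $\Gamma$ with respect to a finite symmetric generating set. Then $\Gamma$ has the Haagerup property if and only if for every $\alpha<1$ there exists a $\Gamma$-invariant site percolation $\mathbb P$ on $\mathcal G$ such that $\mathbb P[o\in\omega]>\alpha$ and the two-point function $\tau(o,\cdot)$ vanishes at infinity.
   Context: Right Cayley graph: vertex set $\Gamma$, edges $[g,gs]$, $g\in\Gamma$, $s\in S$, with $S$ a finite symmetric generating set; $o$ is the identity, $d$ the graph distance. $\Gamma$ acts by left multiplication. A site percolation on $\mathcal G$ is a probability measure $\mathbb P$ on subsets $\omega$ of the vertex set $\Gamma$; it is $\Gamma$-invariant if invariant under the induced action of $\Gamma$. The configuration $\omega$ is identified with the subgraph of $\mathcal G$ induced by $\omega$, whose connected components are the clusters. $\tau(g,h)=\mathbb P[g\leftrightarrow h]$ is the probability that $g$ and $h$ both belong to $\omega$ and lie in the same cluster. $\tau(o,\cdot)$ vanishes at infinity (written $\tau(o,\cdot)\in C_0(\Gamma)$) if $\lim_{r\to\infty}\sup_{d(g,h)>r}\tau(g,h)=0$. $\Gamma$ has the Haagerup property if it admits an affine isometric action on a Hilbert space $H$ which is metrically proper, i.e. for every bounded $B\subset H$ the set $\{g\in\Gamma:gB\cap B\ne\emptyset\}$ is finite. *)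

theory Defs
  imports
    "HOL-Probability.Probability"
    "HOL-Algebra.Generated_Groups"
    "HOL-Algebra.Group_Action"
    "HOL-Algebra.Algebraic_Closure_Type"
begin

section \<open>Cayley graphs and clusters\<close>

definition generating_set :: "('a, 'b) monoid_scheme \<Rightarrow> 'a set \<Rightarrow> bool" where
  "generating_set G S \<longleftrightarrow> S \<subseteq> carrier G \<and> generate G S = carrier G"

definition symmetric_set :: "('a, 'b) monoid_scheme \<Rightarrow> 'a set \<Rightarrow> bool" where
  "symmetric_set G S \<longleftrightarrow> (\<forall>s\<in>S. inv\<^bsub>G\<^esub> s \<in> S)"

text \<open>For symmetric \<open>S\<close> this is a symmetric relation, so that the undirected edge \<open>[g, gs]\<close>
  is represented by both of its orientations.\<close>

definition cayley_edges :: "('a, 'b) monoid_scheme \<Rightarrow> 'a set \<Rightarrow> ('a \<times> 'a) set" where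
  "cayley_edges G S = {(g, g \<otimes>\<^bsub>G\<^esub> s) | g s. g \<in> carrier G \<and> s \<in> S}"

definition cayley_dist :: "('a, 'b) monoid_scheme \<Rightarrow> 'a set \<Rightarrow> 'a \<Rightarrow> 'a \<Rightarrow> nat" where
  "cayley_dist G S g h = (LEAST n. (g, h) \<in> cayley_edges G S ^^ n)"

text \<open>The connected components of the subgraph induced by \<open>\<omega>\<close>.\<close>

definition clusters :: "('a, 'b) monoid_scheme \<Rightarrow> 'a set \<Rightarrow> 'a set \<Rightarrow> 'a set set" where
  "clusters G S \<omega> = \<omega> // (Restr (cayley_edges G S) \<omega>)\<^sup>*"

section \<open>Site percolation\<close>

text \<open>The product \<open>\<sigma>\<close>-algebra on the set of all subsets of the group.\<close>

definition config_space :: "('a, 'b) monoid_scheme \<Rightarrow> 'a set measure" where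
  "config_space G =
     sigma (Pow (carrier G)) ((\<lambda>g. {\<omega> \<in> Pow (carrier G). g \<in> \<omega>}) ` carrier G)"

definition site_percolation :: "('a, 'b) monoid_scheme \<Rightarrow> 'a set measure \<Rightarrow> bool" where
  "site_percolation G P \<longleftrightarrow> prob_space P \<and> sets P = sets (config_space G)"

definition invariant_percolation :: "('a, 'b) monoid_scheme \<Rightarrow> 'a set measure \<Rightarrow> bool" where
  "invariant_percolation G P \<longleftrightarrow> site_percolation G P \<and>
     (\<forall>g\<in>carrier G. distr P (config_space G) (\<lambda>\<omega>. g <#\<^bsub>G\<^esub> \<omega>) = P)"

definition two_point ::
    "('a, 'b) monoid_scheme \<Rightarrow> 'a set \<Rightarrow> 'a set measure \<Rightarrow> 'a \<Rightarrow> 'a \<Rightarrow> real" where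
  "two_point G S P g h = measure P {\<omega> \<in> space P. \<exists>C\<in>clusters G S \<omega>. g \<in> C \<and> h \<in> C}"

definition vanishes_at_infinity ::
    "('a, 'b) monoid_scheme \<Rightarrow> 'a set \<Rightarrow> ('a \<Rightarrow> 'a \<Rightarrow> real) \<Rightarrow> bool" where
  "vanishes_at_infinity G S \<tau> \<longleftrightarrow>
     ((\<lambda>r::real. SUP (g, h) \<in> {(g, h). g \<in> carrier G \<and> h \<in> carrier G \<and>
          real (cayley_dist G S g h) > r}. \<tau> g h) \<longlongrightarrow> 0) at_top"

section \<open>Hilbert spaces\<close>

text \<open>A property of a group that quantifies existentially over Hilbert spaces needs Hilbert spaces
  as objects with an explicit carrier, rather than the type classes \<open>real_inner\<close> and
  \<open>complete_space\<close>. As for every \<open>module\<close>, the multiplicative fields inherited from the record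
  \<open>ring\<close> are irrelevant.\<close>

record 'h inner_space = "(real, 'h) module" +
  ip :: "'h \<Rightarrow> 'h \<Rightarrow> real"

text \<open>The distance is set to 0 outside the carrier because \<open>Metric_space\<close> demands symmetry and
  nonnegativity everywhere.\<close>

definition ip_dist :: "('h, 'm) inner_space_scheme \<Rightarrow> 'h \<Rightarrow> 'h \<Rightarrow> real" where
  "ip_dist H x y = (if x \<in> carrier H \<and> y \<in> carrier H
     then sqrt (ip H (x \<ominus>\<^bsub>H\<^esub> y) (x \<ominus>\<^bsub>H\<^esub> y)) else 0)"

locale inner_product_space = module "ring_of_type_algebra :: real ring" H
  for H :: "('h, 'm) inner_space_scheme" (structure) +
  assumes ip_commute: "\<lbrakk>x \<in> carrier H; y \<in> carrier H\<rbrakk> \<Longrightarrow> ip H x y = ip H y x"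
    and ip_add_left: "\<lbrakk>x \<in> carrier H; y \<in> carrier H; z \<in> carrier H\<rbrakk>
      \<Longrightarrow> ip H (x \<oplus>\<^bsub>H\<^esub> y) z = ip H x z + ip H y z"
    and ip_smult_left: "\<lbrakk>x \<in> carrier H; y \<in> carrier H\<rbrakk>
      \<Longrightarrow> ip H (c \<odot>\<^bsub>H\<^esub> x) y = c * ip H x y"
    and ip_nonneg: "x \<in> carrier H \<Longrightarrow> 0 \<le> ip H x x"
    and ip_eq_zero: "\<lbrakk>x \<in> carrier H; ip H x x = 0\<rbrakk> \<Longrightarrow> x = \<zero>\<^bsub>H\<^esub>"

context inner_product_space
begin

lemma carrier_real [simp]: "c \<in> carrier (ring_of_type_algebra :: real ring)"
  by (simp add: ring_of_type_algebra_def)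

lemma ip_zero_left: "y \<in> carrier H \<Longrightarrow> ip H \<zero>\<^bsub>H\<^esub> y = 0"
  using ip_add_left[of "\<zero>\<^bsub>H\<^esub>" "\<zero>\<^bsub>H\<^esub>" y] by simp

lemma ip_uminus_left:
  assumes "x \<in> carrier H" "y \<in> carrier H"
  shows "ip H (\<ominus>\<^bsub>H\<^esub> x) y = - ip H x y"
  using ip_add_left[of x "\<ominus>\<^bsub>H\<^esub> x" y] ip_zero_left[of y] assms by (simp add: M.r_neg)

lemma ip_add_right:
  assumes "x \<in> carrier H" "y \<in> carrier H" "z \<in> carrier H"
  shows "ip H z (x \<oplus>\<^bsub>H\<^esub> y) = ip H z x + ip H z y"
  using ip_add_left[of x y z] ip_commute[of z] assms by simp

lemma ip_smult_right:
  assumes "x \<in> carrier H" "y \<in> carrier H"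
  shows "ip H x (c \<odot>\<^bsub>H\<^esub> y) = c * ip H x y"
  using ip_smult_left[of y x c] ip_commute[of x] assms by simp

lemma ip_Cauchy_Schwarz:
  assumes [simp]: "x \<in> carrier H" "y \<in> carrier H"
  shows "ip H x y \<le> sqrt (ip H x x) * sqrt (ip H y y)"
proof -
  have expand: "ip H ((a \<odot>\<^bsub>H\<^esub> x) \<oplus>\<^bsub>H\<^esub> (b \<odot>\<^bsub>H\<^esub> y)) ((a \<odot>\<^bsub>H\<^esub> x) \<oplus>\<^bsub>H\<^esub> (b \<odot>\<^bsub>H\<^esub> y)) =
      a\<^sup>2 * ip H x x + 2 * a * b * ip H x y + b\<^sup>2 * ip H y y" for a b
    by (simp add: ip_add_left ip_add_right ip_smult_left ip_smult_right ip_commute[of y x]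
        power2_eq_square algebra_simps)
  have nn: "0 \<le> a\<^sup>2 * ip H x x + 2 * a * b * ip H x y + b\<^sup>2 * ip H y y" for a b
    unfolding expand[symmetric] by (rule ip_nonneg) simp
  have "(ip H x y)\<^sup>2 \<le> ip H x x * ip H y y"
  proof (cases "ip H y y = 0")
    case True
    then have "y = \<zero>\<^bsub>H\<^esub>" by (simp add: ip_eq_zero)
    then show ?thesis using True ip_zero_left[of x] ip_commute[of x y] by simp
  next
    case False
    then have pos: "ip H y y > 0" using ip_nonneg[of y] by simp
    have "0 \<le> ip H y y * (ip H x x * ip H y y - (ip H x y)\<^sup>2)"
      using nn[of "ip H y y" "- ip H x y"] by (simp add: power2_eq_square algebra_simps)
    then show ?thesis using pos by (simp add: zero_le_mult_iff)
  qed
  then show ?thesis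
    by (metis real_le_rsqrt real_sqrt_mult)
qed

lemma ip_dist_Metric_space: "Metric_space (carrier H) (ip_dist H)"
proof
  fix x y
  show "0 \<le> ip_dist H x y" by (simp add: ip_dist_def ip_nonneg)
  have "ip H (x \<ominus>\<^bsub>H\<^esub> y) (x \<ominus>\<^bsub>H\<^esub> y) = ip H (y \<ominus>\<^bsub>H\<^esub> x) (y \<ominus>\<^bsub>H\<^esub> x)"
    if "x \<in> carrier H" "y \<in> carrier H"
  proof -
    have "y \<ominus>\<^bsub>H\<^esub> x = \<ominus>\<^bsub>H\<^esub> (x \<ominus>\<^bsub>H\<^esub> y)"
      using that by (simp add: M.minus_eq M.minus_add M.a_comm)
    then show ?thesis
      using that by (simp add: ip_uminus_left ip_commute[of "x \<ominus>\<^bsub>H\<^esub> y" "\<ominus>\<^bsub>H\<^esub> (x \<ominus>\<^bsub>H\<^esub> y)"])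
  qed
  then show "ip_dist H x y = ip_dist H y x" by (simp add: ip_dist_def)
next
  fix x y assume [simp]: "x \<in> carrier H" "y \<in> carrier H"
  have "x \<ominus>\<^bsub>H\<^esub> y = \<zero>\<^bsub>H\<^esub> \<longleftrightarrow> x = y"
    by (metis M.add.inv_closed M.minus_eq M.minus_equality M.minus_minus M.r_neg
        \<open>x \<in> carrier H\<close> \<open>y \<in> carrier H\<close>)
  then show "ip_dist H x y = 0 \<longleftrightarrow> x = y"
    using ip_eq_zero[of "x \<ominus>\<^bsub>H\<^esub> y"] ip_zero_left[of "\<zero>\<^bsub>H\<^esub>"]
    by (auto simp: ip_dist_def)
next
  fix x y z assume [simp]: "x \<in> carrier H" "y \<in> carrier H" "z \<in> carrier H"
  define u v where "u = x \<ominus>\<^bsub>H\<^esub> y" and "v = y \<ominus>\<^bsub>H\<^esub> z"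
  have [simp]: "u \<in> carrier H" "v \<in> carrier H" by (simp_all add: u_def v_def)
  have "x \<ominus>\<^bsub>H\<^esub> z = u \<oplus>\<^bsub>H\<^esub> v"
    by (simp add: u_def v_def M.minus_eq M.a_assoc M.r_neg1)
  then have "ip H (x \<ominus>\<^bsub>H\<^esub> z) (x \<ominus>\<^bsub>H\<^esub> z) = ip H u u + 2 * ip H u v + ip H v v"
    by (simp add: ip_add_left ip_add_right ip_commute[of v u])
  also have "\<dots> \<le> (sqrt (ip H u u) + sqrt (ip H v v))\<^sup>2"
    using ip_Cauchy_Schwarz[of u v] by (simp add: power2_sum ip_nonneg)
  finally have "sqrt (ip H (x \<ominus>\<^bsub>H\<^esub> z) (x \<ominus>\<^bsub>H\<^esub> z)) \<le> sqrt (ip H u u) + sqrt (ip H v v)"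
    by (intro real_le_lsqrt) (auto simp: ip_nonneg)
  then show "ip_dist H x z \<le> ip_dist H x y + ip_dist H y z"
    by (simp add: ip_dist_def u_def v_def)
qed

end

locale hilbert_space = inner_product_space +
  assumes complete: "Metric_space.mcomplete (carrier H) (ip_dist H)"

section \<open>The Haagerup property\<close>

definition affine_isometric_action ::
    "('a, 'b) monoid_scheme \<Rightarrow> ('h, 'm) inner_space_scheme \<Rightarrow> ('a \<Rightarrow> 'h \<Rightarrow> 'h) \<Rightarrow> bool" where
  "affine_isometric_action G H \<phi> \<longleftrightarrow> group_action G (carrier H) \<phi> \<and>
     (\<forall>g\<in>carrier G. \<forall>x\<in>carrier H. \<forall>y\<in>carrier H.
        ip_dist H (\<phi> g x) (\<phi> g y) = ip_dist H x y \<and>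
        (\<forall>t::real. \<phi> g (((1 - t) \<odot>\<^bsub>H\<^esub> x) \<oplus>\<^bsub>H\<^esub> (t \<odot>\<^bsub>H\<^esub> y)) =
           ((1 - t) \<odot>\<^bsub>H\<^esub> \<phi> g x) \<oplus>\<^bsub>H\<^esub> (t \<odot>\<^bsub>H\<^esub> \<phi> g y)))"

definition metrically_proper_action ::
    "('a, 'b) monoid_scheme \<Rightarrow> ('h, 'm) inner_space_scheme \<Rightarrow> ('a \<Rightarrow> 'h \<Rightarrow> 'h) \<Rightarrow> bool" where
  "metrically_proper_action G H \<phi> \<longleftrightarrow>
     (\<forall>B. Metric_space.mbounded (carrier H) (ip_dist H) B \<longrightarrow>
        finite {g \<in> carrier G. \<phi> g ` B \<inter> B \<noteq> {}})"

text \<open>The type argument \<open>'h\<close> is the universe in which the carriers of the Hilbert spaces live,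
  since HOL cannot quantify over types inside a formula. A universe \<open>'i + nat \<Rightarrow> real\<close> contains,
  up to isometry, every Hilbert space with an orthonormal basis indexed by a subset of \<open>'i + nat\<close>:
  all separable ones, and any given one for a suitable \<open>'i\<close>. Hilbert spaces are real; a complex one is
  in particular a real one, with the same metric and the same bounded sets, and a real one embeds
  equivariantly in its complexification.\<close>

definition haagerup_property :: "'h itself \<Rightarrow> ('a, 'b) monoid_scheme \<Rightarrow> bool" where
  "haagerup_property (_ :: 'h itself) G \<longleftrightarrow>
     (\<exists>(H :: 'h inner_space) \<phi>. hilbert_space H \<and> affine_isometric_action G H \<phi> \<and>
        metrically_proper_action G H \<phi>)"

end

theory Submission
  imports Defs
begin

text \<open>Both directions pass through an invariant kernel of conditionally negative type
  \<open>D(g, h) = \<parallel>g 0 - h 0\<parallel>\<^sup>2\<close> that is proper, and which determines a proper affine isometric action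
  on the closed affine span of the orbit of \<open>0\<close>.

  Being in the same cluster is a partial equivalence relation, so a two-point function is positive
  semidefinite. Percolations \<open>P\<^sub>n\<close> with \<open>P\<^sub>n[o \<in> \<omega>] > 1 - 2\<^bsup>-n\<^esup>\<close> give the kernel
  \<open>D(g, h) = \<Sum>\<^sub>n (\<tau>\<^sub>n(g, g) + \<tau>\<^sub>n(h, h) - 2 \<tau>\<^sub>n(g, h))\<close>. The series converges because a fixed path
  from \<open>g\<close> to \<open>h\<close> is open with probability \<open>1 - O(2\<^bsup>-n\<^esup>)\<close>, and \<open>D\<close> is proper because each
  \<open>\<tau>\<^sub>n\<close> vanishes at infinity.

  Conversely, let \<open>X\<close> be the centered Gaussian field on the group with \<open>E(X\<^sub>g - X\<^sub>h)\<^sup>2 = D(g, h)\<close>,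
  let \<open>U\<close> be uniform on \<open>[0, 1)\<close> and let \<open>\<kappa>\<close> be a small positive number. The partition of the
  group into the level sets of \<open>\<lfloor>\<kappa> X\<^sub>g + U\<rfloor>\<close> is invariant in law, since the increments of \<open>X\<close> are
  stationary and \<open>U\<close> is uniform modulo \<open>1\<close>. Let \<open>\<omega>\<close> consist of the vertices all of whose
  neighbors lie in the same level set. Its clusters lie in level sets, so \<open>\<tau>(g, h)\<close> is at most the
  probability that \<open>\<kappa> \<bar>X\<^sub>g - X\<^sub>h\<bar> < 1\<close>, which vanishes as \<open>D(g, h) \<rightarrow> \<infinity>\<close>.\<close>

section \<open>Uniqueness of joint laws\<close>

text \<open>Two obstacles shape the proof. On a fixed pair the two-point functions
  \<open>\<tau>\<^sub>n\<close> tend to 1, so their sum diverges. Each is therefore centered at the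
  identity before summation: this keeps it positive semidefinite, leaves the squared distances
  unchanged, and makes the series converge. In the other direction, a kernel centered at the
  identity gives a field that is 0 there, which cannot be invariant in law. Changing the base point
  to x subtracts the random number X_x, which is correlated with the increments. The uniform
  variable is therefore integrated out first, for a fixed sample of the field. What remains depends
  on increments only, and equality of their finite-dimensional laws is enough. These laws are
  compared through covariances, which calls for uniqueness of joint laws given their characteristic
  functions; it is derived here from the one-dimensional theorem. Cholesky vectors have finite
  support, so each field value is a finite sum of independent standard normals.\<close>

lemma (in prob_space) expectation_indicator_eq_if_expectation_cos_eq:
  fixes U U' Z Z' :: "'a \<Rightarrow> real"
  assumes [measurable]: "U \<in> borel_measurable M" "U' \<in> borel_measurable M"
    "Z \<in> borel_measurable M" "Z' \<in> borel_measurable M"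
    and Z: "\<And>x. 0 \<le> Z x" "\<And>x. Z x \<le> B" and Z': "\<And>x. 0 \<le> Z' x" "\<And>x. Z' x \<le> B"
    and eq: "\<And>t c. expectation (\<lambda>x. Z x * (1 + cos (t * U x + c))) =
      expectation (\<lambda>x. Z' x * (1 + cos (t * U' x + c)))"
    and [measurable]: "A \<in> sets borel"
  shows "expectation (\<lambda>x. Z x * indicator A (U x)) = expectation (\<lambda>x. Z' x * indicator A (U' x))"
proof -
  have int: "integrable M (\<lambda>x. Y x * f x)"
    if "\<And>x. 0 \<le> Y x" "\<And>x. Y x \<le> B" "\<And>x. \<bar>f x\<bar> \<le> 2"
      and [measurable]: "Y \<in> borel_measurable M" "f \<in> borel_measurable M" for Y f :: "'a \<Rightarrow> real"
    by (rule integrable_const_bound[where B="B * 2"])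
      (use that in \<open>auto simp: abs_mult intro!: mult_mono AE_I2 order.trans[OF that(1) that(2)]\<close>)
  have int1: "integrable M Y" if "\<And>x. 0 \<le> Y x" "\<And>x. Y x \<le> B"
      and [measurable]: "Y \<in> borel_measurable M" for Y :: "'a \<Rightarrow> real"
    using int[of Y "\<lambda>_. 1"] that by simp
  define m where "m = expectation Z"
  \<comment> \<open>At \<open>t = c = 0\<close> the factor \<open>1 + cos\<close> is 2, so the
    hypothesis compares total masses. Subtracting them leaves the pure cosine integrals of
    \<open>cos_eq\<close>.\<close>
  have m: "expectation Z' = m"
    using eq[of 0 0] by (simp add: m_def)
  have cos_eq: "expectation (\<lambda>x. Z x * cos (t * U x + c)) = expectation (\<lambda>x. Z' x * cos (t * U' x + c))"
    for t c
  proof -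
    have "expectation (\<lambda>x. Y x * (1 + cos (t * W x + c))) =
        expectation Y + expectation (\<lambda>x. Y x * cos (t * W x + c))"
      if "\<And>x. 0 \<le> Y x" "\<And>x. Y x \<le> B"
        and [measurable]: "Y \<in> borel_measurable M" "W \<in> borel_measurable M" for Y W :: "'a \<Rightarrow> real"
    proof -
      have "\<bar>cos z\<bar> \<le> 2" for z :: real
        using abs_cos_le_one[of z] by linarith
      then have "integrable M (\<lambda>x. Y x * cos (t * W x + c))"
        using that by (intro int) auto
      moreover have "integrable M Y" using that by (intro int1)
      ultimately show ?thesis by (simp add: distrib_left)
    qed
    from this[of Z U] this[of Z' U'] show ?thesis
      using Z Z' eq[of t c] by (simp add: m m_def)
  qed
  have m0: "0 \<le> m" unfolding m_def using Z by simp
  show ?thesis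
  \<comment> \<open>Weights of mass 0 cannot be normalized, but then both sides vanish. Otherwise
    \<open>Z / m\<close> and \<open>Z' / m\<close> are probability densities, and the claim is that
    \<open>U\<close> and \<open>U'\<close> have the same law under them.\<close>
  proof (cases "m = 0")
    case True
    have *: "expectation (\<lambda>x. Y x * indicator A (W x)) = 0"
      if "\<And>x. 0 \<le> Y x" "\<And>x. Y x \<le> B" "expectation Y = 0"
        and [measurable]: "Y \<in> borel_measurable M" "W \<in> borel_measurable M" for Y W :: "'a \<Rightarrow> real"
    proof (rule antisym)
      show "expectation (\<lambda>x. Y x * indicator A (W x)) \<le> 0"
        unfolding that(3)[symmetric]
        by (rule integral_mono)
          (use that order.trans[OF Z(1) Z(2)] in \<open>auto simp: indicator_def intro!: int int1\<close>)
    qed (use that in \<open>auto intro!: integral_nonneg_AE\<close>)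
    show ?thesis
      using *[of Z U] *[of Z' U'] Z Z' True m unfolding m_def by auto
  next
    case False
    then have mpos: "0 < m" using m0 by simp
    define \<nu> where "\<nu> Y W = distr (density M (\<lambda>x. ennreal (Y x / m))) borel W" for Y W :: "'a \<Rightarrow> real"
    have int_\<nu>: "integral\<^sup>L (\<nu> Y W) f = expectation (\<lambda>x. Y x * f (W x)) / m"
      if "\<And>x. 0 \<le> Y x" and [measurable]: "Y \<in> borel_measurable M" "W \<in> borel_measurable M"
        "f \<in> borel_measurable borel"
      for Y W and f :: "real \<Rightarrow> real"
      unfolding \<nu>_def using that mpos
      by (simp add: integral_distr integral_density)
    have pr: "real_distribution (\<nu> Y W)"
      if "\<And>x. 0 \<le> Y x" "\<And>x. Y x \<le> B" "expectation Y = m"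
        and [measurable]: "Y \<in> borel_measurable M" "W \<in> borel_measurable M" for Y W
    proof -
      have "integrable M Y" using that by (intro int1)
      then have "integrable M (\<lambda>x. Y x / m)" by simp
      then have "(\<integral>\<^sup>+x. ennreal (Y x / m) \<partial>M) = ennreal (expectation (\<lambda>x. Y x / m))"
        using that(1) mpos by (intro nn_integral_eq_integral) simp_all
      also have "expectation (\<lambda>x. Y x / m) = 1" using that mpos by simp
      finally have "prob_space (density M (\<lambda>x. ennreal (Y x / m)))"
        by (intro prob_spaceI) (auto simp: emeasure_density cong: nn_integral_cong)
      then have "prob_space (\<nu> Y W)"
        unfolding \<nu>_def by (rule prob_space.prob_space_distr) simp
      then show ?thesis
        by (simp add: real_distribution_def real_distribution_axioms_def \<nu>_def)
    qed
    \<comment> \<open>The phase \<open>c\<close> supplies both parts of the characteristic function: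
      0 gives the real part, and \<open>- pi / 2\<close>, which turns the cosine into a sine, the
      imaginary part.\<close>
    have ch: "char (\<nu> Y W) t = Complex (expectation (\<lambda>x. Y x * cos (t * W x + 0)) / m)
        (expectation (\<lambda>x. Y x * cos (t * W x + (- pi / 2))) / m)"
      if "\<And>x. 0 \<le> Y x" "\<And>x. Y x \<le> B" "expectation Y = m"
        and [measurable]: "Y \<in> borel_measurable M" "W \<in> borel_measurable M" for Y W t
    proof -
      interpret \<nu>: real_distribution "\<nu> Y W" using that by (rule pr)
      have i: "complex_integrable (\<nu> Y W) (\<lambda>x. iexp (t * x))"
        by (rule \<nu>.integrable_iexp) auto
      have "Re (char (\<nu> Y W) t) = (\<integral>x. cos (t * x) \<partial>\<nu> Y W)"
        unfolding char_def by (subst integral_Re[OF i, symmetric]) (simp add: Re_exp)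
      moreover have "Im (char (\<nu> Y W) t) = (\<integral>x. sin (t * x) \<partial>\<nu> Y W)"
        unfolding char_def by (subst integral_Im[OF i, symmetric]) (simp add: Im_exp)
      moreover have "cos (t * W x + (- pi / 2)) = sin (t * W x)" for x
        by (simp add: cos_diff)
      ultimately show ?thesis
        using that by (simp add: complex_eq_iff int_\<nu>)
    qed
    have "\<nu> Z U = \<nu> Z' U'"
    proof (rule Levy_uniqueness)
      show "real_distribution (\<nu> Z U)" using Z by (intro pr) (auto simp: m_def)
      show "real_distribution (\<nu> Z' U')" using Z' by (intro pr) (auto simp: m)
      show "char (\<nu> Z U) = char (\<nu> Z' U')"
      proof
        fix t show "char (\<nu> Z U) t = char (\<nu> Z' U') t"
          using Z Z' cos_eq[of t 0] cos_eq[of t "- pi / 2"]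
          by (subst (1 2) ch) (auto simp: m m_def[symmetric])
      qed
    qed
    then have "expectation (\<lambda>x. Z x * indicator A (U x)) / m = expectation (\<lambda>x. Z' x * indicator A (U' x)) / m"
      using int_\<nu>[of Z U "indicator A"] int_\<nu>[of Z' U' "indicator A"] Z Z' by simp
    then show ?thesis using mpos by simp
  qed
qed

text \<open>\<open>1 + cos (t x + c)\<close> is a combination of exponentials with frequencies 0, t
  and -t, so a product of such factors only shifts the frequencies of the joint characteristic
  function. The factor \<open>iexp\<close> is there for the induction, which replaces
  \<open>s k\<close> by \<open>s k + t k\<close> and \<open>s k - t k\<close>; the application takes
  \<open>s = 0\<close>.\<close>

lemma (in prob_space) expectation_prod_cos_eq_if_char_eq:
  fixes U Y :: "'k \<Rightarrow> 'a \<Rightarrow> real"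
  assumes K: "finite K"
    and U [measurable]: "\<And>k. k \<in> K \<Longrightarrow> U k \<in> borel_measurable M"
    and Y [measurable]: "\<And>k. k \<in> K \<Longrightarrow> Y k \<in> borel_measurable M"
    and eq: "\<And>s. (CLINT x|M. iexp (\<Sum>k\<in>K. s k * U k x)) = (CLINT x|M. iexp (\<Sum>k\<in>K. s k * Y k x))"
    and F: "F \<subseteq> K"
  shows "(CLINT x|M. of_real (\<Prod>k\<in>F. 1 + cos (t k * U k x + c k)) * iexp (\<Sum>k\<in>K. s k * U k x)) =
    (CLINT x|M. of_real (\<Prod>k\<in>F. 1 + cos (t k * Y k x + c k)) * iexp (\<Sum>k\<in>K. s k * Y k x))"
proof -
  have "finite F" using K F finite_subset by auto
  then show ?thesis using F
  proof (induction F arbitrary: s)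
    case empty
    then show ?case using eq by simp
  next
    case (insert k F)
    have kK: "k \<in> K" using insert by simp
    have expand: "(CLINT x|M. of_real (\<Prod>k\<in>insert k F. 1 + cos (t k * W k x + c k)) * iexp (\<Sum>k\<in>K. s k * W k x)) =
      (CLINT x|M. of_real (\<Prod>k\<in>F. 1 + cos (t k * W k x + c k)) * iexp (\<Sum>k\<in>K. s k * W k x)) +
      iexp (c k) / 2 * (CLINT x|M. of_real (\<Prod>k\<in>F. 1 + cos (t k * W k x + c k)) * iexp (\<Sum>j\<in>K. (s(k := s k + t k)) j * W j x)) +
      iexp (- c k) / 2 * (CLINT x|M. of_real (\<Prod>k\<in>F. 1 + cos (t k * W k x + c k)) * iexp (\<Sum>j\<in>K. (s(k := s k - t k)) j * W j x))"
      if [measurable]: "\<And>k. k \<in> K \<Longrightarrow> W k \<in> borel_measurable M" for W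
    proof -
      have [measurable]: "W k \<in> borel_measurable M" if "k \<in> F" for k
        using that insert.prems by auto
      define P where "P x = (\<Prod>k\<in>F. 1 + cos (t k * W k x + c k))" for x
      have [measurable]: "P \<in> borel_measurable M" unfolding P_def by measurable
      have P: "0 \<le> P x \<and> P x \<le> 2 ^ card F" for x
      proof -
        have "1 + cos z \<ge> 0" "1 + cos z \<le> 2" for z :: real
          using cos_ge_minus_one[of z] cos_le_one[of z] by linarith+
        then show ?thesis
          unfolding P_def using prod_mono[of F "\<lambda>k. 1 + cos (t k * W k x + c k)" "\<lambda>_. 2"]
          by (auto intro!: prod_nonneg)
      qed
      have int: "complex_integrable M (\<lambda>x. of_real (P x) * iexp (\<Sum>k\<in>K. r k * W k x))" for r
        by (rule integrable_const_bound[where B="2 ^ card F"])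
          (use P in \<open>auto simp: norm_mult\<close>)
      have sm: "(\<Sum>j\<in>K. (s(k := s k + d)) j * W j x) = (\<Sum>j\<in>K. s j * W j x) + d * W k x" for d x
      proof -
        have "(\<Sum>j\<in>K. (s(k := s k + d)) j * W j x) = (\<Sum>j\<in>K. s j * W j x + (if j = k then d * W k x else 0))"
          by (rule sum.cong) (auto simp: algebra_simps)
        then show ?thesis using K kK by (simp add: sum.distrib)
      qed
      have pt: "of_real (\<Prod>k\<in>insert k F. 1 + cos (t k * W k x + c k)) * iexp (\<Sum>k\<in>K. s k * W k x) =
        of_real (P x) * iexp (\<Sum>k\<in>K. s k * W k x) +
        iexp (c k) / 2 * (of_real (P x) * iexp (\<Sum>j\<in>K. (s(k := s k + t k)) j * W j x)) +
        iexp (- c k) / 2 * (of_real (P x) * iexp (\<Sum>j\<in>K. (s(k := s k + - t k)) j * W j x))" for x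
      proof -
        have "complex_of_real (cos z) = (iexp z + iexp (- z)) / 2" for z
          by (simp add: cos_of_real[symmetric] cos_exp_eq)
        then have c1: "complex_of_real (1 + cos (t k * W k x + c k)) =
           1 + (iexp (c k) * iexp (t k * W k x) + iexp (- c k) * iexp (- t k * W k x)) / 2"
          by (simp add: exp_add[symmetric] algebra_simps)
        have sh: "iexp ((\<Sum>j\<in>K. s j * W j x) + d * W k x) = iexp (\<Sum>j\<in>K. s j * W j x) * iexp (d * W k x)" for d
          by (simp add: exp_add[symmetric] algebra_simps)
        have P: "(\<Prod>k\<in>insert k F. 1 + cos (t k * W k x + c k)) = (1 + cos (t k * W k x + c k)) * P x"
          unfolding P_def using insert by simp
        have alg: "(1 + (a * b + a' * b') / 2) * p * q =
          p * q + a / 2 * (p * (q * b)) + a' / 2 * (p * (q * b'))" for a b a' b' p q :: complex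
          by (simp add: field_simps)
        show ?thesis unfolding P sm sh of_real_mult c1[unfolded of_real_mult] by (rule alg)
      qed
      define Q where "Q r x = of_real (P x) * iexp (\<Sum>k\<in>K. r k * W k x)" for r x
      have [simp]: "complex_integrable M (Q r)" for r
        using int[of r] unfolding Q_def .
      have "(CLINT x|M. Q s x + iexp (c k) / 2 * Q (s(k := s k + t k)) x + iexp (- c k) / 2 * Q (s(k := s k - t k)) x)
        = (CLINT x|M. Q s x) + iexp (c k) / 2 * (CLINT x|M. Q (s(k := s k + t k)) x) +
          iexp (- c k) / 2 * (CLINT x|M. Q (s(k := s k - t k)) x)"
        by (simp del: fun_upd_apply)
      then show ?thesis unfolding pt Q_def P_def[symmetric] by simp
    qed
    have IH: "(CLINT x|M. of_real (\<Prod>k\<in>F. 1 + cos (t k * U k x + c k)) * iexp (\<Sum>k\<in>K. r k * U k x)) =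
        (CLINT x|M. of_real (\<Prod>k\<in>F. 1 + cos (t k * Y k x + c k)) * iexp (\<Sum>k\<in>K. r k * Y k x))" for r
      using insert.prems insert.IH by simp
    show ?case
      by (simp only: expand[of U] expand[of Y] U Y IH)
  qed
qed

text \<open>Functions \<open>1 + cos (t x + c)\<close> determine finite measures and are nonnegative, so that the
  one-dimensional uniqueness theorem can be applied to one variable at a time.\<close>

lemma (in prob_space) prob_eq_if_joint_char_eq:
  fixes U Y :: "'k \<Rightarrow> 'a \<Rightarrow> real"
  assumes K: "finite K"
    and U [measurable]: "\<And>k. k \<in> K \<Longrightarrow> U k \<in> borel_measurable M"
    and Y [measurable]: "\<And>k. k \<in> K \<Longrightarrow> Y k \<in> borel_measurable M"
    and eq: "\<And>s. (CLINT x|M. iexp (\<Sum>k\<in>K. s k * U k x)) = (CLINT x|M. iexp (\<Sum>k\<in>K. s k * Y k x))"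
    and A: "\<And>k. k \<in> K \<Longrightarrow> A k \<in> sets borel"
  shows "prob {x \<in> space M. \<forall>k\<in>K. U k x \<in> A k} = prob {x \<in> space M. \<forall>k\<in>K. Y k x \<in> A k}"
proof -
  \<comment> \<open>Coordinates in \<open>F\<close> are already tested by indicators, those in
    \<open>K - F\<close> still by cosines. Frequencies and phases stay arbitrary so that those of
    the next coordinate can be varied alone.\<close>
  have "expectation (\<lambda>x. (\<Prod>k\<in>F. indicator (A k) (U k x)) * (\<Prod>k\<in>K - F. 1 + cos (t k * U k x + c k))) =
    expectation (\<lambda>x. (\<Prod>k\<in>F. indicator (A k) (Y k x)) * (\<Prod>k\<in>K - F. 1 + cos (t k * Y k x + c k)))"
    if "finite F" "F \<subseteq> K" for F t c
    using that
  proof (induction F arbitrary: t c)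
    case empty
    have "(CLINT x|M. of_real (\<Prod>k\<in>K. 1 + cos (t k * U k x + c k))) =
      (CLINT x|M. of_real (\<Prod>k\<in>K. 1 + cos (t k * Y k x + c k)))"
      using expectation_prod_cos_eq_if_char_eq[of K U Y K t c "\<lambda>_. 0"] K U Y eq by simp
    then show ?case by (simp only: integral_complex_of_real of_real_eq_iff Diff_empty prod.empty mult_1)
  next
    case (insert k F)
    have kK: "k \<in> K" using insert by simp
    have [simp]: "finite F" "finite (K - insert k F)" using insert K by auto
    have A': "A j \<in> sets borel" "U j \<in> borel_measurable M" "Y j \<in> borel_measurable M"
      if "j \<in> F \<or> j = k \<or> j \<in> K - insert k F" for j
      using that A U Y insert.prems by auto
    note [measurable] = A'
    \<comment> \<open>\<open>Z\<close> gathers the factors of all coordinates but \<open>k\<close>.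
      It is nonnegative and bounded, hence a weight to which the one-dimensional uniqueness
      applies.\<close>
    define Z where "Z W x = (\<Prod>j\<in>F. indicator (A j) (W j x)) * (\<Prod>j\<in>K - insert k F. 1 + cos (t j * W j x + c j))"
      for W :: "'k \<Rightarrow> 'a \<Rightarrow> real" and x
    have Zb: "0 \<le> Z W x" "Z W x \<le> 2 ^ card (K - insert k F)" for W x
    proof -
      have "1 + cos z \<ge> 0" "1 + cos z \<le> 2" for z :: real
        using cos_ge_minus_one[of z] cos_le_one[of z] by linarith+
      then have "0 \<le> (\<Prod>j\<in>K - insert k F. 1 + cos (t j * W j x + c j))"
        "(\<Prod>j\<in>K - insert k F. 1 + cos (t j * W j x + c j)) \<le> 2 ^ card (K - insert k F)"
        using prod_mono[of "K - insert k F" "\<lambda>k. 1 + cos (t k * W k x + c k)" "\<lambda>_. 2"]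
        by (auto intro!: prod_nonneg)
      moreover have "0 \<le> (\<Prod>j\<in>F. indicator (A j) (W j x) :: real)"
        "(\<Prod>j\<in>F. indicator (A j) (W j x) :: real) \<le> 1"
        by (auto intro!: prod_nonneg prod_le_1)
      moreover have "p * q \<le> r" if "0 \<le> p" "p \<le> 1" "0 \<le> q" "q \<le> r" for p q r :: real
        using mult_mono[of p 1 q r] that by simp
      ultimately show "0 \<le> Z W x" "Z W x \<le> 2 ^ card (K - insert k F)"
        unfolding Z_def by auto
    qed
    have [measurable]: "Z U \<in> borel_measurable M" "Z Y \<in> borel_measurable M"
      unfolding Z_def by measurable
    have KF: "K - F = insert k (K - insert k F)" using kK insert.hyps by auto
    have cosZ: "(\<Prod>j\<in>F. indicator (A j) (W j x)) * (\<Prod>j\<in>K - F. 1 + cos ((t(k := t')) j * W j x + (c(k := c')) j))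
        = Z W x * (1 + cos (t' * W k x + c'))" for t' c' x W
    proof -
      have "(\<Prod>j\<in>K - insert k F. 1 + cos ((t(k := t')) j * W j x + (c(k := c')) j)) =
        (\<Prod>j\<in>K - insert k F. 1 + cos (t j * W j x + c j))"
        by (rule prod.cong) auto
      then show ?thesis unfolding KF Z_def using K by simp
    qed
    have "expectation (\<lambda>x. Z U x * indicator (A k) (U k x)) = expectation (\<lambda>x. Z Y x * indicator (A k) (Y k x))"
    proof (rule expectation_indicator_eq_if_expectation_cos_eq)
      show "expectation (\<lambda>x. Z U x * (1 + cos (t' * U k x + c'))) = expectation (\<lambda>x. Z Y x * (1 + cos (t' * Y k x + c')))" for t' c'
        using insert.IH[of "t(k := t')" "c(k := c')"] insert.prems unfolding cosZ by simp
    qed (use Zb in auto)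
    moreover have "(\<Prod>k\<in>insert k F. indicator (A k) (W k x)) * (\<Prod>k\<in>K - insert k F. 1 + cos (t k * W k x + c k)) = Z W x * indicator (A k) (W k x)"
      for W x unfolding Z_def using insert by simp
    ultimately show ?case by simp
  qed
  from this[of K] have 1: "expectation (\<lambda>x. \<Prod>k\<in>K. indicat_real (A k) (U k x)) =
    expectation (\<lambda>x. \<Prod>k\<in>K. indicat_real (A k) (Y k x))"
    using K by simp
  have 2: "expectation (\<lambda>x. \<Prod>k\<in>K. indicat_real (A k) (W k x)) = prob {x \<in> space M. \<forall>k\<in>K. W k x \<in> A k}"
    if [measurable]: "\<And>k. k \<in> K \<Longrightarrow> W k \<in> borel_measurable M" for W
  proof -
    have [measurable]: "{x \<in> space M. \<forall>k\<in>K. W k x \<in> A k} \<in> sets M"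
      using K A by measurable
    have "(\<Prod>k\<in>K. indicat_real (A k) (W k x)) = indicator {x \<in> space M. \<forall>k\<in>K. W k x \<in> A k} x"
      if "x \<in> space M" for x
    proof (cases "\<forall>k\<in>K. W k x \<in> A k")
      case True
      then have "(\<Prod>k\<in>K. indicat_real (A k) (W k x)) = 1"
        by (intro prod.neutral) simp
      then show ?thesis using True that by simp
    next
      case False
      then have "\<exists>k\<in>K. indicat_real (A k) (W k x) = 0" by (metis indicator_simps(2))
      then have "(\<Prod>k\<in>K. indicat_real (A k) (W k x)) = 0"
        using K by (intro prod_zero)
      then show ?thesis using False by simp
    qed
    then have "expectation (\<lambda>x. \<Prod>k\<in>K. indicat_real (A k) (W k x)) =
        expectation (indicator {x \<in> space M. \<forall>k\<in>K. W k x \<in> A k})"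
      by (intro Bochner_Integration.integral_cong) auto
    then show ?thesis by simp
  qed
  have "expectation (\<lambda>x. \<Prod>k\<in>K. indicat_real (A k) (U k x)) = prob {x \<in> space M. \<forall>k\<in>K. U k x \<in> A k}"
    by (rule 2) (rule U)
  moreover have "expectation (\<lambda>x. \<Prod>k\<in>K. indicat_real (A k) (Y k x)) = prob {x \<in> space M. \<forall>k\<in>K. Y k x \<in> A k}"
    by (rule 2) (rule Y)
  ultimately show ?thesis using 1 by simp
qed

section \<open>Positive semidefinite kernels\<close>

definition psd_on :: "'a set \<Rightarrow> ('a \<Rightarrow> 'a \<Rightarrow> real) \<Rightarrow> bool" where
  "psd_on A k \<longleftrightarrow> (\<forall>x\<in>A. \<forall>y\<in>A. k x y = k y x) \<and>
     (\<forall>F c. finite F \<and> F \<subseteq> A \<longrightarrow> 0 \<le> (\<Sum>x\<in>F. \<Sum>y\<in>F. c x * c y * k x y))"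

lemma psd_on_sym: "psd_on A k \<Longrightarrow> x \<in> A \<Longrightarrow> y \<in> A \<Longrightarrow> k x y = k y x"
  by (simp add: psd_on_def)

lemma psd_onD:
  "psd_on A k \<Longrightarrow> finite F \<Longrightarrow> F \<subseteq> A \<Longrightarrow> 0 \<le> (\<Sum>x\<in>F. \<Sum>y\<in>F. c x * c y * k x y)"
  by (simp add: psd_on_def)

lemma psd_on_diag_nonneg:
  assumes "psd_on A k" "x \<in> A"
  shows "0 \<le> k x x"
  using psd_onD[OF assms(1), of "{x}" "\<lambda>_. 1"] assms(2) by simp

text \<open>Positivity of the form at \<open>c\<close> minus \<open>t\<close> times the point mass
  at \<open>n\<close>. Since \<open>n\<close> may lie in \<open>F\<close>, both coefficient families
  are extended by zero to \<open>insert n F\<close> and subtracted there.\<close>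

lemma psd_on_quadratic:
  assumes k: "psd_on A k" and F: "finite F" "F \<subseteq> A" and n: "n \<in> A"
  shows "0 \<le> (\<Sum>x\<in>F. \<Sum>y\<in>F. c x * c y * k x y) - 2 * t * (\<Sum>x\<in>F. c x * k x n) + t\<^sup>2 * k n n"
proof -
  define F' where "F' = insert n F"
  define c0 where "c0 x = (if x \<in> F then c x else 0)" for x
  define d where "d x = (if x = n then t else 0)" for x
  have F': "finite F'" "F' \<subseteq> A" "n \<in> F'" "F \<subseteq> F'" using F n by (auto simp: F'_def)
  have sub: "(\<Sum>x\<in>F'. c0 x * f x) = (\<Sum>x\<in>F. c x * f x)" for f
    by (rule sum.mono_neutral_cong_right) (use F' in \<open>auto simp: c0_def\<close>)
  have del: "(\<Sum>x\<in>F'. d x * f x) = t * f n" for f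
    using F' by (simp add: d_def if_distrib[of "\<lambda>z. z * _"] cong: if_cong)
  have "0 \<le> (\<Sum>x\<in>F'. \<Sum>y\<in>F'. (c0 x - d x) * (c0 y - d y) * k x y)"
    by (rule psd_onD[OF k F'(1,2)])
  also have "\<dots> = (\<Sum>x\<in>F'. c0 x * (\<Sum>y\<in>F'. c0 y * k x y)) - (\<Sum>x\<in>F'. c0 x * (\<Sum>y\<in>F'. d y * k x y))
     - (\<Sum>x\<in>F'. d x * (\<Sum>y\<in>F'. c0 y * k x y)) + (\<Sum>x\<in>F'. d x * (\<Sum>y\<in>F'. d y * k x y))"
    by (simp add: sum_distrib_left sum.distrib sum_subtractf algebra_simps)
  also have "\<dots> = (\<Sum>x\<in>F. c x * (\<Sum>y\<in>F. c y * k x y)) - t * (\<Sum>x\<in>F. c x * k x n) - t * (\<Sum>x\<in>F. c x * k n x) + t\<^sup>2 * k n n"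
    unfolding del sub by (simp add: sum_distrib_left power2_eq_square algebra_simps)
  also have "(\<Sum>x\<in>F. c x * k n x) = (\<Sum>x\<in>F. c x * k x n)"
    using psd_on_sym[OF k] F n by (intro sum.cong) auto
  finally show ?thesis by (simp add: sum_distrib_left algebra_simps)
qed

text \<open>If \<open>k n n\<close> vanishes, the expression in \<open>psd_on_quadratic\<close> is
  affine in \<open>t\<close>, and it can be nonnegative for all \<open>t\<close> only if its slope
  is 0. The \<open>t\<close> in the proof would give it the value -1.\<close>

lemma psd_on_zero_diag:
  assumes k: "psd_on A k" and "x \<in> A" "n \<in> A" "k n n = 0"
  shows "k x n = 0"
proof (rule ccontr)
  assume "k x n \<noteq> 0"
  then show False
    using psd_on_quadratic[OF k, of "{x}" n "\<lambda>_. 1" "(k x x + 1) / (2 * k x n)"] assms by simp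
qed

text \<open>Minimizing the expression of \<open>psd_on_quadratic\<close> over \<open>t\<close>
  yields the form of the Schur complement; the minimum is at \<open>t = b / k n n\<close>, with
  \<open>b\<close> as in the proof. For a zero pivot the quotient is 0 and the kernel is
  unchanged.\<close>

lemma psd_on_schur:
  assumes k: "psd_on A k" and n: "n \<in> A"
  shows "psd_on A (\<lambda>x y. k x y - k x n * k y n / k n n)"
  unfolding psd_on_def
proof (intro conjI ballI allI impI)
  fix x y assume "x \<in> A" "y \<in> A"
  then show "k x y - k x n * k y n / k n n = k y x - k y n * k x n / k n n"
    using psd_on_sym[OF k] by simp
next
  fix F and c :: "'a \<Rightarrow> real" assume F: "finite F \<and> F \<subseteq> A"
  show "0 \<le> (\<Sum>x\<in>F. \<Sum>y\<in>F. c x * c y * (k x y - k x n * k y n / k n n))"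
  proof (cases "k n n = 0")
    case True
    then show ?thesis using psd_onD[OF k] F by simp
  next
    case False
    define b where "b = (\<Sum>x\<in>F. c x * k x n)"
    have "(\<Sum>x\<in>F. \<Sum>y\<in>F. c x * c y * (k x y - k x n * k y n / k n n)) =
      (\<Sum>x\<in>F. \<Sum>y\<in>F. c x * c y * k x y) - (\<Sum>x\<in>F. \<Sum>y\<in>F. (c x * k x n) * (c y * k y n)) / k n n"
      by (simp add: sum_subtractf sum_divide_distrib algebra_simps)
    also have "(\<Sum>x\<in>F. \<Sum>y\<in>F. (c x * k x n) * (c y * k y n)) = b * b"
      unfolding b_def by (simp add: sum_product)
    also have "(\<Sum>x\<in>F. \<Sum>y\<in>F. c x * c y * k x y) - b * b / k n n =
      (\<Sum>x\<in>F. \<Sum>y\<in>F. c x * c y * k x y) - 2 * (b / k n n) * b + (b / k n n)\<^sup>2 * k n n"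
      using False by (simp add: power2_eq_square field_simps)
    also have "\<dots> \<ge> 0"
      unfolding b_def using psd_on_quadratic[OF k] F n by blast
    finally show ?thesis .
  qed
qed

text \<open>The residual of \<open>k\<close> after elimination of the pivots
  \<open>a 0, ..., a (n - 1)\<close>.\<close>

primrec schur :: "(nat \<Rightarrow> 'a) \<Rightarrow> ('a \<Rightarrow> 'a \<Rightarrow> real) \<Rightarrow> nat \<Rightarrow> 'a \<Rightarrow> 'a \<Rightarrow> real" where
  "schur a k 0 = k"
| "schur a k (Suc n) = (\<lambda>x y. schur a k n x y -
     schur a k n x (a n) * schur a k n y (a n) / schur a k n (a n) (a n))"

text \<open>Cholesky decomposition: the vectors are the rows of the triangular factor. A zero pivot needs
  no special treatment, since its column then vanishes and \<open>x / 0 = 0\<close>.\<close>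

lemma psd_on_gram:
  assumes k: "psd_on A k" and A: "countable A" "A \<noteq> {}"
  shows "\<exists>(v :: 'a \<Rightarrow> nat \<Rightarrow> real) N. (\<forall>x\<in>A. \<forall>l\<ge>N x. v x l = 0) \<and>
    (\<forall>x\<in>A. \<forall>y\<in>A. k x y = (\<Sum>l<N x. v x l * v y l))"
proof -
  define a where "a = from_nat_into A"
  have aA [simp]: "a n \<in> A" for n using A by (simp add: a_def from_nat_into)
  have psd: "psd_on A (schur a k n)" for n
    by (induction n) (simp_all add: k psd_on_schur)
  define v where "v x n = schur a k n x (a n) / sqrt (schur a k n (a n) (a n))" for x n
  \<comment> \<open>The row of an eliminated pivot becomes zero and stays so. This covers points
    that the enumeration repeats: their later pivots are 0.\<close>
  have zero: "schur a k n (a i) y = 0" if "i < n" "y \<in> A" for n i y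
    using that
  proof (induction n arbitrary: y)
    case (Suc n)
    show ?case
    proof (cases "i < n")
      case True
      then show ?thesis using Suc by simp
    next
      case False
      then have "i = n" using Suc by simp
      then show ?thesis
        using psd_on_sym[OF psd, of y "a n" n] psd_on_zero_diag[OF psd, of y "a n" n] Suc.prems
        by (cases "schur a k n (a n) (a n) = 0") auto
    qed
  qed simp
  have dec: "k x y = (\<Sum>l<n. v x l * v y l) + schur a k n x y" if "x \<in> A" "y \<in> A" for x y n
    using psd_on_diag_nonneg[OF psd aA]
    by (induction n) (simp_all add: v_def)
  \<comment> \<open>One past an index of \<open>x\<close>: once \<open>x\<close> is eliminated its
    residual row is 0, so its vector ends there and the decomposition at \<open>x\<close> is exact.
    This finite support later makes every field value a finite sum.\<close>
  define N where "N x = Suc (SOME i. a i = x)" for x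
  have N: "a (N x - 1) = x" if "x \<in> A" for x
    unfolding N_def using from_nat_into_surj[OF A(1) that] by (auto simp: a_def intro: someI_ex)
  show ?thesis
  proof (intro exI[of _ v] exI[of _ N] conjI ballI allI impI)
    fix x l assume "x \<in> A" "N x \<le> l"
    then show "v x l = 0"
      using zero[of "N x - 1" l "a l"] N[of x] by (simp add: v_def N_def)
  next
    fix x y assume "x \<in> A" "y \<in> A"
    then show "k x y = (\<Sum>l<N x. v x l * v y l)"
      using zero[of "N x - 1" "N x" y] N[of x] dec[of x y "N x"] by (simp add: N_def)
  qed
qed

section \<open>Square-summable sequences\<close>

text \<open>The vectors of \<open>psd_on_gram\<close> have finite support, but the closed span of an
  orbit has to be taken in a complete space. As a subtype of \<open>nat \<Rightarrow> real\<close>,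
  this one embeds into the universe \<open>'i + nat \<Rightarrow> real\<close>.\<close>

typedef l2 = "{x :: nat \<Rightarrow> real. summable (\<lambda>i. (x i)\<^sup>2)}"
  by (rule exI[of _ "\<lambda>_. 0"]) simp

setup_lifting type_definition_l2

lemma summable_l2_mult:
  assumes "summable (\<lambda>i. (x i)\<^sup>2)" "summable (\<lambda>i. (y i)\<^sup>2)"
  shows "summable (\<lambda>i. x i * y i :: real)"
proof (rule summable_comparison_test')
  show "summable (\<lambda>i. (x i)\<^sup>2 + (y i)\<^sup>2)" using assms by (rule summable_add)
  show "norm (x n * y n) \<le> (x n)\<^sup>2 + (y n)\<^sup>2" for n
    using sum_squares_bound[of "\<bar>x n\<bar>" "\<bar>y n\<bar>"] abs_ge_zero[of "x n * y n"]
    unfolding real_norm_def abs_mult power2_abs by linarith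
qed

lemma summable_l2_add:
  assumes "summable (\<lambda>i. (x i)\<^sup>2)" "summable (\<lambda>i. (y i)\<^sup>2)"
  shows "summable (\<lambda>i. (x i + y i :: real)\<^sup>2)"
  unfolding power2_sum using assms summable_l2_mult[OF assms]
  by (intro summable_add) (simp_all add: mult.assoc)

instantiation l2 :: real_inner
begin

lift_definition zero_l2 :: l2 is "\<lambda>_. 0" by simp
lift_definition plus_l2 :: "l2 \<Rightarrow> l2 \<Rightarrow> l2" is "\<lambda>x y i. x i + y i" by (rule summable_l2_add)
lift_definition uminus_l2 :: "l2 \<Rightarrow> l2" is "\<lambda>x i. - x i" by simp
lift_definition minus_l2 :: "l2 \<Rightarrow> l2 \<Rightarrow> l2" is "\<lambda>x y i. x i - y i"
  subgoal for x y using summable_l2_add[of x "\<lambda>i. - y i"] by simp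
  done
lift_definition scaleR_l2 :: "real \<Rightarrow> l2 \<Rightarrow> l2" is "\<lambda>c x i. c * x i"
  by (simp add: power_mult_distrib)
lift_definition inner_l2 :: "l2 \<Rightarrow> l2 \<Rightarrow> real" is "\<lambda>x y. \<Sum>i. x i * y i" .

definition norm_l2 :: "l2 \<Rightarrow> real" where "norm_l2 x = sqrt (inner x x)"
definition dist_l2 :: "l2 \<Rightarrow> l2 \<Rightarrow> real" where "dist_l2 x y = norm (x - y)"
definition sgn_l2 :: "l2 \<Rightarrow> l2" where "sgn_l2 x = inverse (norm x) *\<^sub>R x"
definition uniformity_l2 :: "(l2 \<times> l2) filter" where
  "uniformity_l2 = (INF e\<in>{0 <..}. principal {(x, y). dist x y < e})"
definition open_l2 :: "l2 set \<Rightarrow> bool" where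
  "open_l2 U \<longleftrightarrow> (\<forall>x\<in>U. \<forall>\<^sub>F (x', y) in uniformity. x' = x \<longrightarrow> y \<in> U)"

instance
proof
  fix x y z :: l2 and a b :: real
  show "x + y + z = x + (y + z)" "x + y = y + x" "0 + x = x" "- x + x = 0" "x - y = x + - y"
    "a *\<^sub>R (x + y) = a *\<^sub>R x + a *\<^sub>R y" "(a + b) *\<^sub>R x = a *\<^sub>R x + b *\<^sub>R x"
    "a *\<^sub>R b *\<^sub>R x = (a * b) *\<^sub>R x" "1 *\<^sub>R x = x"
    by (transfer, simp add: algebra_simps fun_eq_iff)+
  show "dist x y = norm (x - y)" "sgn x = inverse (norm x) *\<^sub>R x"
    "uniformity = (INF e\<in>{0 <..}. principal {(x :: l2, y). dist x y < e})"
    "norm x = sqrt (inner x x)"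
    "open U \<longleftrightarrow> (\<forall>x\<in>U. \<forall>\<^sub>F (x', y) in uniformity. x' = x \<longrightarrow> y \<in> U)" for U :: "l2 set"
    by (simp_all add: dist_l2_def sgn_l2_def uniformity_l2_def norm_l2_def open_l2_def)
  show "inner x y = inner y x" by transfer (simp add: mult.commute)
  show "inner (x + y) z = inner x z + inner y z"
    by transfer (simp add: distrib_right suminf_add[symmetric] summable_l2_mult)
  show "inner (a *\<^sub>R x) y = a * inner x y"
    by transfer (simp add: mult.assoc suminf_mult summable_l2_mult)
  show "0 \<le> inner x x"
    by transfer (auto simp: power2_eq_square intro: suminf_nonneg)
  show "inner x x = 0 \<longleftrightarrow> x = 0"
  proof transfer
    fix x :: "nat \<Rightarrow> real" assume "summable (\<lambda>i. (x i)\<^sup>2)"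
    then show "(\<Sum>i. x i * x i) = 0 \<longleftrightarrow> x = (\<lambda>_. 0)"
      using suminf_eq_zero_iff[of "\<lambda>i. (x i)\<^sup>2"] by (auto simp: power2_eq_square)
  qed
qed

end

lemma norm_l2_sqr: "(norm x)\<^sup>2 = (\<Sum>i. (Rep_l2 x i)\<^sup>2)"
  unfolding power2_norm_eq_inner inner_l2.rep_eq by (simp add: power2_eq_square)

lemma summable_Rep_l2: "summable (\<lambda>i. (Rep_l2 x i)\<^sup>2)"
  using Rep_l2[of x] by simp

lemma sum_Rep_l2_le: "(\<Sum>i<n. (Rep_l2 x i)\<^sup>2) \<le> (norm x)\<^sup>2"
  unfolding norm_l2_sqr by (rule sum_le_suminf) (simp_all add: summable_Rep_l2)

lemma abs_Rep_l2_le: "\<bar>Rep_l2 x i\<bar> \<le> norm x"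
proof -
  have "(Rep_l2 x i)\<^sup>2 \<le> (\<Sum>i<Suc i. (Rep_l2 x i)\<^sup>2)"
    by (rule member_le_sum) auto
  also have "\<dots> \<le> (norm x)\<^sup>2" by (rule sum_Rep_l2_le)
  finally show ?thesis by (simp add: abs_le_square_iff[symmetric])
qed

instance l2 :: complete_space
proof
  fix U :: "nat \<Rightarrow> l2" assume U: "Cauchy U"
  have "Cauchy (\<lambda>n. Rep_l2 (U n) i)" for i
  proof (rule metric_CauchyI)
    fix e :: real assume "0 < e"
    then obtain M where M: "\<And>m n. M \<le> m \<Longrightarrow> M \<le> n \<Longrightarrow> dist (U m) (U n) < e"
      using metric_CauchyD[OF U \<open>0 < e\<close>] by blast
    have "dist (Rep_l2 (U m) i) (Rep_l2 (U n) i) < e" if "M \<le> m" "M \<le> n" for m n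
      using abs_Rep_l2_le[of "U m - U n" i] M[OF that]
      by (simp add: dist_norm minus_l2.rep_eq)
    then show "\<exists>M. \<forall>m\<ge>M. \<forall>n\<ge>M. dist (Rep_l2 (U m) i) (Rep_l2 (U n) i) < e" by blast
  qed
  then obtain y where y: "(\<lambda>n. Rep_l2 (U n) i) \<longlonglongrightarrow> y i" for i
    unfolding Cauchy_convergent_iff convergent_def by metis
  \<comment> \<open>The limit in \<open>n\<close> is taken in partial sums of fixed length,
    coordinate by coordinate; only then does the length grow, so no limits are interchanged.\<close>
  have bound: "summable (\<lambda>i. (Rep_l2 (U m) i - y i)\<^sup>2) \<and> (\<Sum>i. (Rep_l2 (U m) i - y i)\<^sup>2) \<le> e\<^sup>2"
    if M: "\<And>n. m \<le> n \<Longrightarrow> dist (U m) (U n) < e" for m e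
  proof -
    have "(\<Sum>i<k. (Rep_l2 (U m) i - y i)\<^sup>2) \<le> e\<^sup>2" for k
    proof (rule LIMSEQ_le_const2)
      show "(\<lambda>n. \<Sum>i<k. (Rep_l2 (U m) i - Rep_l2 (U n) i)\<^sup>2) \<longlonglongrightarrow> (\<Sum>i<k. (Rep_l2 (U m) i - y i)\<^sup>2)"
        by (intro tendsto_intros y)
      have "(\<Sum>i<k. (Rep_l2 (U m) i - Rep_l2 (U n) i)\<^sup>2) \<le> e\<^sup>2" if "m \<le> n" for n
      proof -
        have "(\<Sum>i<k. (Rep_l2 (U m) i - Rep_l2 (U n) i)\<^sup>2) \<le> (norm (U m - U n))\<^sup>2"
          using sum_Rep_l2_le[of "U m - U n" k] by (simp add: minus_l2.rep_eq)
        also have "\<dots> \<le> e\<^sup>2"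
          using M[OF that] by (intro power_mono) (auto simp: dist_norm)
        finally show ?thesis .
      qed
      then show "\<exists>N. \<forall>n\<ge>N. (\<Sum>i<k. (Rep_l2 (U m) i - Rep_l2 (U n) i)\<^sup>2) \<le> e\<^sup>2" by blast
    qed
    then show ?thesis
      by (auto intro!: suminf_le_const summableI_nonneg_bounded)
  qed
  have sy: "summable (\<lambda>i. (y i)\<^sup>2)"
  proof -
    obtain M where M: "\<And>n. M \<le> n \<Longrightarrow> dist (U M) (U n) < 1"
      using metric_CauchyD[OF U, of 1] by force
    have "summable (\<lambda>i. (Rep_l2 (U M) i - y i)\<^sup>2)" using bound[OF M] by blast
    then have "summable (\<lambda>i. (y i - Rep_l2 (U M) i)\<^sup>2)" by (simp add: power2_commute)
    from summable_l2_add[OF this summable_Rep_l2[of "U M"]] show ?thesis by simp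
  qed
  have Rep_Y: "Rep_l2 (Abs_l2 y) = y" using sy by (simp add: Abs_l2_inverse)
  have "U \<longlonglongrightarrow> Abs_l2 y"
  proof (rule metric_LIMSEQ_I)
    fix e :: real assume e: "0 < e"
    then obtain M where M: "\<And>m n. M \<le> m \<Longrightarrow> M \<le> n \<Longrightarrow> dist (U m) (U n) < e / 2"
      using metric_CauchyD[OF U, of "e / 2"] by force
    have "dist (U n) (Abs_l2 y) < e" if "M \<le> n" for n
    proof -
      have "(dist (U n) (Abs_l2 y))\<^sup>2 = (\<Sum>i. (Rep_l2 (U n) i - y i)\<^sup>2)"
        by (simp add: dist_norm norm_l2_sqr minus_l2.rep_eq Rep_Y)
      also have "\<dots> \<le> (e / 2)\<^sup>2"
        using bound[of n "e / 2"] M that by simp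
      finally have "dist (U n) (Abs_l2 y) \<le> e / 2"
        by (rule power2_le_imp_le) (use e in simp)
      then show ?thesis using e by simp
    qed
    then show "\<exists>no. \<forall>n\<ge>no. dist (U n) (Abs_l2 y) < e" by blast
  qed
  then show "convergent U" by (auto simp: convergent_def)
qed

section \<open>Isometries of closed affine hulls\<close>

lemma affine_combination_in_hull:
  assumes "J \<subseteq> I" "finite J" "sum c J = 1"
  shows "(\<Sum>i\<in>J. c i *\<^sub>R b i) \<in> affine hull (b ` I)"
proof -
  \<comment> \<open>The points \<open>b i\<close> need not be distinct, so the coefficients of equal
    points are added up.\<close>
  define u where "u v = (\<Sum>i\<in>{i \<in> J. b i = v}. c i)" for v
  have "(\<Sum>v\<in>b ` J. u v) = 1"
    unfolding u_def using sum.image_gen[OF assms(2), of c b] assms(3) by simp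
  moreover have "(\<Sum>v\<in>b ` J. u v *\<^sub>R v) = (\<Sum>i\<in>J. c i *\<^sub>R b i)"
    unfolding sum.image_gen[OF assms(2), of "\<lambda>i. c i *\<^sub>R b i" b] u_def scaleR_sum_left
    by (auto intro!: sum.cong)
  moreover have "b ` J \<noteq> {}" using assms by auto
  ultimately show ?thesis
    unfolding affine_hull_explicit using assms
    by (intro CollectI exI[of _ "b ` J"] exI[of _ u]) auto
qed

text \<open>Distances determine the norm of every combination with coefficient sum 0, in particular
  of the difference of two affine combinations. Sending an affine combination of the
  \<open>a i\<close> to the same one of the \<open>b i\<close> is therefore isometric, hence
  independent of the chosen representation. Completeness of the target extends the map to the
  closure.\<close>

lemma isometry_extend_affine_hull:
  fixes a :: "'i \<Rightarrow> 'v::{real_inner}" and b :: "'i \<Rightarrow> 'w::{real_inner, complete_space}"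
  assumes iso: "\<And>i j. i \<in> I \<Longrightarrow> j \<in> I \<Longrightarrow> dist (b i) (b j) = dist (a i) (a j)"
  obtains F where "\<And>i. i \<in> I \<Longrightarrow> F (a i) = b i"
    "\<And>x. x \<in> closure (affine hull (a ` I)) \<Longrightarrow> F x \<in> closure (affine hull (b ` I))"
    "\<And>x y. x \<in> closure (affine hull (a ` I)) \<Longrightarrow> y \<in> closure (affine hull (a ` I)) \<Longrightarrow> dist (F x) (F y) = dist x y"
proof -
  define A where "A = affine hull (a ` I)"
  \<comment> \<open>Coefficients vanish off \<open>J\<close>, so two representations can be compared
    on the union of their index sets.\<close>
  define R where "R x c J \<longleftrightarrow> finite J \<and> J \<subseteq> I \<and> (\<Sum>i\<in>J. c i) = 1 \<and> (\<forall>i. i \<notin> J \<longrightarrow> c i = 0) \<and>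
    x = (\<Sum>i\<in>J. c i *\<^sub>R a i)" for x c J
  \<comment> \<open>When the squared distances are expanded, the terms with
    \<open>inner (u i) (u i)\<close> and \<open>inner (u j) (u j)\<close> drop out because the
    coefficients sum to 0.\<close>
  have norm_comb: "(norm (\<Sum>i\<in>J. e i *\<^sub>R u i))\<^sup>2 = - (\<Sum>i\<in>J. \<Sum>j\<in>J. e i * e j * (dist (u i) (u j))\<^sup>2) / 2"
    if "(\<Sum>i\<in>J. e i) = 0" for e :: "'i \<Rightarrow> real" and u :: "'i \<Rightarrow> 'z::real_inner" and J
  proof -
    have "(\<Sum>i\<in>J. \<Sum>j\<in>J. e i * e j * (dist (u i) (u j))\<^sup>2) =
      (\<Sum>i\<in>J. \<Sum>j\<in>J. e i * inner (u i) (u i) * e j) + (\<Sum>i\<in>J. \<Sum>j\<in>J. e i * (e j * inner (u j) (u j)))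
      - 2 * (\<Sum>i\<in>J. \<Sum>j\<in>J. e i * (e j * inner (u i) (u j)))"
      by (simp add: dist_norm power2_norm_eq_inner inner_diff_left inner_diff_right inner_commute
        sum.distrib[symmetric] sum_subtractf[symmetric] sum_distrib_left algebra_simps)
    also have "(\<Sum>i\<in>J. \<Sum>j\<in>J. e i * inner (u i) (u i) * e j) = 0"
      using that by (simp add: sum_distrib_left[symmetric])
    also have "(\<Sum>i\<in>J. \<Sum>j\<in>J. e i * (e j * inner (u j) (u j))) = 0"
      using that by (simp add: sum_distrib_left[symmetric] sum_distrib_right[symmetric])
    also have "(\<Sum>i\<in>J. \<Sum>j\<in>J. e i * (e j * inner (u i) (u j))) = (norm (\<Sum>i\<in>J. e i *\<^sub>R u i))\<^sup>2"
      unfolding power2_norm_eq_inner inner_sum_left inner_sum_right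
      by (auto simp: sum_distrib_left inner_commute intro!: sum.cong)
    finally show ?thesis by simp
  qed
  have dist_comb: "dist (\<Sum>i\<in>J. c i *\<^sub>R b i) (\<Sum>i\<in>J'. c' i *\<^sub>R b i) = dist x x'"
    if "R x c J" "R x' c' J'" for x c J x' c' J'
  proof -
    define K where "K = J \<union> J'"
    have K: "finite K" "K \<subseteq> I" using that by (auto simp: R_def K_def)
    have ext: "(\<Sum>i\<in>J. c i *\<^sub>R u i) = (\<Sum>i\<in>K. c i *\<^sub>R u i)" "(\<Sum>i\<in>J'. c' i *\<^sub>R u i) = (\<Sum>i\<in>K. c' i *\<^sub>R u i)"
      for u :: "'i \<Rightarrow> 'z::real_vector"
      using that K by (auto simp: R_def K_def intro!: sum.mono_neutral_left)
    have z: "(\<Sum>i\<in>K. c i - c' i) = 0"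
      using ext[of "\<lambda>_. 1 :: real"] that by (simp add: sum_subtractf R_def)
    have "(dist (\<Sum>i\<in>J. c i *\<^sub>R b i) (\<Sum>i\<in>J'. c' i *\<^sub>R b i))\<^sup>2 = (norm (\<Sum>i\<in>K. (c i - c' i) *\<^sub>R b i))\<^sup>2"
      by (simp add: ext dist_norm sum_subtractf scaleR_diff_left)
    also have "\<dots> = (norm (\<Sum>i\<in>K. (c i - c' i) *\<^sub>R a i))\<^sup>2"
      unfolding norm_comb[OF z] using K iso by (auto intro!: sum.cong simp: subset_iff)
    also have "\<dots> = (dist x x')\<^sup>2"
      using that by (simp add: R_def ext dist_norm sum_subtractf scaleR_diff_left)
    finally show ?thesis by simp
  qed
  have "\<exists>c J. R x c J" if "x \<in> A" for x
  proof -
    have "\<exists>S u. finite S \<and> S \<noteq> {} \<and> S \<subseteq> a ` I \<and> sum u S = 1 \<and> (\<Sum>v\<in>S. u v *\<^sub>R v) = x"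
      using that unfolding A_def affine_hull_explicit by (rule CollectD)
    then obtain S u where S: "finite S" "S \<subseteq> a ` I" "sum u S = 1" "(\<Sum>v\<in>S. u v *\<^sub>R v) = x"
      by metis
    define g where "g = inv_into I a"
    have g: "g v \<in> I \<and> a (g v) = v" if "v \<in> S" for v
      using that S(2) by (auto simp: g_def subset_iff inv_into_into f_inv_into_f)
    have inj: "inj_on g S" using g by (intro inj_onI) metis
    have "R x (\<lambda>i. if i \<in> g ` S then u (a i) else 0) (g ` S)"
      using S g by (auto simp: R_def sum.reindex[OF inj])
    then show ?thesis by blast
  qed
  then obtain c J where cJ: "\<And>x. x \<in> A \<Longrightarrow> R x (c x) (J x)" by metis
  define f where "f x = (\<Sum>i\<in>J x. c x i *\<^sub>R b i)" for x
  have f_iso: "dist (f x) (f y) = dist x y" if "x \<in> A" "y \<in> A" for x y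
    unfolding f_def using dist_comb cJ that by blast
  have fA: "f x \<in> affine hull (b ` I)" if "x \<in> A" for x
  proof -
    have "J x \<subseteq> I" "finite (J x)" "sum (c x) (J x) = 1" using cJ[OF that] by (auto simp: R_def)
    then show ?thesis unfolding f_def by (rule affine_combination_in_hull)
  qed
  have fa: "f (a i) = b i" if "i \<in> I" for i
  proof -
    have 1: "R (a i) (\<lambda>j. if j = i then 1 else 0) {i}" using that by (simp add: R_def)
    have "a i \<in> A" using that by (simp add: A_def hull_inc)
    from dist_comb[OF cJ[OF this] 1] show ?thesis by (simp add: f_def)
  qed
  have "uniformly_continuous_on A f"
    unfolding uniformly_continuous_on_def using f_iso by auto
  then obtain F where F: "uniformly_continuous_on (closure A) F" "\<And>x. x \<in> A \<Longrightarrow> f x = F x"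
    by (rule uniformly_continuous_on_extension_on_closure) blast
  have cont: "continuous_on (closure A) F" using F(1) by (rule uniformly_continuous_imp_continuous)
  show ?thesis
  proof
    fix i assume "i \<in> I"
    then show "F (a i) = b i" using fa F(2)[of "a i"] by (simp add: A_def hull_inc)
  next
    fix x assume "x \<in> closure (affine hull (a ` I))"
    then show "F x \<in> closure (affine hull (b ` I))"
      using image_closure_subset[OF cont, of "closure (affine hull (b ` I))"] fA F(2) closure_subset
      unfolding A_def[symmetric] by fastforce
  next
    fix x y assume "x \<in> closure (affine hull (a ` I))" "y \<in> closure (affine hull (a ` I))"
    then obtain U Y where U: "\<And>n. U n \<in> A" "U \<longlonglongrightarrow> x" and Y: "\<And>n. Y n \<in> A" "Y \<longlonglongrightarrow> y"
      unfolding closure_sequential A_def by blast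
    have xy: "x \<in> closure A" "y \<in> closure A" using U Y closure_sequential by blast+
    have "(\<lambda>n. dist (F (U n)) (F (Y n))) \<longlonglongrightarrow> dist (F x) (F y)"
      using U Y xy closure_subset[of A]
      by (intro tendsto_dist continuous_on_tendsto_compose[OF cont]) (auto simp: subset_iff)
    moreover have "(\<lambda>n. dist (F (U n)) (F (Y n))) \<longlonglongrightarrow> dist x y"
      using tendsto_dist[OF U(2) Y(2)] f_iso U Y F(2) by simp
    ultimately show "dist (F x) (F y) = dist x y" by (rule LIMSEQ_unique)
  qed
qed

section \<open>Actions and kernels\<close>

text \<open>A subspace of a type-class inner product space, carried over to a subset of the universe
  type by an injection \<open>J\<close>. The operations go through \<open>inv_into UNIV J\<close>
  and so are meaningful on the range of \<open>J\<close> only.\<close>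

definition image_space :: "('v::real_inner \<Rightarrow> 'h) \<Rightarrow> 'v set \<Rightarrow> 'h inner_space" where
  "image_space J V = \<lparr>carrier = J ` V, mult = undefined, one = undefined, zero = J 0,
     add = (\<lambda>a b. J (inv_into UNIV J a + inv_into UNIV J b)), smult = (\<lambda>c a. J (c *\<^sub>R inv_into UNIV J a)),
     ip = (\<lambda>a b. inner (inv_into UNIV J a) (inv_into UNIV J b))\<rparr>"

lemma image_space_simps [simp]:
  "carrier (image_space J V) = J ` V"
  "\<zero>\<^bsub>image_space J V\<^esub> = J 0"
  "inj J \<Longrightarrow> J x \<oplus>\<^bsub>image_space J V\<^esub> J y = J (x + y)"
  "inj J \<Longrightarrow> c \<odot>\<^bsub>image_space J V\<^esub> J x = J (c *\<^sub>R x)"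
  "inj J \<Longrightarrow> ip (image_space J V) (J x) (J y) = inner x y"
  by (simp_all add: image_space_def)

lemma image_space_inner_product_space:
  assumes J: "inj J" and V: "subspace V"
  shows "inner_product_space (image_space J V)"
proof -
  note [simp] = J subspace_add[OF V] subspace_scale[OF V] subspace_0[OF V]
  have ag: "abelian_group (image_space J V)"
  proof (rule abelian_groupI)
    show "\<exists>y\<in>carrier (image_space J V). y \<oplus>\<^bsub>image_space J V\<^esub> x = \<zero>\<^bsub>image_space J V\<^esub>"
      if "x \<in> carrier (image_space J V)" for x
    proof -
      from that obtain z where z: "z \<in> V" "x = J z" by auto
      then show ?thesis using subspace_neg[OF V, of z] by (intro bexI[of _ "J (- z)"]) auto
    qed
  qed (auto simp: add_ac)
  have "module (ring_of_type_algebra :: real ring) (image_space J V)"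
    by (rule moduleI[OF cring_from_type_algebra ag]) (auto simp: ring_of_type_algebra_def algebra_simps)
  then show ?thesis
    by (rule inner_product_space.intro, unfold_locales)
       (auto simp: inner_commute inner_add_left inner_add_right)
qed

lemma image_space_dist:
  assumes J: "inj J" and V: "subspace V" and "x \<in> V" "y \<in> V"
  shows "ip_dist (image_space J V) (J x) (J y) = dist x y"
proof -
  interpret inner_product_space "image_space J V" by (rule image_space_inner_product_space[OF J V])
  have "\<ominus>\<^bsub>image_space J V\<^esub> J y = J (- y)"
    by (rule M.minus_equality) (use assms subspace_neg[OF V] in auto)
  then have "J x \<ominus>\<^bsub>image_space J V\<^esub> J y = J (x - y)"
    using J by (simp add: M.minus_eq)
  then show ?thesis
    using assms by (simp add: ip_dist_def dist_norm norm_eq_sqrt_inner)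
qed

lemma image_space_hilbert_space:
  fixes J :: "'v::{real_inner, complete_space} \<Rightarrow> 'h"
  assumes J: "inj J" and V: "subspace V" "closed V"
  shows "hilbert_space (image_space J V)"
proof -
  interpret inner_product_space "image_space J V" by (rule image_space_inner_product_space[OF J V(1)])
  interpret Metric_space "J ` V" "ip_dist (image_space J V)"
    using ip_dist_Metric_space by simp
  have "mcomplete"
    unfolding mcomplete_def
  proof (intro allI impI)
    fix \<sigma> assume \<sigma>: "MCauchy \<sigma>"
    then have "\<sigma> n \<in> J ` V" for n unfolding MCauchy_def by blast
    then have "\<forall>n. \<exists>x\<in>V. \<sigma> n = J x" by blast
    then obtain U where U: "\<And>n. U n \<in> V" "\<sigma> = (\<lambda>n. J (U n))" by (metis ext)
    have "Cauchy U"
      using \<sigma> U(1) unfolding MCauchy_def U(2) by (simp add: image_space_dist[OF J V(1)] Cauchy_def)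
    then obtain x where x: "U \<longlonglongrightarrow> x" by (metis Cauchy_convergent_iff convergent_def)
    then have "x \<in> V" using closed_sequentially[OF V(2)] U(1) by blast
    then have "limitin mtopology \<sigma> (J x) sequentially"
      using x U by (simp add: limit_metric_sequentially image_space_dist[OF J V(1)] LIMSEQ_def)
    then show "\<exists>l. limitin mtopology \<sigma> l sequentially" by blast
  qed
  then show ?thesis by unfold_locales simp
qed

section \<open>Invariant proper kernels\<close>

definition kernel_dist :: "('a \<Rightarrow> 'a \<Rightarrow> real) \<Rightarrow> 'a \<Rightarrow> 'a \<Rightarrow> real" where
  "kernel_dist k x y = k x x + k y y - 2 * k x y"

text \<open>The invariant content of a metrically proper affine isometric action: the Gram kernel of the
  orbit of the zero vector. It satisfies \<open>kernel_dist k g h = \<parallel>g 0 - h 0\<parallel>\<^sup>2\<close>.\<close>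

definition haagerup_kernel :: "('a, 'b) monoid_scheme \<Rightarrow> ('a \<Rightarrow> 'a \<Rightarrow> real) \<Rightarrow> bool" where
  "haagerup_kernel G k \<longleftrightarrow> psd_on (carrier G) k \<and> k \<one>\<^bsub>G\<^esub> \<one>\<^bsub>G\<^esub> = 0 \<and>
     (\<forall>g\<in>carrier G. \<forall>h\<in>carrier G. \<forall>x\<in>carrier G.
        kernel_dist k (g \<otimes>\<^bsub>G\<^esub> h) (g \<otimes>\<^bsub>G\<^esub> x) = kernel_dist k h x) \<and>
     (\<forall>r. finite {g \<in> carrier G. kernel_dist k \<one>\<^bsub>G\<^esub> g \<le> r})"

section \<open>From a kernel to an action\<close>

lemma subspace_closure:
  fixes S :: "'v::real_normed_vector set"
  assumes "subspace S"
  shows "subspace (closure S)"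
proof (rule subspaceI)
  show "0 \<in> closure S" using subspace_0[OF assms] closure_subset by blast
  fix x y assume "x \<in> closure S" "y \<in> closure S"
  then obtain U Y where U: "\<And>n. U n \<in> S" "U \<longlonglongrightarrow> x" and Y: "\<And>n. Y n \<in> S" "Y \<longlonglongrightarrow> y"
    unfolding closure_sequential by blast
  have "(\<lambda>n. U n + Y n) \<longlonglongrightarrow> x + y" using U Y by (intro tendsto_add)
  moreover have "U n + Y n \<in> S" for n using U Y assms by (simp add: subspace_add)
  ultimately show "x + y \<in> closure S"
    unfolding closure_sequential by (intro exI[of _ "\<lambda>n. U n + Y n"] conjI allI)
next
  fix c x assume "x \<in> closure S"
  then obtain U where U: "\<And>n. U n \<in> S" "U \<longlonglongrightarrow> x" unfolding closure_sequential by blast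
  have "(\<lambda>n. c *\<^sub>R U n) \<longlonglongrightarrow> c *\<^sub>R x" using U by (intro tendsto_intros)
  moreover have "c *\<^sub>R U n \<in> S" for n using U assms by (simp add: subspace_scale)
  ultimately show "c *\<^sub>R x \<in> closure S"
    unfolding closure_sequential by (intro exI[of _ "\<lambda>n. c *\<^sub>R U n"] conjI allI)
qed

lemma psd_on_l2:
  assumes "psd_on A k" "countable A" "A \<noteq> {}"
  obtains w :: "'a \<Rightarrow> l2" where "\<And>x y. x \<in> A \<Longrightarrow> y \<in> A \<Longrightarrow> inner (w x) (w y) = k x y"
proof -
  obtain v :: "'a \<Rightarrow> nat \<Rightarrow> real" and N where v: "\<And>x l. x \<in> A \<Longrightarrow> N x \<le> l \<Longrightarrow> v x l = 0"
    "\<And>x y. x \<in> A \<Longrightarrow> y \<in> A \<Longrightarrow> k x y = (\<Sum>l<N x. v x l * v y l)"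
    using psd_on_gram[OF assms] by blast
  have "summable (\<lambda>l. (v x l)\<^sup>2)" if "x \<in> A" for x
    by (rule summable_finite[of "{..<N x}"]) (use v(1)[OF that] in \<open>auto simp: not_less\<close>)
  then have R: "Rep_l2 (Abs_l2 (v x)) = v x" if "x \<in> A" for x
    using that by (simp add: Abs_l2_inverse)
  show ?thesis
  proof
    fix x y assume xy: "x \<in> A" "y \<in> A"
    have "(\<Sum>l. v x l * v y l) = (\<Sum>l<N x. v x l * v y l)"
      by (rule suminf_finite) (use v(1)[OF xy(1)] in \<open>auto simp: not_less\<close>)
    then show "inner (Abs_l2 (v x)) (Abs_l2 (v y)) = k x y"
      using xy v(2) by (simp add: inner_l2.rep_eq R)
  qed
qed

text \<open>Stewart's identity: the distance from \<open>z\<close> to an affine combination of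
  \<open>x\<close> and \<open>y\<close> is a function of the mutual distances of the three points.
  Maps that are controlled by distances therefore respect affine combinations.\<close>

lemma dist_sqr_affine_combination:
  fixes x y z :: "'v::real_inner"
  shows "(dist ((1 - t) *\<^sub>R x + t *\<^sub>R y) z)\<^sup>2 =
    (1 - t) * (dist x z)\<^sup>2 + t * (dist y z)\<^sup>2 - t * (1 - t) * (dist x y)\<^sup>2"
  by (simp add: dist_norm power2_norm_eq_inner inner_diff_left inner_diff_right inner_add_left
      inner_add_right inner_commute algebra_simps)

text \<open>Left multiplication permutes the orbit \<open>w\<close> isometrically and so extends to
  its closed affine hull. The extensions are chosen separately for each group element, so the action
  laws have to come from a uniqueness argument.\<close>

lemma (in group) haagerup_property_if_kernel:
  assumes k: "haagerup_kernel G k" and count: "countable (carrier G)"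
  shows "haagerup_property TYPE('i + nat \<Rightarrow> real) G"
proof -
  note k = k[unfolded haagerup_kernel_def]
  obtain w :: "'a \<Rightarrow> l2" where w: "\<And>x y. x \<in> carrier G \<Longrightarrow> y \<in> carrier G \<Longrightarrow> inner (w x) (w y) = k x y"
    using psd_on_l2[of "carrier G" k] k count by blast
  have dist_w: "(dist (w x) (w y))\<^sup>2 = kernel_dist k x y" if "x \<in> carrier G" "y \<in> carrier G" for x y
    using that by (simp add: dist_norm power2_norm_eq_inner inner_diff_left inner_diff_right w
        kernel_dist_def inner_commute[of "w y" "w x"])
  have w1: "w \<one> = 0" using w[of \<one> \<one>] k by simp
  define V where "V = closure (affine hull (w ` carrier G))"
  have wV: "w x \<in> V" if "x \<in> carrier G" for x
    using that closure_subset by (force simp: V_def hull_inc)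
  \<comment> \<open>Since the orbit contains 0, its affine hull is a linear span, and the closure
    can itself serve as the Hilbert space.\<close>
  have "0 \<in> affine hull (w ` carrier G)" using w1 by (metis hull_inc imageI one_closed)
  then have "affine hull (w ` carrier G) = span (w ` carrier G)"
    by (rule affine_hull_span_0)
  then have V: "subspace V" "closed V" by (simp_all add: V_def subspace_closure)
  have iso: "dist (w (g \<otimes> x)) (w (g \<otimes> y)) = dist (w x) (w y)"
    if "g \<in> carrier G" "x \<in> carrier G" "y \<in> carrier G" for g x y
  proof -
    have "(dist (w (g \<otimes> x)) (w (g \<otimes> y)))\<^sup>2 = (dist (w x) (w y))\<^sup>2"
      using that k by (simp add: dist_w)
    then show ?thesis by simp
  qed
  have img: "(\<lambda>x. w (g \<otimes> x)) ` carrier G = w ` carrier G" if "g \<in> carrier G" for g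
  proof (intro equalityI subsetI)
    fix y assume "y \<in> w ` carrier G"
    then obtain x where "x \<in> carrier G" "y = w x" by blast
    then have "inv g \<otimes> x \<in> carrier G" "y = w (g \<otimes> (inv g \<otimes> x))"
      using that by (simp_all add: m_assoc[symmetric])
    then show "y \<in> (\<lambda>x. w (g \<otimes> x)) ` carrier G" by blast
  qed (use that in auto)
  have "\<exists>F. (\<forall>x\<in>carrier G. F (w x) = w (g \<otimes> x)) \<and> (\<forall>x\<in>V. F x \<in> V) \<and>
    (\<forall>x\<in>V. \<forall>y\<in>V. dist (F x) (F y) = dist x y)" if g: "g \<in> carrier G" for g
  proof -
    obtain F where "\<And>x. x \<in> carrier G \<Longrightarrow> F (w x) = w (g \<otimes> x)" "\<And>x. x \<in> V \<Longrightarrow> F x \<in> V"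
      "\<And>x y. x \<in> V \<Longrightarrow> y \<in> V \<Longrightarrow> dist (F x) (F y) = dist x y"
      using isometry_extend_affine_hull[of "carrier G" "\<lambda>x. w (g \<otimes> x)" w, OF iso[OF g]]
      unfolding img[OF g] V_def[symmetric] by blast
    then show ?thesis by blast
  qed
  then obtain F where Fw: "\<And>g x. g \<in> carrier G \<Longrightarrow> x \<in> carrier G \<Longrightarrow> F g (w x) = w (g \<otimes> x)"
    and FV: "\<And>g x. g \<in> carrier G \<Longrightarrow> x \<in> V \<Longrightarrow> F g x \<in> V"
    and Fd: "\<And>g x y. g \<in> carrier G \<Longrightarrow> x \<in> V \<Longrightarrow> y \<in> V \<Longrightarrow> dist (F g x) (F g y) = dist x y"
    by metis
  have uniq: "x = y" if xy: "x \<in> V" "y \<in> V" and d: "\<And>h. h \<in> carrier G \<Longrightarrow> dist x (w h) = dist y (w h)" for x y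
  proof -
    \<comment> \<open>The distance to \<open>w \<one> = 0\<close> fixes the norm. The other
      distances then fix the inner products with the orbit, so \<open>x - y\<close> is orthogonal to
      \<open>V\<close>, to which it belongs.\<close>
    have n: "norm x = norm y" using d[of \<one>] w1 by simp
    have "inner (x - y) (w h) = 0" if "h \<in> carrier G" for h
    proof -
      have "(norm (x - w h))\<^sup>2 = (norm (y - w h))\<^sup>2" using d[OF that] by (simp add: dist_norm)
      moreover have "(norm x)\<^sup>2 = (norm y)\<^sup>2" using n by simp
      ultimately show ?thesis
        by (simp add: power2_norm_eq_inner inner_diff_left inner_diff_right inner_commute)
    qed
    then have "affine hull (w ` carrier G) \<subseteq> {z. inner (x - y) z = 0}"
      by (intro hull_minimal) (auto simp: affine_hyperplane)
    then have "V \<subseteq> {z. inner (x - y) z = 0}"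
      unfolding V_def by (rule closure_minimal) (rule closed_hyperplane)
    then have "inner (x - y) (x - y) = 0" using subspace_diff[OF V(1) xy] by blast
    then show ?thesis by simp
  qed
  \<comment> \<open>A point of \<open>V\<close> is determined by its distances to the orbit \<open>w ` carrier G\<close>, so all identities
    between the maps \<open>F g\<close> can be checked on these distances.\<close>
  have Fdw: "dist (F g x) (w h) = dist x (w (inv g \<otimes> h))" if "g \<in> carrier G" "x \<in> V" "h \<in> carrier G" for g x h
    using Fd[of g x "w (inv g \<otimes> h)"] Fw[of g "inv g \<otimes> h"] that wV by (simp add: m_assoc[symmetric])
  have Fm: "F (g \<otimes> h) x = F g (F h x)" if "g \<in> carrier G" "h \<in> carrier G" "x \<in> V" for g h x
    by (rule uniq) (use that in \<open>simp_all add: FV Fdw inv_mult_group m_assoc\<close>)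
  have F1: "F \<one> x = x" if "x \<in> V" for x
    by (rule uniq) (use that in \<open>simp_all add: FV Fdw\<close>)
  have Fa: "F g ((1 - t) *\<^sub>R x + t *\<^sub>R y) = (1 - t) *\<^sub>R F g x + t *\<^sub>R F g y"
    if "g \<in> carrier G" "x \<in> V" "y \<in> V" for g x y t
  proof (rule uniq)
    have c: "(1 - t) *\<^sub>R x + t *\<^sub>R y \<in> V" if "x \<in> V" "y \<in> V" for x y
      using that V(1) by (simp add: subspace_add subspace_scale)
    show "F g ((1 - t) *\<^sub>R x + t *\<^sub>R y) \<in> V" "(1 - t) *\<^sub>R F g x + t *\<^sub>R F g y \<in> V"
      using c that FV by auto
    fix h assume "h \<in> carrier G"
    then have "(dist (F g ((1 - t) *\<^sub>R x + t *\<^sub>R y)) (w h))\<^sup>2 = (dist ((1 - t) *\<^sub>R F g x + t *\<^sub>R F g y) (w h))\<^sup>2"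
      using that c by (simp add: Fdw Fd dist_sqr_affine_combination)
    then show "dist (F g ((1 - t) *\<^sub>R x + t *\<^sub>R y)) (w h) = dist ((1 - t) *\<^sub>R F g x + t *\<^sub>R F g y) (w h)"
      by simp
  qed
  \<comment> \<open>Padding by 0 on the summand \<open>'i\<close> places \<open>l2\<close> in the
    universe, whatever \<open>'i\<close> is.\<close>
  define J :: "l2 \<Rightarrow> 'i + nat \<Rightarrow> real" where "J x = case_sum (\<lambda>_. 0) (Rep_l2 x)" for x
  have J: "inj J"
  proof (rule injI)
    fix x y assume "J x = J y"
    then have "Rep_l2 x n = Rep_l2 y n" for n by (auto simp: J_def fun_eq_iff split: sum.splits dest: spec[of _ "Inr n"])
    then show "x = y" by (simp add: Rep_l2_inject[symmetric] fun_eq_iff)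
  qed
  define H where "H = image_space J V"
  have cH: "carrier H = J ` V" by (simp add: H_def)
  interpret H: hilbert_space H
    unfolding H_def by (rule image_space_hilbert_space[OF J V])
  have dH: "ip_dist H (J x) (J y) = dist x y" if "x \<in> V" "y \<in> V" for x y
    unfolding H_def by (rule image_space_dist[OF J V(1) that])
  \<comment> \<open>Members of \<open>Bij\<close> are extensional, whence the restriction to the
    carrier.\<close>
  define \<phi> where "\<phi> g = restrict (\<lambda>a. J (F g (inv_into UNIV J a))) (J ` V)" for g
  have \<phi>: "\<phi> g (J x) = J (F g x)" if "x \<in> V" for g x
    using that J by (simp add: \<phi>_def)
  have Bij: "\<phi> g \<in> Bij (J ` V)" if g: "g \<in> carrier G" for g
  proof -
    have "bij_betw (\<phi> g) (J ` V) (J ` V)"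
      by (rule bij_betw_byWitness[where f'="\<phi> (inv g)"])
        (use g in \<open>auto simp: \<phi> FV F1 Fm[symmetric]\<close>)
    then show ?thesis by (simp add: Bij_def \<phi>_def)
  qed
  have "group_action G (carrier H) \<phi>"
  proof -
    have "\<phi> \<in> hom G (BijGroup (J ` V))"
    proof (rule homI)
      fix g h assume gh: "g \<in> carrier G" "h \<in> carrier G"
      have "\<phi> (g \<otimes> h) = compose (J ` V) (\<phi> g) (\<phi> h)"
      proof (rule extensionalityI)
        show "\<phi> (g \<otimes> h) \<in> extensional (J ` V)" by (simp add: \<phi>_def)
        show "\<phi> (g \<otimes> h) a = compose (J ` V) (\<phi> g) (\<phi> h) a" if "a \<in> J ` V" for a
          using that gh by (auto simp: compose_def \<phi> FV Fm)
      qed simp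
      then show "\<phi> (g \<otimes> h) = \<phi> g \<otimes>\<^bsub>BijGroup (J ` V)\<^esub> \<phi> h"
        using gh Bij by (simp add: BijGroup_def)
    qed (use Bij in \<open>simp add: BijGroup_def\<close>)
    then show ?thesis unfolding cH
      by (intro group_action.intro group_hom.intro group_hom_axioms.intro group_BijGroup is_group)
  qed
  moreover have "ip_dist H (\<phi> g a) (\<phi> g b) = ip_dist H a b \<and>
      \<phi> g (((1 - t) \<odot>\<^bsub>H\<^esub> a) \<oplus>\<^bsub>H\<^esub> (t \<odot>\<^bsub>H\<^esub> b)) = ((1 - t) \<odot>\<^bsub>H\<^esub> \<phi> g a) \<oplus>\<^bsub>H\<^esub> (t \<odot>\<^bsub>H\<^esub> \<phi> g b)"
    if g: "g \<in> carrier G" and ab: "a \<in> carrier H" "b \<in> carrier H" for g a b t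
  proof -
    obtain x y where xy: "x \<in> V" "y \<in> V" "a = J x" "b = J y"
      using ab unfolding cH by blast
    have v: "(1 - t) *\<^sub>R x + t *\<^sub>R y \<in> V" using xy V(1) by (simp add: subspace_add subspace_scale)
    have "ip_dist H (\<phi> g a) (\<phi> g b) = ip_dist H a b"
      using g xy by (simp add: \<phi> dH FV Fd)
    moreover have "((1 - t) \<odot>\<^bsub>H\<^esub> a) \<oplus>\<^bsub>H\<^esub> (t \<odot>\<^bsub>H\<^esub> b) = J ((1 - t) *\<^sub>R x + t *\<^sub>R y)"
      unfolding H_def xy(3,4) using J by simp
    moreover have "((1 - t) \<odot>\<^bsub>H\<^esub> \<phi> g a) \<oplus>\<^bsub>H\<^esub> (t \<odot>\<^bsub>H\<^esub> \<phi> g b) = J ((1 - t) *\<^sub>R F g x + t *\<^sub>R F g y)"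
      unfolding H_def xy(3,4) \<phi>[OF xy(1)] \<phi>[OF xy(2)] using J by simp
    ultimately show ?thesis
      using \<phi>[OF v] Fa[OF g xy(1,2)] by simp
  qed
  ultimately have "affine_isometric_action G H \<phi>"
    unfolding affine_isometric_action_def by blast
  moreover have "metrically_proper_action G H \<phi>"
    unfolding metrically_proper_action_def
  proof (intro allI impI)
    fix B assume B: "Metric_space.mbounded (carrier H) (ip_dist H) B"
    interpret MH: Metric_space "carrier H" "ip_dist H" by (rule H.ip_dist_Metric_space)
    obtain c r where cr: "B \<subseteq> MH.mcball c r" using B by (auto simp: MH.mbounded_def)
    \<comment> \<open>The ball around \<open>c\<close> is enlarged to one around the origin, because
      the orbit under study is that of the origin.\<close>
    define R where "R = r + ip_dist H c (J 0)"
    have R: "\<exists>x\<in>V. a = J x \<and> dist 0 x \<le> R" if "a \<in> B" for a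
    proof -
      have a: "a \<in> carrier H" "c \<in> carrier H" "ip_dist H c a \<le> r" using cr that by auto
      then obtain x where x: "x \<in> V" "a = J x" by (auto simp: cH)
      have "ip_dist H (J 0) a \<le> ip_dist H (J 0) c + ip_dist H c a"
        using a subspace_0[OF V(1)] by (intro MH.triangle) (auto simp: cH)
      then have "dist 0 x \<le> R"
        using a x subspace_0[OF V(1)] by (simp add: dH R_def MH.commute[of "J 0" c])
      then show ?thesis using x by blast
    qed
    \<comment> \<open>If \<open>x\<close> and \<open>F g x\<close> have norm at most
      \<open>R\<close>, then \<open>w g = F g 0\<close> lies within \<open>R\<close> of
      \<open>F g x\<close> and within \<open>2 * R\<close> of 0. Properness of the kernel leaves
      finitely many such \<open>g\<close>.\<close>
    have "kernel_dist k \<one> g \<le> (2 * R)\<^sup>2" if g: "g \<in> carrier G" and gB: "\<phi> g ` B \<inter> B \<noteq> {}" for g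
    proof -
      obtain a where a: "a \<in> B" "\<phi> g a \<in> B" using gB by blast
      obtain x where x: "x \<in> V" "a = J x" "dist 0 x \<le> R" using R[OF a(1)] by blast
      have "J (F g x) \<in> B" using a(2) x by (simp add: \<phi>)
      from R[OF this] have "dist 0 (F g x) \<le> R" using J by (auto dest: injD)
      moreover have "dist (F g x) (w g) = dist x 0"
        using Fd[OF g x(1) subspace_0[OF V(1)]] Fw[OF g one_closed] w1 g by simp
      ultimately have "dist 0 (w g) \<le> 2 * R"
        using dist_triangle[of 0 "w g" "F g x"] x(3) by (simp add: dist_commute)
      then have "(dist (w \<one>) (w g))\<^sup>2 \<le> (2 * R)\<^sup>2"
        using w1 by (intro power_mono) auto
      then show ?thesis using g dist_w by simp
    qed
    then have "{g \<in> carrier G. \<phi> g ` B \<inter> B \<noteq> {}} \<subseteq> {g \<in> carrier G. kernel_dist k \<one> g \<le> (2 * R)\<^sup>2}" by blast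
    then show "finite {g \<in> carrier G. \<phi> g ` B \<inter> B \<noteq> {}}"
      using k finite_subset by blast
  qed
  ultimately show ?thesis
    unfolding haagerup_property_def using H.hilbert_space_axioms by blast
qed

section \<open>From an action to its orbit kernel\<close>

lemma (in inner_product_space) ip_finsum_left:
  assumes "finite F" "\<And>x. x \<in> F \<Longrightarrow> f x \<in> carrier H" "y \<in> carrier H"
  shows "ip H (finsum H f F) y = (\<Sum>x\<in>F. ip H (f x) y)"
  using assms
proof (induction F)
  case (insert x F)
  then have "f \<in> F \<rightarrow> carrier H" by auto
  then show ?case using insert by (simp add: ip_add_left M.finsum_closed)
qed (simp add: ip_zero_left)

lemma (in inner_product_space) psd_on_ip:
  assumes b: "\<And>x. x \<in> A \<Longrightarrow> b x \<in> carrier H"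
  shows "psd_on A (\<lambda>x y. ip H (b x) (b y))"
  unfolding psd_on_def
proof (intro conjI ballI allI impI)
  show "ip H (b x) (b y) = ip H (b y) (b x)" if "x \<in> A" "y \<in> A" for x y
    using that b by (simp add: ip_commute)
  fix F and c :: "_ \<Rightarrow> real" assume F: "finite F \<and> F \<subseteq> A"
  define s where "s = finsum H (\<lambda>x. c x \<odot> b x) F"
  have f: "(\<lambda>x. c x \<odot> b x) \<in> F \<rightarrow> carrier H" using F b by auto
  then have s: "s \<in> carrier H" by (simp add: s_def M.finsum_closed)
  have 1: "ip H s y = (\<Sum>x\<in>F. c x * ip H (b x) y)" if "y \<in> carrier H" for y
    unfolding s_def using F f b that
    by (subst ip_finsum_left) (auto simp: ip_smult_left subset_iff intro!: sum.cong)
  have bF: "b x \<in> carrier H" if "x \<in> F" for x using that F b by blast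
  have "ip H s s = (\<Sum>x\<in>F. c x * ip H (b x) s)" by (rule 1[OF s])
  also have "\<dots> = (\<Sum>x\<in>F. \<Sum>y\<in>F. c x * c y * ip H (b x) (b y))"
  proof (rule sum.cong[OF refl])
    fix x assume x: "x \<in> F"
    have "ip H (b x) s = (\<Sum>y\<in>F. c y * ip H (b y) (b x))"
      using 1[OF bF[OF x]] ip_commute[OF s bF[OF x]] by simp
    also have "\<dots> = (\<Sum>y\<in>F. c y * ip H (b x) (b y))"
      using ip_commute[OF bF bF[OF x]] by (intro sum.cong) simp_all
    finally show "c x * ip H (b x) s = (\<Sum>y\<in>F. c x * c y * ip H (b x) (b y))"
      by (simp add: sum_distrib_left mult.assoc)
  qed
  finally show "0 \<le> (\<Sum>x\<in>F. \<Sum>y\<in>F. c x * c y * ip H (b x) (b y))"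
    using ip_nonneg[OF s] by simp
qed

lemma (in inner_product_space) ip_dist_sqr:
  assumes xy: "x \<in> carrier H" "y \<in> carrier H"
  shows "(ip_dist H x y)\<^sup>2 = ip H x x + ip H y y - 2 * ip H x y"
proof -
  have r: "ip H z (\<ominus> y) = - ip H z y" if "z \<in> carrier H" for z
    using that xy ip_uminus_left[of y z] ip_commute[of z "\<ominus> y"] ip_commute[of z y] by simp
  have "ip H (x \<ominus> y) (x \<ominus> y) = ip H x x + ip H y y - 2 * ip H x y"
    using xy by (simp add: M.minus_eq ip_add_left ip_add_right ip_uminus_left r ip_commute[of y x])
  then show ?thesis using xy ip_nonneg[of "x \<ominus> y"] by (simp add: ip_dist_def)
qed

lemma (in group) haagerup_kernel_if_property:
  assumes "haagerup_property TYPE('h) G"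
  shows "\<exists>k. haagerup_kernel G k"
proof -
  obtain H :: "'h inner_space" and \<phi> where H: "hilbert_space H"
    and aff: "affine_isometric_action G H \<phi>" and proper: "metrically_proper_action G H \<phi>"
    using assms unfolding haagerup_property_def by blast
  interpret H: hilbert_space H by (rule H)
  interpret MH: Metric_space "carrier H" "ip_dist H" by (rule H.ip_dist_Metric_space)
  interpret act: group_action G "carrier H" \<phi>
    using aff by (simp add: affine_isometric_action_def)
  have iso: "ip_dist H (\<phi> g x) (\<phi> g y) = ip_dist H x y"
    if "g \<in> carrier G" "x \<in> carrier H" "y \<in> carrier H" for g x y
    using aff that unfolding affine_isometric_action_def by blast
  define b where "b g = \<phi> g \<zero>\<^bsub>H\<^esub>" for g
  have b: "b g \<in> carrier H" if "g \<in> carrier G" for g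
    unfolding b_def using act.element_image[OF that H.M.zero_closed] by blast
  have b1: "b \<one> = \<zero>\<^bsub>H\<^esub>"
    unfolding b_def using act.id_eq_one by (metis H.M.zero_closed restrict_apply')
  have bm: "b (g \<otimes> h) = \<phi> g (b h)" if "g \<in> carrier G" "h \<in> carrier G" for g h
    unfolding b_def using act.composition_rule[OF H.M.zero_closed that] .
  define k where "k g h = ip H (b g) (b h)" for g h
  have kd: "kernel_dist k g h = (ip_dist H (b g) (b h))\<^sup>2" if "g \<in> carrier G" "h \<in> carrier G" for g h
    using that b by (simp add: H.ip_dist_sqr kernel_dist_def k_def)
  have "psd_on (carrier G) k"
    unfolding k_def by (rule H.psd_on_ip) (rule b)
  moreover have "k \<one> \<one> = 0" by (simp add: k_def b1 H.ip_zero_left)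
  moreover have "kernel_dist k (g \<otimes> h) (g \<otimes> x) = kernel_dist k h x"
    if "g \<in> carrier G" "h \<in> carrier G" "x \<in> carrier G" for g h x
    using that by (simp add: kd bm iso b)
  moreover have "finite {g \<in> carrier G. kernel_dist k \<one> g \<le> r}" for r
  proof -
    \<comment> \<open>The ball contains 0, and it contains \<open>b g = \<phi> g 0\<close> whenever
      the kernel distance is at most \<open>r\<close>; so every such \<open>g\<close> moves a point
      of the ball into the ball. The absolute value covers negative \<open>r\<close>.\<close>
    have "finite {g \<in> carrier G. \<phi> g ` MH.mcball \<zero>\<^bsub>H\<^esub> (sqrt \<bar>r\<bar>) \<inter> MH.mcball \<zero>\<^bsub>H\<^esub> (sqrt \<bar>r\<bar>) \<noteq> {}}"
      using proper MH.mbounded_mcball unfolding metrically_proper_action_def by blast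
    moreover have "b g \<in> \<phi> g ` MH.mcball \<zero>\<^bsub>H\<^esub> (sqrt \<bar>r\<bar>) \<inter> MH.mcball \<zero>\<^bsub>H\<^esub> (sqrt \<bar>r\<bar>)"
      if "g \<in> carrier G" "kernel_dist k \<one> g \<le> r" for g
    proof -
      have "(ip_dist H \<zero>\<^bsub>H\<^esub> (b g))\<^sup>2 \<le> \<bar>r\<bar>" using that kd[of \<one> g] b1 by simp
      then have "ip_dist H \<zero>\<^bsub>H\<^esub> (b g) \<le> sqrt \<bar>r\<bar>" by (simp add: real_le_rsqrt)
      moreover have "\<zero>\<^bsub>H\<^esub> \<in> MH.mcball \<zero>\<^bsub>H\<^esub> (sqrt \<bar>r\<bar>)" by simp
      ultimately show ?thesis using b[OF that(1)] by (auto simp: b_def)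
    qed
    ultimately show ?thesis by (elim rev_finite_subset) blast
  qed
  ultimately show ?thesis unfolding haagerup_kernel_def by blast
qed

section \<open>Cayley graphs\<close>

locale cayley_graph = group +
  fixes S :: "'a set"
  assumes finite_generators: "finite S" and symmetric: "symmetric_set G S"
    and generating: "generating_set G S"
begin

abbreviation "edges \<equiv> cayley_edges G S"

lemma generators_closed: "s \<in> S \<Longrightarrow> s \<in> carrier G"
  using generating by (auto simp: generating_set_def)

lemma generators_inv: "s \<in> S \<Longrightarrow> inv s \<in> S"
  using symmetric by (auto simp: symmetric_set_def)

text \<open>Symmetry of \<open>S\<close> turns the inverse case of \<open>generate\<close> into the
  generator case.\<close>

lemma carrier_induct [consumes 1, case_names one generator mult]:
  assumes "g \<in> carrier G" and "P \<one>" and "\<And>s. s \<in> S \<Longrightarrow> P s"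
    and "\<And>g h. g \<in> carrier G \<Longrightarrow> h \<in> carrier G \<Longrightarrow> P g \<Longrightarrow> P h \<Longrightarrow> P (g \<otimes> h)"
  shows "P g"
proof -
  have S: "generate G S = carrier G" using generating by (simp add: generating_set_def)
  then have "g \<in> generate G S" using assms(1) by simp
  then show ?thesis
  proof induction
    case (inv h)
    then show ?case using assms(3) generators_inv by blast
  next
    case (eng h1 h2)
    then show ?case using assms(4) S by blast
  qed (use assms in auto)
qed

lemma edges_iff: "(g, h) \<in> edges \<longleftrightarrow> g \<in> carrier G \<and> h \<in> carrier G \<and> inv g \<otimes> h \<in> S"
proof
  assume "(g, h) \<in> edges"
  then obtain s where "g \<in> carrier G" "s \<in> S" "h = g \<otimes> s" by (auto simp: cayley_edges_def)
  then show "g \<in> carrier G \<and> h \<in> carrier G \<and> inv g \<otimes> h \<in> S"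
    using generators_closed[of s] by (simp add: m_assoc[symmetric])
next
  assume *: "g \<in> carrier G \<and> h \<in> carrier G \<and> inv g \<otimes> h \<in> S"
  then have "h = g \<otimes> (inv g \<otimes> h)" by (simp add: m_assoc[symmetric])
  then show "(g, h) \<in> edges" using * by (auto simp: cayley_edges_def)
qed

lemma sym_edges: "sym edges"
proof (rule symI)
  fix g h assume "(g, h) \<in> edges"
  then show "(h, g) \<in> edges"
    using generators_inv[of "inv g \<otimes> h"] by (simp add: edges_iff inv_mult_group)
qed

lemma edges_mult:
  assumes "x \<in> carrier G" "g \<in> carrier G" "h \<in> carrier G"
  shows "(x \<otimes> g, x \<otimes> h) \<in> edges \<longleftrightarrow> (g, h) \<in> edges"
proof -
  have "inv g \<otimes> inv x \<otimes> (x \<otimes> h) = inv g \<otimes> (inv x \<otimes> x \<otimes> h)"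
    using assms by (simp only: m_assoc inv_closed m_closed)
  then show ?thesis using assms by (simp add: edges_iff inv_mult_group)
qed

lemma edges_relpow_mult:
  assumes x: "x \<in> carrier G" and g: "g \<in> carrier G"
  shows "(g, h) \<in> edges ^^ n \<Longrightarrow> (x \<otimes> g, x \<otimes> h) \<in> edges ^^ n"
proof (induction n arbitrary: h)
  case (Suc n)
  then obtain l where l: "(g, l) \<in> edges ^^ n" "(l, h) \<in> edges" by auto
  then have "(x \<otimes> l, x \<otimes> h) \<in> edges" using x edges_mult[of x l h] by (simp add: edges_iff)
  then show ?case using Suc.IH[OF l(1)] by auto
qed simp

lemma edges_relpow_mult_iff:
  assumes "x \<in> carrier G" "g \<in> carrier G" "h \<in> carrier G"
  shows "(x \<otimes> g, x \<otimes> h) \<in> edges ^^ n \<longleftrightarrow> (g, h) \<in> edges ^^ n"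
  using edges_relpow_mult[of x g h n] edges_relpow_mult[of "inv x" "x \<otimes> g" "x \<otimes> h" n] assms
  by (auto simp: m_assoc[symmetric])

lemma edges_connected:
  assumes "g \<in> carrier G" "h \<in> carrier G"
  shows "\<exists>n. (g, h) \<in> edges ^^ n"
proof -
  have 1: "\<exists>n. (\<one>, g) \<in> edges ^^ n" if "g \<in> carrier G" for g
    using that
  proof (induction rule: carrier_induct)
    case one
    show ?case by (rule exI[of _ 0]) simp
  next
    case (generator s)
    then show ?case using generators_closed[of s] by (intro exI[of _ 1]) (simp add: edges_iff)
  next
    case (mult g h)
    then obtain m n where "(\<one>, g) \<in> edges ^^ m" "(\<one>, h) \<in> edges ^^ n" by blast
    then have "(\<one>, g) \<in> edges ^^ m" "(g, g \<otimes> h) \<in> edges ^^ n"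
      using edges_relpow_mult[of g \<one> h n] mult by auto
    then show ?case by (intro exI[of _ "m + n"]) (auto simp: relpow_add)
  qed
  from 1[of "inv g \<otimes> h"] obtain n where "(\<one>, inv g \<otimes> h) \<in> edges ^^ n" using assms by auto
  from edges_relpow_mult[OF assms(1) one_closed this] show ?thesis
    using assms by (auto simp: m_assoc[symmetric])
qed

lemma cayley_dist_mult:
  assumes "x \<in> carrier G" "g \<in> carrier G" "h \<in> carrier G"
  shows "cayley_dist G S (x \<otimes> g) (x \<otimes> h) = cayley_dist G S g h"
  using edges_relpow_mult_iff[OF assms] by (simp add: cayley_dist_def)

lemma finite_cayley_ball:
  assumes g: "g \<in> carrier G"
  shows "finite {h \<in> carrier G. cayley_dist G S g h \<le> r}"
proof -
  have fin: "finite {h. (g, h) \<in> edges ^^ n}" for n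
  proof (induction n)
    case (Suc n)
    have "{h. (g, h) \<in> edges ^^ Suc n} \<subseteq> (\<Union>l\<in>{l. (g, l) \<in> edges ^^ n}. (\<lambda>s. l \<otimes> s) ` S)"
      by (auto simp: cayley_edges_def)
    moreover have "finite (\<Union>l\<in>{l. (g, l) \<in> edges ^^ n}. (\<lambda>s. l \<otimes> s) ` S)"
      using Suc finite_generators by auto
    ultimately show ?case by (rule finite_subset)
  qed simp
  have "{h \<in> carrier G. cayley_dist G S g h \<le> r} \<subseteq> (\<Union>n\<in>{..r}. {h. (g, h) \<in> edges ^^ n})"
    unfolding cayley_dist_def using LeastI_ex[OF edges_connected[OF g]] by auto
  then show ?thesis by (rule finite_subset) (use fin in auto)
qed

lemma countable_carrier: "countable (carrier G)"
proof -
  have "carrier G \<subseteq> (\<Union>r. {h \<in> carrier G. cayley_dist G S \<one> h \<le> r})" by auto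
  moreover have "countable (\<Union>r. {h \<in> carrier G. cayley_dist G S \<one> h \<le> r})"
    using finite_cayley_ball by (intro countable_UN) (auto intro: countable_finite)
  ultimately show ?thesis by (rule countable_subset)
qed

text \<open>\<open>(Restr edges \<omega>)\<^sup>*\<close> is reflexive at closed vertices too.
  Requiring \<open>g \<in> \<omega>\<close> excludes these, so a closed vertex is not even connected
  to itself.\<close>

definition connected_in :: "'a set \<Rightarrow> 'a \<Rightarrow> 'a \<Rightarrow> bool" where
  "connected_in \<omega> g h \<longleftrightarrow> g \<in> \<omega> \<and> (g, h) \<in> (Restr edges \<omega>)\<^sup>*"

lemma connected_in_right: "connected_in \<omega> g h \<Longrightarrow> h \<in> \<omega>"
  unfolding connected_in_def by (auto elim: rtranclE)

lemma connected_in_sym: "connected_in \<omega> g h \<Longrightarrow> connected_in \<omega> h g"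
proof -
  have "sym ((Restr edges \<omega>)\<^sup>*)"
    using sym_edges by (intro sym_rtrancl symI) (auto dest: symD)
  then show "connected_in \<omega> g h \<Longrightarrow> connected_in \<omega> h g"
    using connected_in_right[of \<omega> g h] unfolding connected_in_def by (auto dest: symD)
qed

lemma connected_in_trans: "connected_in \<omega> g h \<Longrightarrow> connected_in \<omega> h l \<Longrightarrow> connected_in \<omega> g l"
  unfolding connected_in_def by auto

lemma clusters_iff: "(\<exists>C\<in>clusters G S \<omega>. g \<in> C \<and> h \<in> C) \<longleftrightarrow> connected_in \<omega> g h"
proof
  assume "\<exists>C\<in>clusters G S \<omega>. g \<in> C \<and> h \<in> C"
  then obtain x where "connected_in \<omega> x g" "connected_in \<omega> x h"
    by (auto simp: clusters_def quotient_def connected_in_def)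
  then show "connected_in \<omega> g h" using connected_in_sym connected_in_trans by blast
next
  assume *: "connected_in \<omega> g h"
  then have "(Restr edges \<omega>)\<^sup>* `` {g} \<in> clusters G S \<omega>"
    by (auto simp: clusters_def connected_in_def intro: quotientI)
  then show "\<exists>C\<in>clusters G S \<omega>. g \<in> C \<and> h \<in> C"
    using * by (intro bexI) (auto simp: connected_in_def)
qed

lemma connected_in_translate:
  assumes x: "x \<in> carrier G" and \<omega>: "\<omega> \<subseteq> carrier G" and c: "connected_in \<omega> g h"
  shows "connected_in (x <#\<^bsub>G\<^esub> \<omega>) (x \<otimes> g) (x \<otimes> h)"
proof -
  have g: "g \<in> \<omega>" "(g, h) \<in> (Restr edges \<omega>)\<^sup>*" using c by (auto simp: connected_in_def)
  from g(2) have "(x \<otimes> g, x \<otimes> h) \<in> (Restr edges (x <#\<^bsub>G\<^esub> \<omega>))\<^sup>*"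
  proof induction
    case (step h l)
    then have "(x \<otimes> h, x \<otimes> l) \<in> Restr edges (x <#\<^bsub>G\<^esub> \<omega>)"
      using x \<omega> edges_mult[of x h l] by (auto simp: l_coset_def)
    then show ?case using step.IH by (rule rtrancl_into_rtrancl[rotated])
  qed simp
  then show ?thesis using g by (auto simp: connected_in_def l_coset_def)
qed

end

section \<open>From percolations to kernels\<close>

text \<open>The form is a sum of squares, one for each class, of the coefficient sum over that
  class. Points that are not related to themselves are related to nothing and drop out.\<close>

lemma psd_form_partial_equivalence:
  fixes c :: "'a \<Rightarrow> real"
  assumes F: "finite F"
    and sym: "\<And>x y. R x y \<Longrightarrow> R y x" and trans: "\<And>x y z. R x y \<Longrightarrow> R y z \<Longrightarrow> R x z"
  shows "0 \<le> (\<Sum>x\<in>F. \<Sum>y\<in>F. c x * c y * of_bool (R x y))"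
proof -
  define E where "E = {x \<in> F. R x x}"
  define cl where "cl x = {y \<in> F. R x y}" for x
  define s where "s D = (\<Sum>y\<in>{y \<in> E. cl y = D}. c y)" for D
  have E: "finite E" "E \<subseteq> F" using F by (auto simp: E_def)
  have cl: "cl x = cl y \<longleftrightarrow> R x y" if "x \<in> E" "y \<in> E" for x y
    using that sym trans unfolding E_def cl_def by blast
  have out: "\<not> R x y \<and> \<not> R y x" if "x \<in> F - E" for x y
    using that sym trans unfolding E_def by blast
  have "(\<Sum>x\<in>F. \<Sum>y\<in>F. c x * c y * of_bool (R x y)) = (\<Sum>x\<in>E. \<Sum>y\<in>F. c x * c y * of_bool (R x y))"
    using F E out by (intro sum.mono_neutral_right ballI sum.neutral) auto
  also have "\<dots> = (\<Sum>x\<in>E. \<Sum>y\<in>E. c x * c y * of_bool (R x y))"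
    using F E out by (intro sum.cong refl sum.mono_neutral_right) auto
  also have "\<dots> = (\<Sum>x\<in>E. c x * s (cl x))"
  proof (rule sum.cong[OF refl])
    fix x assume x: "x \<in> E"
    have "s (cl x) = (\<Sum>y\<in>E. if cl y = cl x then c y else 0)"
      unfolding s_def using E by (simp add: sum.inter_filter)
    also have "\<dots> = (\<Sum>y\<in>E. c y * of_bool (R x y))"
      using cl[OF x] by (intro sum.cong) auto
    finally show "(\<Sum>y\<in>E. c x * c y * of_bool (R x y)) = c x * s (cl x)"
      by (simp add: sum_distrib_left mult.assoc)
  qed
  also have "\<dots> = (\<Sum>D\<in>cl ` E. \<Sum>x\<in>{x \<in> E. cl x = D}. c x * s (cl x))"
    by (rule sum.image_gen[OF E(1)])
  also have "\<dots> = (\<Sum>D\<in>cl ` E. s D * s D)"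
    by (intro sum.cong refl) (simp add: s_def sum_distrib_right)
  also have "\<dots> \<ge> 0" by (intro sum_nonneg) simp
  finally show ?thesis .
qed

context cayley_graph
begin

lemma space_config: "space (config_space G) = Pow (carrier G)"
  unfolding config_space_def by (rule space_measure_of) auto

lemma pred_member_config: "Measurable.pred (config_space G) (\<lambda>\<omega>. g \<in> \<omega>)"
proof (cases "g \<in> carrier G")
  case True
  have "{\<omega> \<in> Pow (carrier G). g \<in> \<omega>} \<in> sets (config_space G)"
    unfolding config_space_def using True by (subst sets_measure_of) (auto intro: sigma_sets.Basic)
  then show ?thesis by (simp add: pred_def space_config)
next
  case False
  then have "{\<omega> \<in> space (config_space G). g \<in> \<omega>} = {}" by (auto simp: space_config)
  then show ?thesis unfolding pred_def by (metis sets.empty_sets)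
qed

text \<open>Splitting connections by their length and their last but one vertex writes the event as
  a countable combination of membership events, since the group is countable.\<close>

lemma pred_connected_in_config: "Measurable.pred (config_space G) (\<lambda>\<omega>. connected_in \<omega> g h)"
proof -
  note [measurable] = pred_member_config
  have 1: "Measurable.pred (config_space G) (\<lambda>\<omega>. (g, h) \<in> Restr edges \<omega> ^^ n)" for n
  proof (induction n arbitrary: h)
    case (Suc n)
    have "(g, h) \<in> Restr edges \<omega> ^^ Suc n \<longleftrightarrow>
        (\<exists>l\<in>carrier G. (g, l) \<in> Restr edges \<omega> ^^ n \<and> (l, h) \<in> edges \<and> l \<in> \<omega> \<and> h \<in> \<omega>)" for \<omega>
      by (auto simp: edges_iff)
    moreover have "Measurable.pred (config_space G) (\<lambda>\<omega>. (g, l) \<in> Restr edges \<omega> ^^ n \<and> (l, h) \<in> edges \<and> l \<in> \<omega> \<and> h \<in> \<omega>)" for l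
      using Suc[of l] by measurable
    ultimately show ?case
      unfolding pred_def by (simp add: sets.sets_Collect_countable_Ex'[OF _ countable_carrier])
  qed simp
  have "connected_in \<omega> g h \<longleftrightarrow> g \<in> \<omega> \<and> (\<exists>n. (g, h) \<in> Restr edges \<omega> ^^ n)" for \<omega>
    unfolding connected_in_def rtrancl_power by simp
  then show ?thesis using 1 by simp
qed

lemma measurable_translate_config:
  assumes x: "x \<in> carrier G"
  shows "(\<lambda>\<omega>. x <#\<^bsub>G\<^esub> \<omega>) \<in> config_space G \<rightarrow>\<^sub>M config_space G"
proof -
  have "(\<lambda>\<omega>. x <#\<^bsub>G\<^esub> \<omega>) -` {\<omega> \<in> Pow (carrier G). g \<in> \<omega>} \<inter> space (config_space G) \<in> sets (config_space G)"
    if g: "g \<in> carrier G" for g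
  proof -
    have "(\<lambda>\<omega>. x <#\<^bsub>G\<^esub> \<omega>) -` {\<omega> \<in> Pow (carrier G). g \<in> \<omega>} \<inter> space (config_space G) =
      {\<omega> \<in> space (config_space G). inv x \<otimes> g \<in> \<omega>}"
      unfolding space_config using x g
      by (force simp: l_coset_def subset_iff m_assoc[symmetric] intro: bexI[of _ "inv x \<otimes> g"])
    then show ?thesis using pred_member_config[of "inv x \<otimes> g"] by (simp add: pred_def)
  qed
  moreover have "x <#\<^bsub>G\<^esub> \<omega> \<subseteq> carrier G" if "\<omega> \<subseteq> carrier G" for \<omega>
    using x that by (rule l_coset_subset_G[rotated])
  ultimately show ?thesis
    by (subst (2) config_space_def, intro measurable_measure_of) (auto simp: space_config)
qed

end

section \<open>Two-point functions of invariant percolations\<close>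

locale invariant_percolation_on = cayley_graph G S + prob_space P
  for G :: "('a, 'b) monoid_scheme" (structure) and S :: "'a set" and P :: "'a set measure" +
  assumes sets_P [measurable_cong]: "sets P = sets (config_space G)"
    and invariant: "x \<in> carrier G \<Longrightarrow> distr P (config_space G) (\<lambda>\<omega>. x <#\<^bsub>G\<^esub> \<omega>) = P"
begin

lemmas [measurable] = pred_member_config pred_connected_in_config

lemma space_P: "space P = Pow (carrier G)"
  using sets_eq_imp_space_eq[OF sets_P] space_config by simp

definition density :: real where "density = prob {\<omega> \<in> space P. \<one> \<in> \<omega>}"

abbreviation \<tau> where "\<tau> \<equiv> two_point G S P"

lemma two_point_eq: "\<tau> g h = prob {\<omega> \<in> space P. connected_in \<omega> g h}"
  unfolding two_point_def clusters_iff ..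

lemma prob_translate:
  assumes x: "x \<in> carrier G" and [measurable]: "Measurable.pred (config_space G) Q"
  shows "prob {\<omega> \<in> space P. Q (x <#\<^bsub>G\<^esub> \<omega>)} = prob {\<omega> \<in> space P. Q \<omega>}"
proof -
  have [measurable]: "(\<lambda>\<omega>. x <#\<^bsub>G\<^esub> \<omega>) \<in> P \<rightarrow>\<^sub>M config_space G"
    using measurable_translate_config[OF x] by (simp add: measurable_cong_sets[OF sets_P])
  have "prob {\<omega> \<in> space P. Q \<omega>} = measure (distr P (config_space G) (\<lambda>\<omega>. x <#\<^bsub>G\<^esub> \<omega>)) {\<omega> \<in> space P. Q \<omega>}"
    using invariant[OF x] by simp
  also have "\<dots> = prob ((\<lambda>\<omega>. x <#\<^bsub>G\<^esub> \<omega>) -` {\<omega> \<in> space P. Q \<omega>} \<inter> space P)"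
    by (rule measure_distr) (simp_all add: sets_P[symmetric])
  also have "(\<lambda>\<omega>. x <#\<^bsub>G\<^esub> \<omega>) -` {\<omega> \<in> space P. Q \<omega>} \<inter> space P = {\<omega> \<in> space P. Q (x <#\<^bsub>G\<^esub> \<omega>)}"
    using x by (auto simp: space_P l_coset_def)
  finally show ?thesis by simp
qed

lemma connected_in_translate_iff:
  assumes x: "x \<in> carrier G" and gh: "g \<in> carrier G" "h \<in> carrier G" and \<omega>: "\<omega> \<subseteq> carrier G"
  shows "connected_in (x <#\<^bsub>G\<^esub> \<omega>) (x \<otimes> g) (x \<otimes> h) \<longleftrightarrow> connected_in \<omega> g h"
proof
  assume "connected_in (x <#\<^bsub>G\<^esub> \<omega>) (x \<otimes> g) (x \<otimes> h)"
  moreover have "x <#\<^bsub>G\<^esub> \<omega> \<subseteq> carrier G" using x \<omega> by (auto simp: l_coset_def)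
  ultimately have "connected_in (inv x <#\<^bsub>G\<^esub> (x <#\<^bsub>G\<^esub> \<omega>)) (inv x \<otimes> (x \<otimes> g)) (inv x \<otimes> (x \<otimes> h))"
    using connected_in_translate[OF inv_closed[OF x]] by blast
  moreover have "inv x <#\<^bsub>G\<^esub> (x <#\<^bsub>G\<^esub> \<omega>) = \<omega>"
    using x \<omega> by (simp add: lcos_m_assoc lcos_mult_one)
  ultimately show "connected_in \<omega> g h" using x gh by (simp add: m_assoc[symmetric])
qed (use connected_in_translate[OF x \<omega>] in blast)

lemma two_point_mult:
  assumes "x \<in> carrier G" "g \<in> carrier G" "h \<in> carrier G"
  shows "\<tau> (x \<otimes> g) (x \<otimes> h) = \<tau> g h"
proof -
  have "\<tau> (x \<otimes> g) (x \<otimes> h) = prob {\<omega> \<in> space P. connected_in (x <#\<^bsub>G\<^esub> \<omega>) (x \<otimes> g) (x \<otimes> h)}"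
    unfolding two_point_eq by (rule prob_translate[symmetric]) (use assms in measurable)
  also have "{\<omega> \<in> space P. connected_in (x <#\<^bsub>G\<^esub> \<omega>) (x \<otimes> g) (x \<otimes> h)} = {\<omega> \<in> space P. connected_in \<omega> g h}"
    using assms by (auto simp: space_P connected_in_translate_iff)
  finally show ?thesis by (simp add: two_point_eq)
qed

lemma prob_member:
  assumes "g \<in> carrier G"
  shows "prob {\<omega> \<in> space P. g \<in> \<omega>} = density"
proof -
  have "prob {\<omega> \<in> space P. g \<in> \<omega>} = prob {\<omega> \<in> space P. g \<in> g <#\<^bsub>G\<^esub> \<omega>}"
    by (rule prob_translate[symmetric]) (use assms in measurable)
  also have "{\<omega> \<in> space P. g \<in> g <#\<^bsub>G\<^esub> \<omega>} = {\<omega> \<in> space P. \<one> \<in> \<omega>}"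
    using assms by (force simp: space_P l_coset_def subset_iff)
  finally show ?thesis by (simp add: density_def)
qed

lemma two_point_refl: "g \<in> carrier G \<Longrightarrow> \<tau> g g = density"
  unfolding two_point_eq prob_member[symmetric] by (simp add: connected_in_def)

lemma two_point_sym: "\<tau> g h = \<tau> h g"
  unfolding two_point_eq using connected_in_sym by metis

lemma two_point_le_1: "\<tau> g h \<le> 1"
  by (simp add: two_point_eq)

lemma two_point_eq_expectation: "\<tau> g h = expectation (\<lambda>\<omega>. of_bool (connected_in \<omega> g h))"
proof -
  have "\<tau> g h = expectation (indicator {\<omega> \<in> space P. connected_in \<omega> g h})"
    by (simp add: two_point_eq)
  also have "\<dots> = expectation (\<lambda>\<omega>. of_bool (connected_in \<omega> g h))"
    by (rule Bochner_Integration.integral_cong) (auto simp: indicator_def)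
  finally show ?thesis .
qed

text \<open>The form of \<open>\<tau>\<close> is the average over configurations of the forms of
  \<open>psd_form_partial_equivalence\<close>.\<close>

lemma psd_on_two_point: "psd_on (carrier G) \<tau>"
  unfolding psd_on_def
proof (intro conjI ballI allI impI)
  show "\<tau> x y = \<tau> y x" for x y by (rule two_point_sym)
  fix F and c :: "'a \<Rightarrow> real" assume F: "finite F \<and> F \<subseteq> carrier G"
  have int: "integrable P (\<lambda>\<omega>. of_bool (connected_in \<omega> x y) :: real)" for x y
    by (rule integrable_const_bound[where B=1]) auto
  have "(\<Sum>x\<in>F. \<Sum>y\<in>F. c x * c y * \<tau> x y) =
      expectation (\<lambda>\<omega>. \<Sum>x\<in>F. \<Sum>y\<in>F. c x * c y * of_bool (connected_in \<omega> x y))"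
    unfolding two_point_eq_expectation by (simp add: int Bochner_Integration.integral_sum)
  also have "\<dots> \<ge> 0"
    using F by (intro integral_nonneg_AE AE_I2 psd_form_partial_equivalence)
      (auto intro: connected_in_sym connected_in_trans)
  finally show "0 \<le> (\<Sum>x\<in>F. \<Sum>y\<in>F. c x * c y * \<tau> x y)" .
qed

text \<open>A union bound: by transitivity, \<open>g\<close> and \<open>l\<close> are disconnected
  only if one of the legs through \<open>h\<close> is.\<close>

lemma two_point_chain: "1 - \<tau> g l \<le> (1 - \<tau> g h) + (1 - \<tau> h l)"
proof -
  have c: "1 - \<tau> g h = prob {\<omega> \<in> space P. \<not> connected_in \<omega> g h}" for g h
    unfolding two_point_eq by (subst prob_neg) auto
  have "1 - \<tau> g l \<le> prob ({\<omega> \<in> space P. \<not> connected_in \<omega> g h} \<union> {\<omega> \<in> space P. \<not> connected_in \<omega> h l})"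
    unfolding c by (rule finite_measure_mono) (auto dest: connected_in_trans)
  also have "\<dots> \<le> (1 - \<tau> g h) + (1 - \<tau> h l)"
    unfolding c by (rule measure_Un_le) auto
  finally show ?thesis .
qed

text \<open>In an induced subgraph an edge is present once both its ends are, so only two vertices
  have to be open.\<close>

lemma two_point_edge:
  assumes "(g, h) \<in> edges"
  shows "1 - \<tau> g h \<le> 2 * (1 - density)"
proof -
  have gh: "g \<in> carrier G" "h \<in> carrier G" using assms by (auto simp: edges_iff)
  have c: "1 - density = prob {\<omega> \<in> space P. g \<notin> \<omega>}" if "g \<in> carrier G" for g
    unfolding prob_member[OF that, symmetric] by (subst prob_neg) auto
  have "1 - \<tau> g h = prob {\<omega> \<in> space P. \<not> connected_in \<omega> g h}"
    unfolding two_point_eq by (subst prob_neg) auto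
  also have "\<dots> \<le> prob ({\<omega> \<in> space P. g \<notin> \<omega>} \<union> {\<omega> \<in> space P. h \<notin> \<omega>})"
    using assms by (intro finite_measure_mono) (auto simp: connected_in_def)
  also have "\<dots> \<le> prob {\<omega> \<in> space P. g \<notin> \<omega>} + prob {\<omega> \<in> space P. h \<notin> \<omega>}"
    by (rule measure_Un_le) auto
  finally show ?thesis using c[OF gh(1)] c[OF gh(2)] by simp
qed

end

context cayley_graph
begin

lemma invariant_percolation_on_iff:
  "invariant_percolation_on G S P \<longleftrightarrow> invariant_percolation G P"
  unfolding invariant_percolation_on_def invariant_percolation_on_axioms_def
    invariant_percolation_def site_percolation_def
  using cayley_graph_axioms by auto

text \<open>\<open>M\<close> is chosen before the percolation, so that one constant serves a whole
  sequence of percolations; it depends only on a word for \<open>g\<close>. The starting point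
  \<open>x\<close> varies because the second leg of a product starts at
  \<open>x \<otimes> g\<close>.\<close>

lemma two_point_near_1:
  assumes "g \<in> carrier G"
  shows "\<exists>M\<ge>0. \<forall>P. invariant_percolation G P \<longrightarrow> (\<forall>x\<in>carrier G.
    1 - two_point G S P x (x \<otimes> g) \<le> M * (1 - measure P {\<omega> \<in> space P. \<one> \<in> \<omega>}))"
  using assms
proof (induction rule: carrier_induct)
  case one
  show ?case
  proof (intro exI[of _ 1] conjI allI impI ballI)
    fix P x assume P: "invariant_percolation G P" and x: "x \<in> carrier G"
    interpret invariant_percolation_on G S P using P by (simp add: invariant_percolation_on_iff)
    show "1 - \<tau> x (x \<otimes> \<one>) \<le> 1 * (1 - prob {\<omega> \<in> space P. \<one> \<in> \<omega>})"
      using x two_point_refl by (simp add: density_def)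
  qed simp
next
  case (generator s)
  show ?case
  proof (intro exI[of _ 2] conjI allI impI ballI)
    fix P x assume P: "invariant_percolation G P" and x: "x \<in> carrier G"
    interpret invariant_percolation_on G S P using P by (simp add: invariant_percolation_on_iff)
    have "(x, x \<otimes> s) \<in> edges" using x generator by (auto simp: cayley_edges_def)
    then show "1 - \<tau> x (x \<otimes> s) \<le> 2 * (1 - prob {\<omega> \<in> space P. \<one> \<in> \<omega>})"
      using two_point_edge by (simp add: density_def)
  qed simp
next
  case (mult g h)
  obtain M where M: "0 \<le> M" "\<And>P x. invariant_percolation G P \<Longrightarrow> x \<in> carrier G \<Longrightarrow>
    1 - two_point G S P x (x \<otimes> g) \<le> M * (1 - measure P {\<omega> \<in> space P. \<one> \<in> \<omega>})"
    using mult.IH(1) by blast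
  obtain M' where M': "0 \<le> M'" "\<And>P x. invariant_percolation G P \<Longrightarrow> x \<in> carrier G \<Longrightarrow>
    1 - two_point G S P x (x \<otimes> h) \<le> M' * (1 - measure P {\<omega> \<in> space P. \<one> \<in> \<omega>})"
    using mult.IH(2) by blast
  show ?case
  proof (intro exI[of _ "M + M'"] conjI allI impI ballI)
    show "0 \<le> M + M'" using M M' by simp
    fix P x assume P: "invariant_percolation G P" and x: "x \<in> carrier G"
    interpret invariant_percolation_on G S P using P by (simp add: invariant_percolation_on_iff)
    have "1 - \<tau> x (x \<otimes> g \<otimes> h) \<le> (1 - \<tau> x (x \<otimes> g)) + (1 - \<tau> (x \<otimes> g) (x \<otimes> g \<otimes> h))"
      by (rule two_point_chain)
    also have "\<dots> \<le> (M + M') * (1 - prob {\<omega> \<in> space P. \<one> \<in> \<omega>})"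
      unfolding distrib_right using M(2)[OF P x] M'(2)[OF P, of "x \<otimes> g"] x mult.hyps by (intro add_mono) auto
    finally show "1 - \<tau> x (x \<otimes> (g \<otimes> h)) \<le> (M + M') * (1 - prob {\<omega> \<in> space P. \<one> \<in> \<omega>})"
      using x mult.hyps by (simp add: m_assoc)
  qed
qed

text \<open>The bound by 1 makes the values bounded above, so that each of them is below the real
  supremum.\<close>

lemma vanishes_at_infinityD:
  assumes "vanishes_at_infinity G S \<tau>" and "\<And>g h. \<tau> g h \<le> 1" and "0 < e"
  shows "\<exists>r. \<forall>g\<in>carrier G. \<forall>h\<in>carrier G. r < real (cayley_dist G S g h) \<longrightarrow> \<tau> g h < e"
proof -
  let ?A = "\<lambda>r. {(g, h). g \<in> carrier G \<and> h \<in> carrier G \<and> r < real (cayley_dist G S g h)}"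
  have "\<forall>\<^sub>F r in at_top. (SUP (g, h)\<in>?A r. \<tau> g h) < e"
    using assms(1,3) unfolding vanishes_at_infinity_def by (rule order_tendstoD)
  then obtain r where r: "(SUP (g, h)\<in>?A r. \<tau> g h) < e"
    using eventually_happens'[OF trivial_limit_at_top_linorder] by blast
  have bdd: "bdd_above ((\<lambda>(g, h). \<tau> g h) ` ?A r)"
    using assms(2) by (intro bdd_aboveI[of _ 1]) auto
  have "\<tau> g h < e" if "(g, h) \<in> ?A r" for g h
    using cSUP_upper[OF that bdd] r by simp
  then show ?thesis by (intro exI[of _ r]) simp
qed

end

section \<open>Centering and summing kernels\<close>

definition centered_kernel :: "'a \<Rightarrow> ('a \<Rightarrow> 'a \<Rightarrow> real) \<Rightarrow> 'a \<Rightarrow> 'a \<Rightarrow> real" where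
  "centered_kernel e k x y = k x y - k x e - k e y + k e e"

text \<open>Centering subtracts the vector of \<open>e\<close> from all vectors of the kernel. The
  new form is the one of \<open>psd_on_quadratic\<close> with \<open>n = e\<close> and
  \<open>t\<close> the sum of the coefficients.\<close>

lemma psd_on_centered_kernel:
  assumes k: "psd_on A k" and e: "e \<in> A"
  shows "psd_on A (centered_kernel e k)"
  unfolding psd_on_def
proof (intro conjI ballI allI impI)
  show "centered_kernel e k x y = centered_kernel e k y x" if "x \<in> A" "y \<in> A" for x y
    using that e psd_on_sym[OF k] by (simp add: centered_kernel_def)
  fix F and c :: "'a \<Rightarrow> real" assume F: "finite F \<and> F \<subseteq> A"
  define t where "t = sum c F"
  have "(\<Sum>x\<in>F. \<Sum>y\<in>F. c x * c y * centered_kernel e k x y) =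
    (\<Sum>x\<in>F. \<Sum>y\<in>F. c x * c y * k x y) - (\<Sum>x\<in>F. \<Sum>y\<in>F. (c x * k x e) * c y)
    - (\<Sum>x\<in>F. \<Sum>y\<in>F. c x * (c y * k e y)) + (\<Sum>x\<in>F. \<Sum>y\<in>F. c x * c y * k e e)"
    by (simp add: centered_kernel_def sum.distrib sum_subtractf algebra_simps)
  also have "(\<Sum>x\<in>F. \<Sum>y\<in>F. c x * (c y * k e y)) = t * (\<Sum>x\<in>F. c x * k x e)"
    unfolding t_def sum_product using F e psd_on_sym[OF k] by (intro sum.cong refl) (auto simp: subset_iff)
  also have "(\<Sum>x\<in>F. \<Sum>y\<in>F. (c x * k x e) * c y) = t * (\<Sum>x\<in>F. c x * k x e)"
    unfolding t_def sum_product[symmetric] by simp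
  also have "(\<Sum>x\<in>F. \<Sum>y\<in>F. c x * c y * k e e) = t\<^sup>2 * k e e"
    unfolding t_def power2_eq_square sum_product by (simp add: sum_distrib_right)
  finally show "0 \<le> (\<Sum>x\<in>F. \<Sum>y\<in>F. c x * c y * centered_kernel e k x y)"
    using psd_on_quadratic[OF k, of F e c t] F e by simp
qed

lemma psd_on_suminf:
  assumes psd: "\<And>n. psd_on A (k n)" and sm: "\<And>x y. x \<in> A \<Longrightarrow> y \<in> A \<Longrightarrow> summable (\<lambda>n. k n x y)"
  shows "psd_on A (\<lambda>x y. \<Sum>n. k n x y)"
  unfolding psd_on_def
proof (intro conjI ballI allI impI)
  show "(\<Sum>n. k n x y) = (\<Sum>n. k n y x)" if "x \<in> A" "y \<in> A" for x y
    using that psd_on_sym[OF psd] by simp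
  fix F and c :: "'a \<Rightarrow> real" assume F: "finite F \<and> F \<subseteq> A"
  have s: "(\<lambda>n. \<Sum>x\<in>F. \<Sum>y\<in>F. c x * c y * k n x y) sums (\<Sum>x\<in>F. \<Sum>y\<in>F. c x * c y * (\<Sum>n. k n x y))"
    using F sm by (intro sums_sum sums_mult summable_sums) auto
  have nn: "0 \<le> (\<Sum>x\<in>F. \<Sum>y\<in>F. c x * c y * k n x y)" for n
    using psd_onD[OF psd] F by blast
  show "0 \<le> (\<Sum>x\<in>F. \<Sum>y\<in>F. c x * c y * (\<Sum>n. k n x y))"
    by (rule sums_le[OF nn sums_zero s])
qed

context cayley_graph
begin

lemma haagerup_kernel_if_percolation:
  assumes perc: "\<forall>\<alpha><1::real. \<exists>P. invariant_percolation G P \<and>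
       measure P {\<omega> \<in> space P. \<one> \<in> \<omega>} > \<alpha> \<and> vanishes_at_infinity G S (two_point G S P)"
  shows "\<exists>k. haagerup_kernel G k"
proof -
  have "\<forall>n. \<exists>P. invariant_percolation G P \<and>
       measure P {\<omega> \<in> space P. \<one> \<in> \<omega>} > 1 - (1/2)^n \<and> vanishes_at_infinity G S (two_point G S P)"
    using perc by simp
  then obtain P where P: "\<And>n. invariant_percolation G (P n)"
    "\<And>n. measure (P n) {\<omega> \<in> space (P n). \<one> \<in> \<omega>} > 1 - (1/2)^n"
    "\<And>n. vanishes_at_infinity G S (two_point G S (P n))"
    by metis
  interpret P: invariant_percolation_on G S "P n" for n
    using P(1) by (simp add: invariant_percolation_on_iff)
  define \<tau> where "\<tau> n = two_point G S (P n)" for n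
  have \<tau>_near: "\<exists>M\<ge>0. \<forall>n. 1 - \<tau> n g h \<le> M * (1/2)^n" if gh: "g \<in> carrier G" "h \<in> carrier G" for g h
  proof -
    obtain M where M: "M \<ge> 0" "\<And>P x. invariant_percolation G P \<Longrightarrow> x \<in> carrier G \<Longrightarrow>
      1 - two_point G S P x (x \<otimes> (inv g \<otimes> h)) \<le> M * (1 - measure P {\<omega> \<in> space P. \<one> \<in> \<omega>})"
      using two_point_near_1[of "inv g \<otimes> h"] gh by blast
    have "1 - \<tau> n g h \<le> M * (1/2)^n" for n
    proof -
      have "1 - \<tau> n g h \<le> M * (1 - measure (P n) {\<omega> \<in> space (P n). \<one> \<in> \<omega>})"
        using M(2)[OF P(1)[of n] gh(1)] gh by (simp add: m_assoc[symmetric] \<tau>_def)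
      also have "\<dots> \<le> M * (1/2)^n"
        using M(1) P(2)[of n] by (intro mult_left_mono) auto
      finally show ?thesis .
    qed
    then show ?thesis using M(1) by blast
  qed
  have \<tau>_le: "\<tau> n g h \<le> 1" for n g h using P.two_point_le_1 by (simp add: \<tau>_def)
  \<comment> \<open>Two entries of \<open>\<tau> n\<close> are added and two subtracted, so the
    constants cancel and what remains is a signed sum of four terms \<open>1 - \<tau> n\<close>,
    each of order \<open>(1/2)^n\<close>. This makes the series converge.\<close>
  define k where "k n = centered_kernel \<one> (\<tau> n)" for n
  have psd: "psd_on (carrier G) (k n)" for n
    unfolding k_def \<tau>_def by (rule psd_on_centered_kernel[OF P.psd_on_two_point one_closed])
  have summable: "summable (\<lambda>n. k n g h)" if gh: "g \<in> carrier G" "h \<in> carrier G" for g h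
  proof -
    obtain M1 where M1: "0 \<le> M1" "\<And>n. 1 - \<tau> n g h \<le> M1 * (1/2)^n" using \<tau>_near[OF gh] by blast
    obtain M2 where M2: "0 \<le> M2" "\<And>n. 1 - \<tau> n g \<one> \<le> M2 * (1/2)^n" using \<tau>_near[OF gh(1) one_closed] by blast
    obtain M3 where M3: "0 \<le> M3" "\<And>n. 1 - \<tau> n \<one> h \<le> M3 * (1/2)^n" using \<tau>_near[OF one_closed gh(2)] by blast
    obtain M4 where M4: "0 \<le> M4" "\<And>n. 1 - \<tau> n \<one> \<one> \<le> M4 * (1/2)^n" using \<tau>_near[OF one_closed one_closed] by blast
    have b: "\<bar>k n g h\<bar> \<le> (M1 + M2 + M3 + M4) * (1/2)^n" for n
    proof -
      have "0 \<le> M1 * (1/2)^n" "0 \<le> M2 * (1/2)^n" "0 \<le> M3 * (1/2)^n" "0 \<le> M4 * (1/2)^n"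
        using M1(1) M2(1) M3(1) M4(1) by simp_all
      then show ?thesis
        using M1(2)[of n] M2(2)[of n] M3(2)[of n] M4(2)[of n] \<tau>_le[of n g h] \<tau>_le[of n g \<one>]
          \<tau>_le[of n \<one> h] \<tau>_le[of n \<one> \<one>]
        unfolding k_def centered_kernel_def distrib_right by linarith
    qed
    have s: "summable (\<lambda>n. (M1 + M2 + M3 + M4) * (1/2 :: real)^n)"
      by (intro summable_mult summable_geometric) simp
    show ?thesis by (rule summable_comparison_test'[OF s, of 0]) (use b in simp)
  qed
  have kd: "kernel_dist (k n) g h = kernel_dist (\<tau> n) g h" if "g \<in> carrier G" "h \<in> carrier G" for n g h
    using P.two_point_sym[of n] by (simp add: kernel_dist_def k_def centered_kernel_def \<tau>_def)
  define K where "K g h = (\<Sum>n. k n g h)" for g h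
  have Kd: "(\<lambda>n. kernel_dist (k n) g h) sums kernel_dist K g h" if "g \<in> carrier G" "h \<in> carrier G" for g h
    unfolding kernel_dist_def K_def using that
    by (intro sums_diff sums_add sums_mult summable_sums summable)
  have "psd_on (carrier G) K"
    unfolding K_def using psd summable by (rule psd_on_suminf)
  moreover have "K \<one> \<one> = 0" by (simp add: K_def k_def centered_kernel_def)
  moreover have "kernel_dist K (g \<otimes> h) (g \<otimes> x) = kernel_dist K h x"
    if "g \<in> carrier G" "h \<in> carrier G" "x \<in> carrier G" for g h x
  proof (rule sums_unique2)
    show "(\<lambda>n. kernel_dist (k n) h x) sums kernel_dist K (g \<otimes> h) (g \<otimes> x)"
      using Kd[of "g \<otimes> h" "g \<otimes> x"] that P.two_point_mult
      by (simp add: kd) (simp add: kernel_dist_def \<tau>_def)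
  qed (use Kd that in blast)
  moreover have "finite {g \<in> carrier G. kernel_dist K \<one> g \<le> r}" for r
  proof -
    \<comment> \<open>Far from the identity each of the terms 1 to \<open>N\<close> contributes at
      least 1/2, so their sum exceeds \<open>r\<close> once \<open>N > 2 * r\<close>. All exceptions
      lie in \<open>N\<close> finite balls.\<close>
    obtain N :: nat where N: "2 * r < real N" using reals_Archimedean2 by blast
    have "\<exists>R. \<forall>g\<in>carrier G. \<forall>h\<in>carrier G. R < real (cayley_dist G S g h) \<longrightarrow> \<tau> n g h < 1/4" for n
      unfolding \<tau>_def by (rule vanishes_at_infinityD[OF P(3) P.two_point_le_1]) simp
    then obtain R where R: "\<And>n g h. g \<in> carrier G \<Longrightarrow> h \<in> carrier G \<Longrightarrow>
        R n < real (cayley_dist G S g h) \<Longrightarrow> \<tau> n g h < 1/4"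
      by metis
    have "\<exists>n\<in>{1..N}. cayley_dist G S \<one> g \<le> nat \<lfloor>R n\<rfloor>" if g: "g \<in> carrier G" and le: "kernel_dist K \<one> g \<le> r" for g
    proof (rule ccontr)
      assume neg: "\<not> ?thesis"
      have nonneg: "0 \<le> kernel_dist (k n) \<one> g" for n
        using psd_on_diag_nonneg[OF psd g, of n] kd[OF one_closed g, of n] P.two_point_sym[of n g \<one>]
        by (simp add: kernel_dist_def k_def centered_kernel_def \<tau>_def)
      \<comment> \<open>The density exceeds 1/2 and \<open>\<tau> n \<one> g\<close> is below 1/4,
        so the kernel distance exceeds \<open>2 * 1/2 - 2 * 1/4\<close>. Index 0 is excluded because
        its density is only known to exceed 0.\<close>
      have big: "1 / 2 \<le> kernel_dist (k n) \<one> g" if n: "n \<in> {1..N}" for n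
      proof -
        have "\<not> cayley_dist G S \<one> g \<le> nat \<lfloor>R n\<rfloor>" using neg n by blast
        then have "R n < real (cayley_dist G S \<one> g)" by linarith
        then have "\<tau> n \<one> g < 1/4" using R g by blast
        moreover have "(1/2 :: real)^n \<le> 1/2" using n power_decreasing[of 1 n "1/2 :: real"] by simp
        then have "1/2 < P.density n" using P(2)[of n] unfolding P.density_def by linarith
        ultimately show ?thesis
          using P.two_point_refl[of \<one> n] P.two_point_refl[OF g, of n]
          unfolding kd[OF one_closed g] by (simp add: kernel_dist_def \<tau>_def)
      qed
      have "(\<Sum>n\<in>{1..N}. 1 / 2) \<le> (\<Sum>n\<in>{1..N}. kernel_dist (k n) \<one> g)"
        by (rule sum_mono) (rule big)
      also have "\<dots> \<le> kernel_dist K \<one> g"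
        unfolding sums_unique[OF Kd[OF one_closed g]]
        by (rule sum_le_suminf) (use Kd[OF one_closed g] nonneg in \<open>auto simp: sums_iff\<close>)
      finally show False using N le by simp
    qed
    then have "{g \<in> carrier G. kernel_dist K \<one> g \<le> r} \<subseteq>
        (\<Union>n\<in>{1..N}. {g \<in> carrier G. cayley_dist G S \<one> g \<le> nat \<lfloor>R n\<rfloor>})"
      by blast
    then show ?thesis by (rule finite_subset) (auto intro: finite_cayley_ball)
  qed
  ultimately show ?thesis unfolding haagerup_kernel_def by blast
qed

end

section \<open>Gaussian fields\<close>

definition gauss :: "(nat \<Rightarrow> real) measure" where
  "gauss = (\<Pi>\<^sub>M i\<in>UNIV. std_normal_distribution)"

lemma prob_space_std_normal: "prob_space std_normal_distribution"
  using real_dist_normal_dist by (rule real_distribution.axioms(1))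

interpretation gauss: prob_space gauss
  unfolding gauss_def by (rule prob_space_PiM) (rule prob_space_std_normal)

lemma sets_gauss [measurable_cong]: "sets gauss = sets (\<Pi>\<^sub>M i\<in>UNIV. borel)"
  unfolding gauss_def by (rule sets_PiM_cong) auto

lemma measurable_gauss_component [measurable]: "(\<lambda>\<xi>. \<xi> i) \<in> borel_measurable gauss"
  by measurable

lemma distr_gauss_component: "distr gauss borel (\<lambda>\<xi>. \<xi> i) = std_normal_distribution"
proof -
  have "distr gauss borel (\<lambda>\<xi>. \<xi> i) = distr gauss std_normal_distribution (\<lambda>\<xi>. \<xi> i)"
    by (rule distr_cong) auto
  also have "\<dots> = std_normal_distribution"
    unfolding gauss_def by (rule distr_PiM_component) (auto intro: prob_space_std_normal)
  finally show ?thesis .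
qed

lemma indep_gauss_components: "gauss.indep_vars (\<lambda>_. borel) (\<lambda>i \<xi>. \<xi> i) UNIV"
proof (subst gauss.indep_vars_iff_distr_eq_PiM)
  have "distr gauss (\<Pi>\<^sub>M i\<in>UNIV. borel) (\<lambda>\<xi>. \<lambda>i\<in>UNIV. \<xi> i) = distr gauss gauss (\<lambda>\<xi>. \<xi>)"
    by (rule distr_cong) (auto simp: sets_gauss)
  then show "distr gauss (\<Pi>\<^sub>M i\<in>UNIV. borel) (\<lambda>\<xi>. \<lambda>i\<in>UNIV. \<xi> i) =
      (\<Pi>\<^sub>M i\<in>UNIV. distr gauss borel (\<lambda>\<xi>. \<xi> i))"
    unfolding distr_gauss_component by (simp add: gauss_def[symmetric])
qed auto

definition lin :: "nat \<Rightarrow> (nat \<Rightarrow> real) \<Rightarrow> (nat \<Rightarrow> real) \<Rightarrow> real" where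
  "lin n a \<xi> = (\<Sum>l<n. a l * \<xi> l)"

lemma lin_measurable [measurable]: "lin n a \<in> borel_measurable gauss"
  unfolding lin_def by measurable

lemma lin_extend:
  assumes "n \<le> m" "\<And>l. n \<le> l \<Longrightarrow> a l = 0"
  shows "lin n a = lin m a"
  unfolding lin_def using assms by (intro ext sum.mono_neutral_left) auto

lemma char_lin: "(CLINT \<xi>|gauss. iexp (lin n a \<xi>)) = exp (- (\<Sum>l<n. (a l)\<^sup>2) / 2)"
proof -
  have "gauss.indep_vars (\<lambda>_. borel) (\<lambda>l \<xi>. a l * \<xi> l) {..<n}"
    using gauss.indep_vars_compose2[OF gauss.indep_vars_subset[OF indep_gauss_components, of "{..<n}"],
        of "\<lambda>l x. a l * x" "\<lambda>_. borel"] by simp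
  then have "char (distr gauss borel (\<lambda>\<xi>. \<Sum>l<n. a l * \<xi> l)) 1 =
      (\<Prod>l<n. char (distr gauss borel (\<lambda>\<xi>. a l * \<xi> l)) 1)"
    by (rule gauss.char_distr_sum)
  also have "\<dots> = (\<Prod>l<n. complex_of_real (exp (- (a l)\<^sup>2 / 2)))"
  proof (rule prod.cong[OF refl])
    fix l
    have "char (distr gauss borel (\<lambda>\<xi>. a l * \<xi> l)) 1 = char (distr gauss borel (\<lambda>\<xi>. \<xi> l)) (a l)"
      by (simp add: char_def integral_distr)
    then show "char (distr gauss borel (\<lambda>\<xi>. a l * \<xi> l)) 1 = complex_of_real (exp (- (a l)\<^sup>2 / 2))"
      by (simp add: distr_gauss_component char_std_normal_distribution)
  qed
  also have "\<dots> = complex_of_real (exp (- (\<Sum>l<n. (a l)\<^sup>2) / 2))"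
    by (simp add: exp_sum[symmetric] sum_negf sum_divide_distrib flip: of_real_prod)
  finally show ?thesis by (simp add: char_def integral_distr lin_def)
qed

text \<open>A combination of functionals is again a functional \<open>lin n\<close>, so the joint
  characteristic function at \<open>s\<close> is \<open>exp (- q / 2)\<close> with \<open>q\<close>
  the Gram form at \<open>s\<close>. It depends on the vectors only through their Gram
  matrix.\<close>

lemma gauss_prob_eq_if_gram_eq:
  assumes K: "finite K"
    and gram: "\<And>i j. i \<in> K \<Longrightarrow> j \<in> K \<Longrightarrow> (\<Sum>l<n. a i l * a j l) = (\<Sum>l<n. b i l * b j l)"
    and A: "\<And>i. i \<in> K \<Longrightarrow> A i \<in> sets borel"
  shows "gauss.prob {\<xi> \<in> space gauss. \<forall>i\<in>K. lin n (a i) \<xi> \<in> A i} =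
    gauss.prob {\<xi> \<in> space gauss. \<forall>i\<in>K. lin n (b i) \<xi> \<in> A i}"
proof (rule gauss.prob_eq_if_joint_char_eq[OF K _ _ _ A])
  fix s :: "_ \<Rightarrow> real"
  have comb: "(\<Sum>i\<in>K. s i * lin n (c i) \<xi>) = lin n (\<lambda>l. \<Sum>i\<in>K. s i * c i l) \<xi>" for c \<xi>
  proof -
    have "(\<Sum>i\<in>K. s i * lin n (c i) \<xi>) = (\<Sum>i\<in>K. \<Sum>l<n. s i * c i l * \<xi> l)"
      by (simp add: lin_def sum_distrib_left mult.assoc)
    also have "\<dots> = (\<Sum>l<n. \<Sum>i\<in>K. s i * c i l * \<xi> l)" by (rule sum.swap)
    finally show ?thesis by (simp add: lin_def sum_distrib_right)
  qed
  have sq: "(\<Sum>l<n. (\<Sum>i\<in>K. s i * c i l)\<^sup>2) = (\<Sum>i\<in>K. \<Sum>j\<in>K. s i * s j * (\<Sum>l<n. c i l * c j l))" for c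
  proof -
    have "(\<Sum>l<n. (\<Sum>i\<in>K. s i * c i l)\<^sup>2) = (\<Sum>l<n. \<Sum>i\<in>K. \<Sum>j\<in>K. s i * c i l * (s j * c j l))"
      by (simp add: power2_eq_square sum_product)
    also have "\<dots> = (\<Sum>i\<in>K. \<Sum>l<n. \<Sum>j\<in>K. s i * c i l * (s j * c j l))" by (rule sum.swap)
    also have "\<dots> = (\<Sum>i\<in>K. \<Sum>j\<in>K. \<Sum>l<n. s i * c i l * (s j * c j l))" by (intro sum.cong refl sum.swap)
    finally show ?thesis by (simp add: sum_distrib_left algebra_simps)
  qed
  have "(\<Sum>l<n. (\<Sum>i\<in>K. s i * a i l)\<^sup>2) = (\<Sum>l<n. (\<Sum>i\<in>K. s i * b i l)\<^sup>2)"
    unfolding sq using gram by (intro sum.cong refl) simp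
  then show "(CLINT \<xi>|gauss. iexp (\<Sum>i\<in>K. s i * lin n (a i) \<xi>)) = (CLINT \<xi>|gauss. iexp (\<Sum>i\<in>K. s i * lin n (b i) \<xi>))"
    unfolding comb char_lin by simp
qed auto

text \<open>Boxes generate the product \<sigma>-algebra. The equality of laws is needed for
  functionals of the field other than indicators of boxes.\<close>

lemma gauss_distr_eq_if_gram_eq:
  assumes K: "finite K"
    and gram: "\<And>i j. i \<in> K \<Longrightarrow> j \<in> K \<Longrightarrow> (\<Sum>l<n. a i l * a j l) = (\<Sum>l<n. b i l * b j l)"
  shows "distr gauss (\<Pi>\<^sub>M i\<in>K. borel) (\<lambda>\<xi>. \<lambda>i\<in>K. lin n (a i) \<xi>) =
    distr gauss (\<Pi>\<^sub>M i\<in>K. borel) (\<lambda>\<xi>. \<lambda>i\<in>K. lin n (b i) \<xi>)"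
proof (rule measure_eqI_PiM_finite[OF K])
  have em: "emeasure (distr gauss (\<Pi>\<^sub>M i\<in>K. borel) (\<lambda>\<xi>. \<lambda>i\<in>K. lin n (c i) \<xi>)) (Pi\<^sub>E K A) =
      ennreal (gauss.prob {\<xi> \<in> space gauss. \<forall>i\<in>K. lin n (c i) \<xi> \<in> A i})"
    if A: "\<And>i. i \<in> K \<Longrightarrow> A i \<in> sets borel" for A c
  proof -
    have "(\<lambda>\<xi>. \<lambda>i\<in>K. lin n (c i) \<xi>) -` Pi\<^sub>E K A \<inter> space gauss = {\<xi> \<in> space gauss. \<forall>i\<in>K. lin n (c i) \<xi> \<in> A i}"
      by (auto simp: PiE_iff)
    then show ?thesis
      using A K by (subst emeasure_distr) (auto simp: gauss.emeasure_eq_measure intro!: sets_PiM_I_finite measurable_restrict)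
  qed
  show "emeasure (distr gauss (\<Pi>\<^sub>M i\<in>K. borel) (\<lambda>\<xi>. \<lambda>i\<in>K. lin n (a i) \<xi>)) (Pi\<^sub>E K A) =
      emeasure (distr gauss (\<Pi>\<^sub>M i\<in>K. borel) (\<lambda>\<xi>. \<lambda>i\<in>K. lin n (b i) \<xi>)) (Pi\<^sub>E K A)"
    if A: "\<And>i. i \<in> K \<Longrightarrow> A i \<in> sets borel" for A
  proof -
    have "gauss.prob {\<xi> \<in> space gauss. \<forall>i\<in>K. lin n (a i) \<xi> \<in> A i} =
        gauss.prob {\<xi> \<in> space gauss. \<forall>i\<in>K. lin n (b i) \<xi> \<in> A i}"
      by (rule gauss_prob_eq_if_gram_eq[OF K gram A])
    then show ?thesis using em[of A a] em[of A b] A by simp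
  qed
  show "range (\<lambda>_::nat. Pi\<^sub>E K (\<lambda>_. UNIV)) \<subseteq> prod_algebra K (\<lambda>_. borel)"
    using K by (auto intro!: prod_algebraI_finite)
  show "emeasure (distr gauss (\<Pi>\<^sub>M i\<in>K. borel) (\<lambda>\<xi>. \<lambda>i\<in>K. lin n (a i) \<xi>)) (Pi\<^sub>E K (\<lambda>_. UNIV)) \<noteq> \<infinity>" for i :: nat
    using em[of "\<lambda>_. UNIV" a] by simp
qed (auto simp: space_PiM)

text \<open>Only the norm \<open>d\<close> of \<open>a\<close> matters, so \<open>lin n a\<close>
  can be replaced by \<open>d\<close> times one coordinate. The normal density is at most 1, so an
  interval of length \<open>2 * c / d\<close> has at most this probability.\<close>

lemma gauss_small_ball:
  assumes "0 < (\<Sum>l<n. (a l)\<^sup>2)" "0 \<le> c"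
  shows "gauss.prob {\<xi> \<in> space gauss. \<bar>lin n a \<xi>\<bar> < c} \<le> 2 * c / sqrt (\<Sum>l<n. (a l)\<^sup>2)"
proof -
  define d where "d = sqrt (\<Sum>l<n. (a l)\<^sup>2)"
  have d: "0 < d" using assms by (simp add: d_def)
  have n: "0 < n" using assms by (cases n) auto
  define b where "b l = (if l = 0 then d else 0)" for l :: nat
  have b: "(\<Sum>l<n. b l * f l) = d * f 0" for f
    using n by (simp add: b_def if_distrib[of "\<lambda>z. z * _"] cong: if_cong)
  have lb: "lin n b \<xi> = d * \<xi> 0" for \<xi> unfolding lin_def by (rule b)
  have "(\<Sum>l<n. b l * b l) = d * d" by (simp add: b) (simp add: b_def)
  then have bb: "(\<Sum>l<n. a l * a l) = (\<Sum>l<n. b l * b l)"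
    using assms(1) by (simp add: d_def power2_eq_square)
  \<comment> \<open>The comparison of joint laws is applied to a family with a single member,
    indexed by \<open>()\<close>.\<close>
  have "gauss.prob {\<xi> \<in> space gauss. \<forall>i\<in>{()}. lin n a \<xi> \<in> {-c<..<c}} =
      gauss.prob {\<xi> \<in> space gauss. \<forall>i\<in>{()}. lin n b \<xi> \<in> {-c<..<c}}"
    by (rule gauss_prob_eq_if_gram_eq[where a="\<lambda>_. a" and b="\<lambda>_. b"]) (auto simp: bb)
  also have "{\<xi> \<in> space gauss. \<forall>i\<in>{()}. lin n b \<xi> \<in> {-c<..<c}} = (\<lambda>\<xi>. \<xi> 0) -` {- c / d<..<c / d} \<inter> space gauss"
    using d by (auto simp: lb field_simps)
  also have "gauss.prob \<dots> = measure (distr gauss borel (\<lambda>\<xi>. \<xi> 0)) {- c / d<..<c / d}"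
    by (rule measure_distr[symmetric]) auto
  also have "\<dots> = measure std_normal_distribution {- c / d<..<c / d}"
    by (simp add: distr_gauss_component)
  also have "\<dots> \<le> 2 * c / d"
  proof -
    have "emeasure std_normal_distribution {- c / d<..<c / d} =
        (\<integral>\<^sup>+x. ennreal (std_normal_density x) * indicator {- c / d<..<c / d} x \<partial>lborel)"
      by (rule emeasure_density) auto
    also have "\<dots> \<le> (\<integral>\<^sup>+x. indicator {- c / d<..<c / d} x \<partial>lborel)"
    proof (rule nn_integral_mono)
      fix x :: real
      have "1 \<le> sqrt (2 * pi)" using pi_ge_two by (intro real_le_rsqrt) simp
      then have "std_normal_density x \<le> 1 * 1"
        unfolding std_normal_density_def by (intro mult_mono) auto
      then show "ennreal (std_normal_density x) * indicator {- c / d<..<c / d} x \<le> indicator {- c / d<..<c / d} x"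
        by (auto simp: indicator_def)
    qed
    also have "\<dots> = ennreal (2 * c / d)"
      using d assms(2) by simp
    finally show ?thesis
      unfolding measure_def using d assms(2)
      by (metis enn2real_leI divide_nonneg_pos mult_nonneg_nonneg zero_le_numeral)
  qed
  finally show ?thesis by (simp add: d_def abs_less_iff conj_commute minus_less_iff)
qed

section \<open>Uniform shifts modulo 1\<close>

definition unif :: "real measure" where "unif = density lborel (indicator {0..<1})"

lemma sets_unif [measurable_cong, simp]: "sets unif = sets borel"
  by (simp add: unif_def)

lemma space_unif [simp]: "space unif = UNIV"
  by (simp add: unif_def)

interpretation unif: prob_space unif
  by (rule prob_spaceI) (simp add: unif_def emeasure_density)

text \<open>With \<open>r\<close> the fractional part of \<open>c\<close>, the interval from
  \<open>r\<close> to \<open>r + 1\<close> is cut at 1 and its right piece moved back by one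
  period.\<close>

lemma nn_integral_unif_shift:
  fixes f :: "real \<Rightarrow> ennreal"
  assumes [measurable]: "f \<in> borel_measurable borel"
    and per: "\<And>(n::int) u. f (u + of_int n) = f u"
  shows "(\<integral>\<^sup>+u. f (c + u) \<partial>unif) = (\<integral>\<^sup>+u. f u \<partial>unif)"
proof -
  have shift: "(\<integral>\<^sup>+u. g u \<partial>lborel) = (\<integral>\<^sup>+u. g (t + u) \<partial>lborel)"
    if [measurable]: "g \<in> borel_measurable borel" for g :: "real \<Rightarrow> ennreal" and t
    using nn_integral_real_affine[OF that, of 1 t] by simp
  define r where "r = frac c"
  have r: "0 \<le> r" "r < 1" by (simp_all add: r_def frac_lt_1)
  have "(\<integral>\<^sup>+u. f (c + u) \<partial>unif) = (\<integral>\<^sup>+u. f (r + u) * indicator {0..<1} u \<partial>lborel)"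
    unfolding unif_def using per[of "r + u" "\<lfloor>c\<rfloor>" for u]
    by (subst nn_integral_density) (auto simp: r_def frac_def algebra_simps intro!: nn_integral_cong)
  also have "\<dots> = (\<integral>\<^sup>+u. f u * indicator {r..<r + 1} u \<partial>lborel)"
    by (subst (2) shift[of _ r]) (auto intro!: nn_integral_cong simp: indicator_def)
  also have "\<dots> = (\<integral>\<^sup>+u. f u * indicator {r..<1} u + f u * indicator {1..<r + 1} u \<partial>lborel)"
    using r by (intro nn_integral_cong) (auto simp: indicator_def)
  also have "\<dots> = (\<integral>\<^sup>+u. f u * indicator {r..<1} u \<partial>lborel) + (\<integral>\<^sup>+u. f u * indicator {1..<r + 1} u \<partial>lborel)"
    by (rule nn_integral_add) auto
  also have "(\<integral>\<^sup>+u. f u * indicator {1..<r + 1} u \<partial>lborel) = (\<integral>\<^sup>+u. f u * indicator {0..<r} u \<partial>lborel)"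
    using per[of _ 1] by (subst shift[of _ 1]) (auto intro!: nn_integral_cong simp: indicator_def add.commute)
  also have "(\<integral>\<^sup>+u. f u * indicator {r..<1} u \<partial>lborel) + (\<integral>\<^sup>+u. f u * indicator {0..<r} u \<partial>lborel) =
      (\<integral>\<^sup>+u. f u * indicator {r..<1} u + f u * indicator {0..<r} u \<partial>lborel)"
    by (rule nn_integral_add[symmetric]) auto
  also have "\<dots> = (\<integral>\<^sup>+u. f u * indicator {0..<1} u \<partial>lborel)"
    using r by (intro nn_integral_cong) (auto simp: indicator_def)
  also have "\<dots> = (\<integral>\<^sup>+u. f u \<partial>unif)"
    unfolding unif_def by (subst nn_integral_density) (auto simp: mult.commute)
  finally show ?thesis .
qed

section \<open>From kernels to percolations\<close>

context cayley_graph
begin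

text \<open>The events that all of \<open>F\<close> is open, for finite \<open>F\<close>, generate
  the \<sigma>-algebra and are closed under intersection:
  \<open>C F \<inter> C F' = C (F \<union> F')\<close>.\<close>

lemma config_measure_eqI:
  assumes M: "prob_space M" "sets M = sets (config_space G)" and N: "sets N = sets (config_space G)"
    and eq: "\<And>F. finite F \<Longrightarrow> F \<subseteq> carrier G \<Longrightarrow>
      emeasure M {\<omega> \<in> Pow (carrier G). F \<subseteq> \<omega>} = emeasure N {\<omega> \<in> Pow (carrier G). F \<subseteq> \<omega>}"
  shows "M = N"
proof -
  interpret M: prob_space M by (rule M(1))
  define C where "C F = {\<omega> \<in> Pow (carrier G). F \<subseteq> \<omega>}" for F
  define E where "E = C ` {F. finite F \<and> F \<subseteq> carrier G}"
  have "sets (config_space G) = sigma_sets (Pow (carrier G)) E"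
  proof
    have "{\<omega> \<in> Pow (carrier G). g \<in> \<omega>} \<in> E" if "g \<in> carrier G" for g
      unfolding E_def C_def using that by (intro image_eqI[of _ _ "{g}"]) auto
    then show "sets (config_space G) \<subseteq> sigma_sets (Pow (carrier G)) E"
      unfolding config_space_def
      by (subst sets_measure_of) (auto intro!: sigma_sets_mono')
    have "C F \<in> sets (config_space G)" if F: "finite F" for F
    proof -
      have "Measurable.pred (config_space G) (\<lambda>\<omega>. \<forall>g\<in>F. g \<in> \<omega>)"
        using F pred_member_config by measurable
      moreover have "C F = {\<omega> \<in> space (config_space G). \<forall>g\<in>F. g \<in> \<omega>}"
        by (auto simp: C_def space_config)
      ultimately show ?thesis by (simp add: pred_def)
    qed
    then have "E \<subseteq> sets (config_space G)" by (auto simp: E_def)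
    then show "sigma_sets (Pow (carrier G)) E \<subseteq> sets (config_space G)"
      using sets.sigma_sets_subset space_config by metis
  qed
  then have sE: "sets M = sigma_sets (Pow (carrier G)) E" "sets N = sigma_sets (Pow (carrier G)) E"
    using M N by simp_all
  show ?thesis
  proof (rule measure_eqI_generator_eq[OF _ _ _ sE])
    show "Int_stable E"
    proof (rule Int_stableI)
      fix a b assume "a \<in> E" "b \<in> E"
      then obtain F F' where F: "finite F" "F \<subseteq> carrier G" "finite F'" "F' \<subseteq> carrier G" "a = C F" "b = C F'"
        by (auto simp: E_def)
      then have "a \<inter> b = C (F \<union> F')" by (auto simp: C_def)
      then show "a \<inter> b \<in> E" using F by (auto simp: E_def)
    qed
    show "E \<subseteq> Pow (Pow (carrier G))" by (auto simp: E_def C_def)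
    show "emeasure M a = emeasure N a" if "a \<in> E" for a
      using that eq by (auto simp: E_def C_def)
    show "range (\<lambda>_::nat. C {}) \<subseteq> E" by (auto simp: E_def)
    show "(\<Union>i::nat. C {}) = Pow (carrier G)" by (auto simp: C_def)
    show "emeasure M (C {}) \<noteq> \<infinity>" for i :: nat by simp
  qed
qed

lemma vanishes_at_infinityI:
  assumes inf: "infinite (carrier G)" and nonneg: "\<And>g h. 0 \<le> \<tau> g h"
    and small: "\<And>e. 0 < e \<Longrightarrow> \<exists>r::nat. \<forall>g\<in>carrier G. \<forall>h\<in>carrier G. r < cayley_dist G S g h \<longrightarrow> \<tau> g h \<le> e"
  shows "vanishes_at_infinity G S \<tau>"
  unfolding vanishes_at_infinity_def
proof (rule tendstoI)
  fix e :: real assume e: "0 < e"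
  let ?A = "\<lambda>r. {(g, h). g \<in> carrier G \<and> h \<in> carrier G \<and> r < real (cayley_dist G S g h)}"
  obtain r :: nat where r: "\<forall>g\<in>carrier G. \<forall>h\<in>carrier G. r < cayley_dist G S g h \<longrightarrow> \<tau> g h \<le> e / 2"
    using small[of "e / 2"] e by auto
  have "\<bar>SUP (g, h)\<in>?A t. \<tau> g h\<bar> < e" if t: "real r \<le> t" for t
  proof -
    \<comment> \<open>Balls are finite, so an infinite group has pairs at arbitrarily large
      distance. The supremum is thus taken over a nonempty set and inherits the bounds 0 and
      \<open>e / 2\<close>; over the empty set its value would be unspecified.\<close>
    have "\<not> carrier G \<subseteq> {h \<in> carrier G. cayley_dist G S \<one> h \<le> nat \<lceil>t\<rceil>}"
      using inf finite_cayley_ball[OF one_closed] finite_subset by blast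
    then obtain h where "h \<in> carrier G" "\<not> cayley_dist G S \<one> h \<le> nat \<lceil>t\<rceil>" by blast
    then have h: "(\<one>, h) \<in> ?A t" by simp linarith
    have le: "\<tau> g h \<le> e / 2" if "(g, h) \<in> ?A t" for g h
    proof -
      have "real r < real (cayley_dist G S g h)" using that t by auto
      then show ?thesis using r that by auto
    qed
    have "(SUP (g, h)\<in>?A t. \<tau> g h) \<le> e / 2"
      using h le by (intro cSUP_least) (auto simp del: mem_Collect_eq)
    moreover have "\<tau> \<one> h \<le> (SUP (g, h)\<in>?A t. \<tau> g h)"
      using cSUP_upper[OF h, of "\<lambda>(g, h). \<tau> g h"] le by (force intro!: bdd_aboveI[of _ "e / 2"])
    ultimately show ?thesis using nonneg[of \<one> h] e by linarith
  qed
  then show "\<forall>\<^sub>F t in at_top. dist (SUP (g, h)\<in>?A t. \<tau> g h) 0 < e"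
    unfolding eventually_at_top_linorder by (intro exI[of _ "real r"]) simp
qed

end

section \<open>Cutting the group along a Gaussian field\<close>

locale gaussian_cuts = cayley_graph G S for G :: "('a, 'b) monoid_scheme" (structure) and S :: "'a set" +
  fixes k :: "'a \<Rightarrow> 'a \<Rightarrow> real" and v :: "'a \<Rightarrow> nat \<Rightarrow> real" and N :: "'a \<Rightarrow> nat"
  assumes kernel: "haagerup_kernel G k"
    and v_zero: "\<And>x l. x \<in> carrier G \<Longrightarrow> N x \<le> l \<Longrightarrow> v x l = 0"
    and v_gram: "\<And>x y. x \<in> carrier G \<Longrightarrow> y \<in> carrier G \<Longrightarrow> k x y = (\<Sum>l<N x. v x l * v y l)"
begin

lemma gram:
  assumes "x \<in> carrier G" "y \<in> carrier G" "N x \<le> n"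
  shows "(\<Sum>l<n. v x l * v y l) = k x y"
  unfolding v_gram[OF assms(1,2)] using assms v_zero by (intro sum.mono_neutral_right) auto

lemma psd: "psd_on (carrier G) k"
  and kernel_one: "k \<one> \<one> = 0"
  and kernel_dist_mult: "g \<in> carrier G \<Longrightarrow> h \<in> carrier G \<Longrightarrow> x \<in> carrier G \<Longrightarrow>
    kernel_dist k (g \<otimes> h) (g \<otimes> x) = kernel_dist k h x"
  and kernel_proper: "finite {g \<in> carrier G. kernel_dist k \<one> g \<le> r}"
  using kernel unfolding haagerup_kernel_def by blast+

lemma kernel_sym: "x \<in> carrier G \<Longrightarrow> y \<in> carrier G \<Longrightarrow> k x y = k y x"
  by (rule psd_on_sym[OF psd])

lemma kernel_one_right: "x \<in> carrier G \<Longrightarrow> k x \<one> = 0"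
  by (rule psd_on_zero_diag[OF psd _ one_closed kernel_one])

text \<open>Polarization of the invariance of \<open>kernel_dist\<close>, with \<open>k\<close>
  vanishing at the identity. The left side is the covariance of the increments of the field from
  \<open>x\<close>, the right side that of its values.\<close>

lemma kernel_increments:
  assumes "x \<in> carrier G" "g \<in> carrier G" "h \<in> carrier G"
  shows "k (x \<otimes> g) (x \<otimes> h) - k (x \<otimes> g) x - k x (x \<otimes> h) + k x x = k g h"
proof -
  have "kernel_dist k x (x \<otimes> g) = k g g" if "g \<in> carrier G" for g
    using kernel_dist_mult[of x \<one> g] assms(1) that kernel_one kernel_one_right[of g] kernel_sym[of g \<one>]
    by (simp add: kernel_dist_def)
  from this[OF assms(2)] this[OF assms(3)] show ?thesis
    using kernel_dist_mult[OF assms] kernel_sym[of "x \<otimes> g" x] assms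
    unfolding kernel_dist_def by simp
qed

definition field :: "'a \<Rightarrow> (nat \<Rightarrow> real) \<Rightarrow> real" where
  "field g = lin (N g) (v g)"

lemma field_measurable [measurable]: "field g \<in> borel_measurable gauss"
  unfolding field_def by measurable

lemma field_eq_lin:
  assumes "g \<in> carrier G" "N g \<le> n"
  shows "field g = lin n (v g)"
  unfolding field_def using assms v_zero by (intro lin_extend) auto

text \<open>A vertex is open if no level set boundary of the randomly shifted and discretized field
  separates it from a neighbor.\<close>

definition uncut :: "real \<Rightarrow> 'a \<Rightarrow> (nat \<Rightarrow> real) \<times> real \<Rightarrow> bool" where
  "uncut \<kappa> g = (\<lambda>(\<xi>, u). \<forall>s\<in>S. \<lfloor>\<kappa> * field g \<xi> + u\<rfloor> = \<lfloor>\<kappa> * field (g \<otimes> s) \<xi> + u\<rfloor>)"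

definition cut_config :: "real \<Rightarrow> (nat \<Rightarrow> real) \<times> real \<Rightarrow> 'a set" where
  "cut_config \<kappa> p = {g \<in> carrier G. uncut \<kappa> g p}"

definition cut_percolation :: "real \<Rightarrow> 'a set measure" where
  "cut_percolation \<kappa> = distr (gauss \<Otimes>\<^sub>M unif) (config_space G) (cut_config \<kappa>)"

lemma uncut_measurable [measurable]: "Measurable.pred (gauss \<Otimes>\<^sub>M unif) (uncut \<kappa> g)"
  unfolding uncut_def split_beta' using finite_generators by measurable

lemma cut_config_measurable [measurable]: "cut_config \<kappa> \<in> gauss \<Otimes>\<^sub>M unif \<rightarrow>\<^sub>M config_space G"
proof -
  have "cut_config \<kappa> -` {\<omega> \<in> Pow (carrier G). g \<in> \<omega>} \<inter> space (gauss \<Otimes>\<^sub>M unif) \<in> sets (gauss \<Otimes>\<^sub>M unif)"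
    if g: "g \<in> carrier G" for g
  proof -
    have "cut_config \<kappa> -` {\<omega> \<in> Pow (carrier G). g \<in> \<omega>} \<inter> space (gauss \<Otimes>\<^sub>M unif) =
      {p \<in> space (gauss \<Otimes>\<^sub>M unif). uncut \<kappa> g p}"
      using g by (auto simp: cut_config_def)
    also have "\<dots> \<in> sets (gauss \<Otimes>\<^sub>M unif)" by measurable
    finally show ?thesis .
  qed
  then show ?thesis
    unfolding config_space_def by (intro measurable_measure_of) (auto simp: cut_config_def)
qed

text \<open>Subtracting the value at \<open>x\<close> from the translated field amounts to a shift of \<open>u\<close>, which does not
  matter modulo \<open>1\<close>, and the increments have the law of the field.\<close>

lemma emeasure_uncut_mult:
  assumes x: "x \<in> carrier G" and F: "finite F" "F \<subseteq> carrier G"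
  shows "emeasure (gauss \<Otimes>\<^sub>M unif) {p \<in> space (gauss \<Otimes>\<^sub>M unif). \<forall>g\<in>F. uncut \<kappa> (x \<otimes> g) p} =
    emeasure (gauss \<Otimes>\<^sub>M unif) {p \<in> space (gauss \<Otimes>\<^sub>M unif). \<forall>g\<in>F. uncut \<kappa> g p}"
proof -
  \<comment> \<open>All vertices that the events at \<open>F\<close> inspect. Because
    \<open>K\<close> is finite, finite-dimensional laws suffice.\<close>
  define K where "K = F \<union> (\<Union>g\<in>F. (\<lambda>s. g \<otimes> s) ` S)"
  have K: "finite K" "K \<subseteq> carrier G" "\<And>g. g \<in> F \<Longrightarrow> g \<in> K" "\<And>g s. g \<in> F \<Longrightarrow> s \<in> S \<Longrightarrow> g \<otimes> s \<in> K"
    using F finite_generators generators_closed by (auto simp: K_def)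
  define E where "E z u \<longleftrightarrow> (\<forall>g\<in>F. \<forall>s\<in>S. \<lfloor>\<kappa> * z g + u\<rfloor> = \<lfloor>\<kappa> * z (g \<otimes> s) + u\<rfloor>)" for z :: "'a \<Rightarrow> real" and u
  \<comment> \<open>With \<open>u\<close> integrated out, only the increments of \<open>z\<close>
    matter: adding \<open>c\<close> to \<open>z\<close> moves \<open>u\<close> by
    \<open>\<kappa> * c\<close>, which \<open>nn_integral_unif_shift\<close> undoes.\<close>
  define H where "H z = (\<integral>\<^sup>+u. indicator {u. E z u} u \<partial>unif)" for z
  have E_cong: "E z = E z'" if "\<And>h. h \<in> K \<Longrightarrow> z h = z' h" for z z'
    using that K by (simp add: E_def fun_eq_iff)
  have [measurable]: "Measurable.pred borel (E z)" for z
    unfolding E_def using F finite_generators by measurable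
  have H_shift: "H (\<lambda>h. z h + c) = H z" for z c
  proof -
    have per: "E z (u + of_int m) = E z u" for u and m :: int
      unfolding E_def by (simp flip: add.assoc)
    have "E (\<lambda>h. z h + c) u = E z (\<kappa> * c + u)" for u
      unfolding E_def by (simp add: algebra_simps)
    then have "H (\<lambda>h. z h + c) = (\<integral>\<^sup>+u. indicator {u. E z u} (\<kappa> * c + u) \<partial>unif)"
      unfolding H_def by (intro nn_integral_cong) (simp add: indicator_def)
    also have "\<dots> = H z"
      unfolding H_def using per by (intro nn_integral_unif_shift) (simp_all add: indicator_def)
    finally show ?thesis .
  qed
  have zK: "(\<lambda>p. fst p h) \<in> borel_measurable ((\<Pi>\<^sub>M i\<in>K. borel) \<Otimes>\<^sub>M unif)" if "h \<in> K" for h :: 'a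
    by (rule measurable_compose[OF measurable_fst measurable_component_singleton[OF that]])
  have H_meas: "H \<in> borel_measurable (\<Pi>\<^sub>M i\<in>K. borel)"
  proof -
    have "Measurable.pred ((\<Pi>\<^sub>M i\<in>K. borel) \<Otimes>\<^sub>M unif)
        (\<lambda>p. \<lfloor>\<kappa> * fst p g + snd p\<rfloor> = \<lfloor>\<kappa> * fst p (g \<otimes> s) + snd p\<rfloor>)" if "g \<in> F" "s \<in> S" for g s
    proof -
      note [measurable] = zK[OF K(3)[OF that(1)]] zK[OF K(4)[OF that]]
      show ?thesis by measurable
    qed
    then have "Measurable.pred ((\<Pi>\<^sub>M i\<in>K. borel) \<Otimes>\<^sub>M unif) (\<lambda>p. E (fst p) (snd p))"
      unfolding E_def by (intro pred_intros_finite F finite_generators)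
    then have "(\<lambda>(z, u). indicator {u. E z u} u :: ennreal) \<in> borel_measurable ((\<Pi>\<^sub>M i\<in>K. borel) \<Otimes>\<^sub>M unif)"
      by (simp add: indicator_def split_beta')
    then show ?thesis unfolding H_def by (rule unif.borel_measurable_nn_integral)
  qed
  \<comment> \<open>One number of coordinates serves \<open>x\<close> and all vertices involved, so
    that their field values and differences are all functionals \<open>lin n\<close>.\<close>
  obtain n where n: "\<And>h. h \<in> K \<Longrightarrow> N h \<le> n" "\<And>h. h \<in> K \<Longrightarrow> N (x \<otimes> h) \<le> n" "N x \<le> n"
  proof
    let ?T = "insert (N x) (N ` K \<union> (\<lambda>h. N (x \<otimes> h)) ` K)"
    have "finite ?T" using K by simp
    then show "N h \<le> Max ?T" "N (x \<otimes> h) \<le> Max ?T" if "h \<in> K" for h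
      using that by (auto intro!: Max_ge)
    show "N x \<le> Max ?T" using \<open>finite ?T\<close> by (intro Max_ge) auto
  qed
  have emeasure_eq: "emeasure (gauss \<Otimes>\<^sub>M unif) {p \<in> space (gauss \<Otimes>\<^sub>M unif). \<forall>g\<in>F. uncut \<kappa> (y \<otimes> g) p} =
      (\<integral>\<^sup>+\<xi>. H (\<lambda>h. field (y \<otimes> h) \<xi>) \<partial>gauss)" if y: "y \<in> carrier G" for y
  proof -
    have E: "(\<forall>g\<in>F. uncut \<kappa> (y \<otimes> g) (\<xi>, u)) \<longleftrightarrow> E (\<lambda>h. field (y \<otimes> h) \<xi>) u" for \<xi> u
      unfolding uncut_def E_def using y F generators_closed by (auto simp: m_assoc subset_iff)
    have "{p \<in> space (gauss \<Otimes>\<^sub>M unif). \<forall>g\<in>F. uncut \<kappa> (y \<otimes> g) p} \<in> sets (gauss \<Otimes>\<^sub>M unif)"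
      using F by measurable
    then have "emeasure (gauss \<Otimes>\<^sub>M unif) {p \<in> space (gauss \<Otimes>\<^sub>M unif). \<forall>g\<in>F. uncut \<kappa> (y \<otimes> g) p} =
      (\<integral>\<^sup>+\<xi>. \<integral>\<^sup>+u. indicator {p \<in> space (gauss \<Otimes>\<^sub>M unif). \<forall>g\<in>F. uncut \<kappa> (y \<otimes> g) p} (\<xi>, u) \<partial>unif \<partial>gauss)"
      by (rule unif.emeasure_pair_measure)
    also have "\<dots> = (\<integral>\<^sup>+\<xi>. H (\<lambda>h. field (y \<otimes> h) \<xi>) \<partial>gauss)"
      unfolding H_def by (intro nn_integral_cong) (simp add: indicator_def space_pair_measure E)
    finally show ?thesis .
  qed
  have law: "distr gauss (\<Pi>\<^sub>M i\<in>K. borel) (\<lambda>\<xi>. \<lambda>h\<in>K. lin n (\<lambda>l. v (x \<otimes> h) l - v x l) \<xi>) =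
      distr gauss (\<Pi>\<^sub>M i\<in>K. borel) (\<lambda>\<xi>. \<lambda>h\<in>K. lin n (v h) \<xi>)"
  proof (rule gauss_distr_eq_if_gram_eq[OF K(1)])
    fix i j assume ij: "i \<in> K" "j \<in> K"
    then have c: "i \<in> carrier G" "j \<in> carrier G" "N i \<le> n" "N j \<le> n" "N (x \<otimes> i) \<le> n" "N (x \<otimes> j) \<le> n"
      using K n by auto
    have "(\<Sum>l<n. (v (x \<otimes> i) l - v x l) * (v (x \<otimes> j) l - v x l)) =
      k (x \<otimes> i) (x \<otimes> j) - k (x \<otimes> i) x - k x (x \<otimes> j) + k x x"
      using c x n(3)
      by (simp add: gram[symmetric, of _ _ n] algebra_simps sum.distrib sum_subtractf)
    also have "\<dots> = k i j" using c x by (intro kernel_increments)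
    also have "\<dots> = (\<Sum>l<n. v i l * v j l)" using c by (simp add: gram)
    finally show "(\<Sum>l<n. (v (x \<otimes> i) l - v x l) * (v (x \<otimes> j) l - v x l)) = (\<Sum>l<n. v i l * v j l)" .
  qed
  \<comment> \<open>\<open>H\<close> reads \<open>z\<close> on \<open>K\<close> only, so it can be
    evaluated on the restriction and integrated against a law on a finite product.\<close>
  have H_distr: "(\<integral>\<^sup>+\<xi>. H (\<lambda>h. lin n (a h) \<xi>) \<partial>gauss) =
      (\<integral>\<^sup>+z. H z \<partial>distr gauss (\<Pi>\<^sub>M i\<in>K. borel) (\<lambda>\<xi>. \<lambda>h\<in>K. lin n (a h) \<xi>))" for a
  proof -
    have "H (\<lambda>h. lin n (a h) \<xi>) = H (\<lambda>h\<in>K. lin n (a h) \<xi>)" for \<xi>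
      unfolding H_def using E_cong[of "\<lambda>h. lin n (a h) \<xi>" "\<lambda>h\<in>K. lin n (a h) \<xi>"] by simp
    then show ?thesis using H_meas
      by (subst nn_integral_distr) (auto intro!: measurable_restrict)
  qed
  \<comment> \<open>For fixed \<open>\<xi>\<close> the number \<open>field x \<xi>\<close> is a
    constant, so \<open>H_shift\<close> removes it pointwise; no independence from the increments is
    involved.\<close>
  have "(\<integral>\<^sup>+\<xi>. H (\<lambda>h. field (x \<otimes> h) \<xi>) \<partial>gauss) = (\<integral>\<^sup>+\<xi>. H (\<lambda>h. lin n (\<lambda>l. v (x \<otimes> h) l - v x l) \<xi>) \<partial>gauss)"
  proof (rule nn_integral_cong)
    fix \<xi>
    have "field (x \<otimes> h) \<xi> = lin n (\<lambda>l. v (x \<otimes> h) l - v x l) \<xi> + field x \<xi>" if "h \<in> K" for h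
      using that K x n by (simp add: field_eq_lin[of _ n] subset_iff)
        (simp add: lin_def sum_subtractf algebra_simps)
    then have "E (\<lambda>h. field (x \<otimes> h) \<xi>) = E (\<lambda>h. lin n (\<lambda>l. v (x \<otimes> h) l - v x l) \<xi> + field x \<xi>)"
      by (rule E_cong)
    then have "H (\<lambda>h. field (x \<otimes> h) \<xi>) = H (\<lambda>h. lin n (\<lambda>l. v (x \<otimes> h) l - v x l) \<xi> + field x \<xi>)"
      unfolding H_def by simp
    then show "H (\<lambda>h. field (x \<otimes> h) \<xi>) = H (\<lambda>h. lin n (\<lambda>l. v (x \<otimes> h) l - v x l) \<xi>)"
      unfolding H_shift .
  qed
  also have "\<dots> = (\<integral>\<^sup>+\<xi>. H (\<lambda>h. lin n (v h) \<xi>) \<partial>gauss)"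
    unfolding H_distr law ..
  also have "\<dots> = (\<integral>\<^sup>+\<xi>. H (\<lambda>h. field (\<one> \<otimes> h) \<xi>) \<partial>gauss)"
  proof (rule nn_integral_cong)
    fix \<xi>
    have "E (\<lambda>h. lin n (v h) \<xi>) = E (\<lambda>h. field (\<one> \<otimes> h) \<xi>)"
      using K n by (intro E_cong) (auto simp: field_eq_lin[of _ n] subset_iff)
    then show "H (\<lambda>h. lin n (v h) \<xi>) = H (\<lambda>h. field (\<one> \<otimes> h) \<xi>)"
      unfolding H_def by simp
  qed
  finally have "emeasure (gauss \<Otimes>\<^sub>M unif) {p \<in> space (gauss \<Otimes>\<^sub>M unif). \<forall>g\<in>F. uncut \<kappa> (x \<otimes> g) p} =
    emeasure (gauss \<Otimes>\<^sub>M unif) {p \<in> space (gauss \<Otimes>\<^sub>M unif). \<forall>g\<in>F. uncut \<kappa> (\<one> \<otimes> g) p}"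
    unfolding emeasure_eq[OF x] emeasure_eq[OF one_closed] .
  also have "{p \<in> space (gauss \<Otimes>\<^sub>M unif). \<forall>g\<in>F. uncut \<kappa> (\<one> \<otimes> g) p} = {p \<in> space (gauss \<Otimes>\<^sub>M unif). \<forall>g\<in>F. uncut \<kappa> g p}"
    using F by (auto simp: subset_iff)
  finally show ?thesis .
qed

end

section \<open>Invariance, density and decay\<close>

interpretation gauss_unif: pair_prob_space gauss unif ..

lemma gauss_unif_fst:
  assumes [measurable]: "Measurable.pred gauss Q"
  shows "gauss_unif.prob {p \<in> space (gauss \<Otimes>\<^sub>M unif). Q (fst p)} = gauss.prob {\<xi> \<in> space gauss. Q \<xi>}"
proof -
  have "{p \<in> space (gauss \<Otimes>\<^sub>M unif). Q (fst p)} = {\<xi> \<in> space gauss. Q \<xi>} \<times> space unif"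
    by (auto simp: space_pair_measure)
  then have "emeasure (gauss \<Otimes>\<^sub>M unif) {p \<in> space (gauss \<Otimes>\<^sub>M unif). Q (fst p)} = emeasure gauss {\<xi> \<in> space gauss. Q \<xi>}"
    by (simp only: unif.emeasure_space_1 mult_1_right) (subst unif.emeasure_pair_measure_Times, auto simp: unif.emeasure_space_1[simplified])
  then show ?thesis by (simp add: measure_def)
qed

text \<open>At \<open>u = 0\<close> an arbitrarily small negative field value changes the floor; for
  \<open>u\<close> inside the interval small values do not.\<close>

lemma AE_gauss_unif_snd: "AE p in gauss \<Otimes>\<^sub>M unif. 0 < snd p \<and> snd p < 1"
proof -
  have u: "AE u in unif. 0 < u \<and> u < 1"
    unfolding unif_def using AE_lborel_singleton[of 0]
    by (subst AE_density) (auto simp: indicator_def elim!: eventually_mono)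
  have "AE \<xi> in gauss. AE u in unif. 0 < snd (\<xi>, u) \<and> snd (\<xi>, u) < 1"
    unfolding snd_conv by (rule AE_I2) (rule u)
  then show ?thesis by (rule gauss_unif.AE_pair_measure[rotated]) measurable
qed

context gaussian_cuts
begin

lemma emeasure_cut_percolation:
  assumes [measurable]: "Measurable.pred (config_space G) Q"
  shows "emeasure (cut_percolation \<kappa>) {\<omega> \<in> Pow (carrier G). Q \<omega>} =
    emeasure (gauss \<Otimes>\<^sub>M unif) {p \<in> space (gauss \<Otimes>\<^sub>M unif). Q (cut_config \<kappa> p)}"
proof -
  have "{\<omega> \<in> Pow (carrier G). Q \<omega>} \<in> sets (config_space G)"
    using assms by (simp add: pred_def space_config)
  moreover have "cut_config \<kappa> -` {\<omega> \<in> Pow (carrier G). Q \<omega>} \<inter> space (gauss \<Otimes>\<^sub>M unif) =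
      {p \<in> space (gauss \<Otimes>\<^sub>M unif). Q (cut_config \<kappa> p)}"
    by (auto simp: cut_config_def)
  ultimately show ?thesis
    unfolding cut_percolation_def by (subst emeasure_distr) auto
qed

lemma space_cut_percolation: "space (cut_percolation \<kappa>) = Pow (carrier G)"
  by (simp add: cut_percolation_def space_config)

lemma measure_cut_percolation:
  assumes "Measurable.pred (config_space G) Q"
  shows "measure (cut_percolation \<kappa>) {\<omega> \<in> space (cut_percolation \<kappa>). Q \<omega>} =
    gauss_unif.prob {p \<in> space (gauss \<Otimes>\<^sub>M unif). Q (cut_config \<kappa> p)}"
  unfolding space_cut_percolation using emeasure_cut_percolation[OF assms, of \<kappa>] by (simp add: measure_def)

lemma invariant_cut_percolation: "invariant_percolation G (cut_percolation \<kappa>)"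
proof -
  have pr: "prob_space (cut_percolation \<kappa>)"
    unfolding cut_percolation_def by (rule gauss_unif.prob_space_distr) measurable
  have sets: "sets (cut_percolation \<kappa>) = sets (config_space G)" by (simp add: cut_percolation_def)
  have "distr (cut_percolation \<kappa>) (config_space G) (\<lambda>\<omega>. x <#\<^bsub>G\<^esub> \<omega>) = cut_percolation \<kappa>" if x: "x \<in> carrier G" for x
  proof (rule config_measure_eqI)
    have tr [measurable]: "(\<lambda>\<omega>. x <#\<^bsub>G\<^esub> \<omega>) \<in> cut_percolation \<kappa> \<rightarrow>\<^sub>M config_space G"
      using measurable_translate_config[OF x] by (simp add: measurable_cong_sets[OF sets])
    then show "prob_space (distr (cut_percolation \<kappa>) (config_space G) (\<lambda>\<omega>. x <#\<^bsub>G\<^esub> \<omega>))"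
      by (rule prob_space.prob_space_distr[OF pr])
    fix F assume F: "finite F" "F \<subseteq> carrier G"
    note [measurable] = pred_member_config
    \<comment> \<open>Translating the configuration by \<open>x\<close> turns the event for
      \<open>F\<close> into the event for the translate of \<open>F\<close> by \<open>inv x\<close>,
      so \<open>emeasure_uncut_mult\<close> is applied at \<open>inv x\<close>.\<close>
    have inv: "F \<subseteq> x <#\<^bsub>G\<^esub> \<omega> \<longleftrightarrow> (\<forall>g\<in>F. inv x \<otimes> g \<in> \<omega>)" if \<omega>: "\<omega> \<subseteq> carrier G" for \<omega>
    proof -
      have "g \<in> x <#\<^bsub>G\<^esub> \<omega> \<longleftrightarrow> inv x \<otimes> g \<in> \<omega>" if "g \<in> carrier G" for g
        using x \<omega> that by (force simp: l_coset_def subset_iff m_assoc[symmetric] intro: bexI[of _ "inv x \<otimes> g"])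
      then show ?thesis using F by blast
    qed
    have "{\<omega> \<in> Pow (carrier G). F \<subseteq> \<omega>} \<in> sets (config_space G)"
    proof -
      have "Measurable.pred (config_space G) (\<lambda>\<omega>. \<forall>g\<in>F. g \<in> \<omega>)" using F by measurable
      moreover have "{\<omega> \<in> Pow (carrier G). F \<subseteq> \<omega>} = {\<omega> \<in> space (config_space G). \<forall>g\<in>F. g \<in> \<omega>}"
        by (auto simp: space_config)
      ultimately show ?thesis by (simp add: pred_def)
    qed
    then have "emeasure (distr (cut_percolation \<kappa>) (config_space G) (\<lambda>\<omega>. x <#\<^bsub>G\<^esub> \<omega>)) {\<omega> \<in> Pow (carrier G). F \<subseteq> \<omega>} =
      emeasure (cut_percolation \<kappa>) ((\<lambda>\<omega>. x <#\<^bsub>G\<^esub> \<omega>) -` {\<omega> \<in> Pow (carrier G). F \<subseteq> \<omega>} \<inter> space (cut_percolation \<kappa>))"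
      by (rule emeasure_distr[OF tr])
    also have "(\<lambda>\<omega>. x <#\<^bsub>G\<^esub> \<omega>) -` {\<omega> \<in> Pow (carrier G). F \<subseteq> \<omega>} \<inter> space (cut_percolation \<kappa>) =
        {\<omega> \<in> Pow (carrier G). \<forall>g\<in>F. inv x \<otimes> g \<in> \<omega>}"
      using inv l_coset_subset_G[OF _ x] unfolding space_cut_percolation vimage_def by blast
    also have "emeasure (cut_percolation \<kappa>) \<dots> =
        emeasure (gauss \<Otimes>\<^sub>M unif) {p \<in> space (gauss \<Otimes>\<^sub>M unif). \<forall>g\<in>F. inv x \<otimes> g \<in> cut_config \<kappa> p}"
      using F by (intro emeasure_cut_percolation) measurable
    also have "{p \<in> space (gauss \<Otimes>\<^sub>M unif). \<forall>g\<in>F. inv x \<otimes> g \<in> cut_config \<kappa> p} =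
        {p \<in> space (gauss \<Otimes>\<^sub>M unif). \<forall>g\<in>F. uncut \<kappa> (inv x \<otimes> g) p}"
      using F x by (auto simp: cut_config_def subset_iff)
    also have "emeasure (gauss \<Otimes>\<^sub>M unif) \<dots> = emeasure (gauss \<Otimes>\<^sub>M unif) {p \<in> space (gauss \<Otimes>\<^sub>M unif). \<forall>g\<in>F. uncut \<kappa> g p}"
      using x F by (intro emeasure_uncut_mult) auto
    also have "{p \<in> space (gauss \<Otimes>\<^sub>M unif). \<forall>g\<in>F. uncut \<kappa> g p} = {p \<in> space (gauss \<Otimes>\<^sub>M unif). \<forall>g\<in>F. g \<in> cut_config \<kappa> p}"
      using F by (auto simp: cut_config_def subset_iff)
    also have "emeasure (gauss \<Otimes>\<^sub>M unif) \<dots> = emeasure (cut_percolation \<kappa>) {\<omega> \<in> Pow (carrier G). \<forall>g\<in>F. g \<in> \<omega>}"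
      using F by (intro emeasure_cut_percolation[symmetric]) measurable
    also have "{\<omega> \<in> Pow (carrier G). \<forall>g\<in>F. g \<in> \<omega>} = {\<omega> \<in> Pow (carrier G). F \<subseteq> \<omega>}" by auto
    finally show "emeasure (distr (cut_percolation \<kappa>) (config_space G) (\<lambda>\<omega>. x <#\<^bsub>G\<^esub> \<omega>)) {\<omega> \<in> Pow (carrier G). F \<subseteq> \<omega>} =
      emeasure (cut_percolation \<kappa>) {\<omega> \<in> Pow (carrier G). F \<subseteq> \<omega>}" .
  qed (simp_all add: sets)
  then show ?thesis using pr sets by (simp add: invariant_percolation_def site_percolation_def)
qed

text \<open>For \<open>0 < u < 1\<close> the values \<open>\<kappa> * field g \<xi> + u\<close> at
  the identity and its finitely many neighbors tend to \<open>u\<close> as \<open>\<kappa>\<close>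
  tends to 0, so their floors are eventually all 0. Dominated convergence then gives the limit,
  without a rate.\<close>

lemma cut_percolation_density:
  "(\<lambda>n. measure (cut_percolation (1 / real (Suc n)))
     {\<omega> \<in> space (cut_percolation (1 / real (Suc n))). \<one> \<in> \<omega>}) \<longlonglongrightarrow> 1"
proof -
  have eq: "measure (cut_percolation \<kappa>) {\<omega> \<in> space (cut_percolation \<kappa>). \<one> \<in> \<omega>} =
      (\<integral>p. of_bool (uncut \<kappa> \<one> p) \<partial>(gauss \<Otimes>\<^sub>M unif))" for \<kappa>
  proof -
    have "measure (cut_percolation \<kappa>) {\<omega> \<in> space (cut_percolation \<kappa>). \<one> \<in> \<omega>} =
        gauss_unif.prob {p \<in> space (gauss \<Otimes>\<^sub>M unif). uncut \<kappa> \<one> p}"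
      by (subst measure_cut_percolation[OF pred_member_config]) (simp add: cut_config_def)
    also have "\<dots> = (\<integral>p. indicator {p \<in> space (gauss \<Otimes>\<^sub>M unif). uncut \<kappa> \<one> p} p \<partial>(gauss \<Otimes>\<^sub>M unif))"
      by (simp add: Collect_conj_eq Int_ac)
    also have "\<dots> = (\<integral>p. of_bool (uncut \<kappa> \<one> p) \<partial>(gauss \<Otimes>\<^sub>M unif))"
      by (rule Bochner_Integration.integral_cong) (auto simp: indicator_def)
    finally show ?thesis .
  qed
  have "(\<lambda>n. \<integral>p. of_bool (uncut (1 / real (Suc n)) \<one> p) \<partial>(gauss \<Otimes>\<^sub>M unif)) \<longlonglongrightarrow>
      (\<integral>p. (1 :: real) \<partial>(gauss \<Otimes>\<^sub>M unif))"
  proof (rule integral_dominated_convergence[where w="\<lambda>_. 1"])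
    show "AE p in gauss \<Otimes>\<^sub>M unif. (\<lambda>n. of_bool (uncut (1 / real (Suc n)) \<one> p)) \<longlonglongrightarrow> (1 :: real)"
      using AE_gauss_unif_snd
    proof eventually_elim
      case (elim p)
      obtain \<xi> u where p: "p = (\<xi>, u)" by (cases p)
      have floor0: "\<forall>\<^sub>F n in sequentially. \<lfloor>1 / real (Suc n) * field g \<xi> + u\<rfloor> = 0" for g
      proof -
        have "(\<lambda>n. 1 / real (Suc n) * field g \<xi> + u) \<longlonglongrightarrow> 0 * field g \<xi> + u"
          by (intro tendsto_intros LIMSEQ_Suc[OF lim_1_over_n])
        then have "\<forall>\<^sub>F n in sequentially. 0 < 1 / real (Suc n) * field g \<xi> + u"
          "\<forall>\<^sub>F n in sequentially. 1 / real (Suc n) * field g \<xi> + u < 1"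
          using elim p by (auto dest: order_tendstoD)
        then show ?thesis by eventually_elim (simp add: floor_eq_iff)
      qed
      have "\<forall>\<^sub>F n in sequentially. \<forall>s\<in>S. \<lfloor>1 / real (Suc n) * field (\<one> \<otimes> s) \<xi> + u\<rfloor> = 0"
        using finite_generators floor0 by (intro eventually_ball_finite) auto
      then have "\<forall>\<^sub>F n in sequentially. uncut (1 / real (Suc n)) \<one> p"
        using floor0[of \<one>] unfolding uncut_def p by eventually_elim simp
      then show ?case by (intro tendsto_eventually) (auto elim: eventually_mono)
    qed
  qed auto
  then show ?thesis unfolding eq by (simp add: gauss_unif.prob_space)
qed

text \<open>Every step of an open path starts at an uncut vertex and hence stays in its level
  set.\<close>

lemma connected_in_cut_config:
  assumes "connected_in (cut_config \<kappa> (\<xi>, u)) g h"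
  shows "\<lfloor>\<kappa> * field g \<xi> + u\<rfloor> = \<lfloor>\<kappa> * field h \<xi> + u\<rfloor>"
proof -
  have "(g, h) \<in> (Restr edges (cut_config \<kappa> (\<xi>, u)))\<^sup>*"
    using assms by (simp add: connected_in_def)
  then show ?thesis
  proof induction
    case (step h l)
    then obtain s where "s \<in> S" "l = h \<otimes> s" "uncut \<kappa> h (\<xi>, u)"
      by (auto simp: cayley_edges_def cut_config_def)
    then show ?case using step.IH by (auto simp: uncut_def)
  qed simp
qed

text \<open>Numbers with equal floors differ by less than 1, and \<open>u\<close> cancels in the
  difference. A connection thus forces the Gaussian increment, of variance
  \<open>kernel_dist k g h\<close>, below \<open>1 / \<kappa>\<close>, and the small ball estimate
  applies.\<close>

lemma cut_percolation_two_point_le: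
  assumes \<kappa>: "0 < \<kappa>" and gh: "g \<in> carrier G" "h \<in> carrier G" and D: "0 < kernel_dist k g h"
  shows "two_point G S (cut_percolation \<kappa>) g h \<le> 2 / \<kappa> / sqrt (kernel_dist k g h)"
proof -
  define n where "n = max (N g) (N h)"
  define a where "a l = v g l - v h l" for l
  have sq: "(\<Sum>l<n. (a l)\<^sup>2) = kernel_dist k g h"
  proof -
    have "(\<Sum>l<n. (a l)\<^sup>2) = (\<Sum>l<n. v g l * v g l) + (\<Sum>l<n. v h l * v h l) - 2 * (\<Sum>l<n. v g l * v h l)"
      by (simp add: a_def power2_eq_square algebra_simps sum.distrib sum_subtractf sum_distrib_left)
    then show ?thesis using gh by (simp add: gram n_def kernel_dist_def)
  qed
  have lin_a: "lin n a \<xi> = field g \<xi> - field h \<xi>" for \<xi>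
    using gh by (simp add: field_eq_lin[of _ n] n_def) (simp add: lin_def a_def sum_subtractf algebra_simps)
  have "two_point G S (cut_percolation \<kappa>) g h =
      gauss_unif.prob {p \<in> space (gauss \<Otimes>\<^sub>M unif). connected_in (cut_config \<kappa> p) g h}"
    unfolding two_point_def clusters_iff by (rule measure_cut_percolation[OF pred_connected_in_config])
  also have "\<dots> \<le> gauss_unif.prob {p \<in> space (gauss \<Otimes>\<^sub>M unif). \<bar>lin n a (fst p)\<bar> < 1 / \<kappa>}"
  proof (rule gauss_unif.finite_measure_mono)
    show "{p \<in> space (gauss \<Otimes>\<^sub>M unif). connected_in (cut_config \<kappa> p) g h} \<subseteq>
      {p \<in> space (gauss \<Otimes>\<^sub>M unif). \<bar>lin n a (fst p)\<bar> < 1 / \<kappa>}"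
    proof safe
      fix \<xi> u assume "connected_in (cut_config \<kappa> (\<xi>, u)) g h"
      then have "\<bar>\<kappa> * field g \<xi> - \<kappa> * field h \<xi>\<bar> < 1"
        using connected_in_cut_config[of \<kappa> \<xi> u g h] by linarith
      then have "\<kappa> * \<bar>lin n a \<xi>\<bar> < 1"
        using \<kappa> unfolding lin_a by (simp add: abs_mult flip: right_diff_distrib)
      then show "\<bar>lin n a (fst (\<xi>, u))\<bar> < 1 / \<kappa>" using \<kappa> by (simp add: field_simps)
    qed
  qed measurable
  also have "\<dots> = gauss.prob {\<xi> \<in> space gauss. \<bar>lin n a \<xi>\<bar> < 1 / \<kappa>}"
    by (rule gauss_unif_fst) measurable
  also have "\<dots> \<le> 2 * (1 / \<kappa>) / sqrt (\<Sum>l<n. (a l)\<^sup>2)"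
    using D \<kappa> by (intro gauss_small_ball) (simp_all add: sq)
  finally show ?thesis by (simp add: sq)
qed

lemma cut_percolation_vanishes:
  assumes \<kappa>: "0 < \<kappa>" and inf: "infinite (carrier G)"
  shows "vanishes_at_infinity G S (two_point G S (cut_percolation \<kappa>))"
proof (rule vanishes_at_infinityI[OF inf])
  show "0 \<le> two_point G S (cut_percolation \<kappa>) g h" for g h by (simp add: two_point_def)
  fix e :: real assume e: "0 < e"
  \<comment> \<open>The kernel distance at which the bound of
    \<open>cut_percolation_two_point_le\<close> equals \<open>e\<close>.\<close>
  define R where "R = (2 / \<kappa> / e)\<^sup>2"
  have "finite (cayley_dist G S \<one> ` {x \<in> carrier G. kernel_dist k \<one> x \<le> R})"
    using kernel_proper by blast
  \<comment> \<open>By properness finitely many elements have kernel distance at most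
    \<open>R\<close> from the identity; \<open>r\<close> bounds their word lengths. Left invariance
    of both distances carries this to all pairs.\<close>
  then obtain r where r: "\<forall>d\<in>cayley_dist G S \<one> ` {x \<in> carrier G. kernel_dist k \<one> x \<le> R}. d \<le> r"
    unfolding finite_nat_set_iff_bounded_le by blast
  show "\<exists>r. \<forall>g\<in>carrier G. \<forall>h\<in>carrier G. r < cayley_dist G S g h \<longrightarrow> two_point G S (cut_percolation \<kappa>) g h \<le> e"
  proof (intro exI[of _ r] ballI impI)
    fix g h assume gh: "g \<in> carrier G" "h \<in> carrier G" and d: "r < cayley_dist G S g h"
    define x where "x = inv g \<otimes> h"
    have x: "x \<in> carrier G" "g \<otimes> x = h" using gh by (simp_all add: x_def m_assoc[symmetric])
    have "cayley_dist G S \<one> x = cayley_dist G S g h"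
      using cayley_dist_mult[of g \<one> x] gh x by simp
    then have "R < kernel_dist k \<one> x" using r d x by (metis (no_types, lifting) image_eqI leD mem_Collect_eq not_le)
    then have D: "R < kernel_dist k g h"
      using kernel_dist_mult[of g \<one> x] gh x by simp
    have R: "0 \<le> R" by (simp add: R_def)
    have sR: "sqrt R = 2 / \<kappa> / e" using \<kappa> e by (simp add: R_def)
    have "two_point G S (cut_percolation \<kappa>) g h \<le> 2 / \<kappa> / sqrt (kernel_dist k g h)"
      using cut_percolation_two_point_le[OF \<kappa> gh] D R by simp
    also have "\<dots> \<le> 2 / \<kappa> / sqrt R"
    proof (rule divide_left_mono)
      show "sqrt R \<le> sqrt (kernel_dist k g h)" using D by simp
      have "0 < sqrt R" unfolding sR using \<kappa> e by simp
      then show "0 < sqrt (kernel_dist k g h) * sqrt R" using D by simp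
    qed (use \<kappa> in simp)
    also have "\<dots> = e" unfolding sR using \<kappa> e by simp
    finally show "two_point G S (cut_percolation \<kappa>) g h \<le> e" .
  qed
qed

end

text \<open>The decay holds for every positive \<open>\<kappa>\<close>, so \<open>\<kappa>\<close>
  can be made as small as the required density \<open>\<alpha>\<close> demands.\<close>

lemma (in cayley_graph) percolation_if_haagerup_kernel:
  assumes k: "haagerup_kernel G k" and inf: "infinite (carrier G)" and "\<alpha> < 1"
  shows "\<exists>P. invariant_percolation G P \<and> measure P {\<omega> \<in> space P. \<one> \<in> \<omega>} > \<alpha> \<and>
    vanishes_at_infinity G S (two_point G S P)"
proof -
  have "psd_on (carrier G) k" using k by (simp add: haagerup_kernel_def)
  then obtain v :: "'a \<Rightarrow> nat \<Rightarrow> real" and N where v: "\<forall>x\<in>carrier G. \<forall>l\<ge>N x. v x l = 0"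
    "\<forall>x\<in>carrier G. \<forall>y\<in>carrier G. k x y = (\<Sum>l<N x. v x l * v y l)"
    using psd_on_gram[OF _ countable_carrier] one_closed by blast
  interpret gaussian_cuts G S k v N
    by unfold_locales (use k v in auto)
  obtain n where "measure (cut_percolation (1 / real (Suc n)))
     {\<omega> \<in> space (cut_percolation (1 / real (Suc n))). \<one> \<in> \<omega>} > \<alpha>"
    using order_tendstoD(1)[OF cut_percolation_density \<open>\<alpha> < 1\<close>] by (auto dest: eventually_happens)
  then show ?thesis
    using invariant_cut_percolation cut_percolation_vanishes[OF _ inf, of "1 / real (Suc n)"] by auto
qed

theorem theorem3p10:
  fixes G :: "('a, 'b) monoid_scheme" and S :: "'a set"
  assumes "group G"
    and "infinite (carrier G)"
    and "finite S"
    and "symmetric_set G S"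
    and "generating_set G S"
  shows "haagerup_property TYPE('i + nat \<Rightarrow> real) G \<longleftrightarrow>
    (\<forall>\<alpha><1::real. \<exists>P. invariant_percolation G P \<and>
       measure P {\<omega> \<in> space P. \<one>\<^bsub>G\<^esub> \<in> \<omega>} > \<alpha> \<and>
       vanishes_at_infinity G S (two_point G S P))"
proof -
  interpret cayley_graph G S
    using assms by (simp add: cayley_graph_def cayley_graph_axioms_def)
  show ?thesis
  proof
    assume "haagerup_property TYPE('i + nat \<Rightarrow> real) G"
    then obtain k where "haagerup_kernel G k" using haagerup_kernel_if_property by blast
    then show "\<forall>\<alpha><1::real. \<exists>P. invariant_percolation G P \<and>
       measure P {\<omega> \<in> space P. \<one>\<^bsub>G\<^esub> \<in> \<omega>} > \<alpha> \<and> vanishes_at_infinity G S (two_point G S P)"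
      using percolation_if_haagerup_kernel assms(2) by blast
  next
    assume "\<forall>\<alpha><1::real. \<exists>P. invariant_percolation G P \<and>
       measure P {\<omega> \<in> space P. \<one>\<^bsub>G\<^esub> \<in> \<omega>} > \<alpha> \<and> vanishes_at_infinity G S (two_point G S P)"
    then obtain k where "haagerup_kernel G k" using haagerup_kernel_if_percolation by blast
    then show "haagerup_property TYPE('i + nat \<Rightarrow> real) G"
      using haagerup_property_if_kernel countable_carrier by blast
  qed
qed

end
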